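(* For $n\in\{3,4\}$ let $\sigma$ be the dynamics on $C^*(B_n^+)$ given by $\sigma_t(v_p)=e^{it\ell(p)}v_p$, where $\ell$ is the normalised length function on the braid monoid $B_n^+$. (1) Let $t_1=\sqrt5/2-1/2$ be the smallest positive root of the clique polynomial $1-2t+t^3$ of $B_3^+$, and let $a=-\log t_1$. Then the inverse temperature space of $(C^*(B_3^+),\sigma)$ is $\{0\}\cup[a,\infty]$. (2) Let $r_1$ be the smallest positive root of $1-2t-t^2+t^3+t^4+t^5$, and let $b=-\log r_1$. Then the inverse temperature space of $(C^*(B_4^+),\sigma)$ is $\{0\}\cup[b,\infty]$.
   Context: $B_n^+$ is the monoid generated by $s_1,\dots,s_{n-1}$ with relations $s_is_js_i=s_js_is_j$ when $|i-j|=1$ and $s_is_j=s_js_i$ when $|i-j|\ge2$; $\ell:B_n^+\to\mathbb{N}$ is the monoid homomorphism with $\ell(s_i)=1$. For $P=B_n^+$, any finite nonempty $K\subset P$ has a least common right multiple $\vee K$, with $\bigcap_{k\in K}kP=(\vee K)P$. The clique polynomial of $B_n^+$ is $1+\sum_{\emptyset\ne K\subset\{s_1,\dots,s_{n-1}\}}(-1)^{|K|}t^{\ell(\vee K)}$. $C^*(P)$ is the full (Nica covariant) semigroup $C^*$-algebra: the universal unital $C^*$-algebra generated by isometries $v_p$, $p\in P$, with $v_e=1$, $v_pv_q=v_{pq}$ and $v_pv_p^*v_qv_q^*=v_{p\vee q}v_{p\vee q}^*$. A state $\phi$ is a $\mathrm{KMS}_\beta$-state ($\beta\in\mathbb{R}$)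 if $\phi(xy)=\phi(y\sigma_{i\beta}(x))$ for all $x,y$ with $x$ $\sigma$-analytic; a $\mathrm{KMS}_\infty$-state is a weak-$*$ limit of $\mathrm{KMS}_{\beta_k}$-states with $\beta_k\to\infty$. The inverse temperature space is the set of $\beta\in(-\infty,\infty]$ for which a $\mathrm{KMS}_\beta$-state exists. *)

theory Defs
  imports
    "HOL-Analysis.Analysis"
    "HOL-Algebra.Coset"
    "HOL-Algebra.Ring"
    "HOL-Computational_Algebra.Polynomial"
begin

section \<open>Braid monoids\<close>

text \<open>Words are lists over \<open>{1..<n}\<close>, the letter \<open>i\<close> standing for \<open>s\<^sub>i\<close>; elements of the monoid are
  classes of words modulo the congruence generated by the braid relations.\<close>

inductive braid_eq :: "nat \<Rightarrow> nat list \<Rightarrow> nat list \<Rightarrow> bool" for n :: nat where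
  refl: "set w \<subseteq> {1..<n} \<Longrightarrow> braid_eq n w w"
| sym: "braid_eq n u w \<Longrightarrow> braid_eq n w u"
| trans: "braid_eq n u w \<Longrightarrow> braid_eq n w x \<Longrightarrow> braid_eq n u x"
| braid: "set u \<subseteq> {1..<n} \<Longrightarrow> set w \<subseteq> {1..<n} \<Longrightarrow> i \<in> {1..<n} \<Longrightarrow> j \<in> {1..<n} \<Longrightarrow>
    i = j + 1 \<or> j = i + 1 \<Longrightarrow> braid_eq n (u @ [i, j, i] @ w) (u @ [j, i, j] @ w)"
| commute: "set u \<subseteq> {1..<n} \<Longrightarrow> set w \<subseteq> {1..<n} \<Longrightarrow> i \<in> {1..<n} \<Longrightarrow> j \<in> {1..<n} \<Longrightarrow>
    i \<ge> j + 2 \<or> j \<ge> i + 2 \<Longrightarrow> braid_eq n (u @ [i, j] @ w) (u @ [j, i] @ w)"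

definition braid_class :: "nat \<Rightarrow> nat list \<Rightarrow> nat list set" where
  "braid_class n w = {u. braid_eq n w u}"

definition braid_monoid :: "nat \<Rightarrow> nat list set monoid" where
  "braid_monoid n =
    \<lparr> carrier = braid_class n ` lists {1..<n},
      mult = (\<lambda>X Y. \<Union>u\<in>X. \<Union>w\<in>Y. braid_class n (u @ w)),
      one = braid_class n [] \<rparr>"

definition braid_gen :: "nat \<Rightarrow> nat \<Rightarrow> nat list set" where
  "braid_gen n i = braid_class n [i]"

text \<open>The relations preserve word length, so all words in a class have the same length;
  see \<open>braid_length_class\<close>, \<open>braid_length_gen\<close> and \<open>braid_length_mult\<close> below.\<close>

definition braid_length :: "nat list set \<Rightarrow> nat" where
  "braid_length X = the_elem (length ` X)"

lemma braid_eq_length: "braid_eq n u w \<Longrightarrow> length u = length w"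
  by (induction rule: braid_eq.induct) auto

lemma braid_eq_set: "braid_eq n u w \<Longrightarrow> set u \<subseteq> {1..<n} \<and> set w \<subseteq> {1..<n}"
  by (induction rule: braid_eq.induct) auto

lemma braid_eq_context:
  "braid_eq n u w \<Longrightarrow> set x \<subseteq> {1..<n} \<Longrightarrow> set y \<subseteq> {1..<n} \<Longrightarrow>
    braid_eq n (x @ u @ y) (x @ w @ y)"
proof (induction rule: braid_eq.induct)
  case (refl w) then show ?case by (intro braid_eq.refl) auto
next
  case (sym u w) then show ?case by (blast intro: braid_eq.sym)
next
  case (trans u w z) then show ?case by (blast intro: braid_eq.trans)
next
  case (braid u w i j)
  then show ?case using braid_eq.braid[of "x @ u" n "w @ y" i j] by simp
next
  case (commute u w i j)
  then show ?case using braid_eq.commute[of "x @ u" n "w @ y" i j] by simp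
qed

lemma braid_eq_append:
  assumes "braid_eq n u u'" "braid_eq n w w'"
  shows "braid_eq n (u @ w) (u' @ w')"
proof -
  have "braid_eq n (u @ w) (u' @ w)"
    using braid_eq_context[OF assms(1), of "[]" w] braid_eq_set[OF assms(2)] by simp
  moreover have "braid_eq n (u' @ w) (u' @ w')"
    using braid_eq_context[OF assms(2), of u' "[]"] braid_eq_set[OF assms(1)] by simp
  ultimately show ?thesis by (rule braid_eq.trans)
qed

lemma braid_class_eq_iff:
  assumes "set u \<subseteq> {1..<n}"
  shows "braid_class n u = braid_class n w \<longleftrightarrow> braid_eq n u w"
proof
  have "u \<in> braid_class n u"
    using braid_eq.refl[OF assms] by (simp add: braid_class_def)
  moreover assume "braid_class n u = braid_class n w"
  ultimately have "u \<in> braid_class n w" by simp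
  then have "braid_eq n w u" by (simp add: braid_class_def)
  then show "braid_eq n u w" by (rule braid_eq.sym)
next
  assume uw: "braid_eq n u w"
  have "braid_eq n u x \<longleftrightarrow> braid_eq n w x" for x
    using braid_eq.trans[OF uw] braid_eq.trans[OF braid_eq.sym[OF uw]] by blast
  then show "braid_class n u = braid_class n w"
    by (simp add: braid_class_def)
qed

lemma braid_class_mult:
  assumes "set u \<subseteq> {1..<n}" "set w \<subseteq> {1..<n}"
  shows "braid_class n u \<otimes>\<^bsub>braid_monoid n\<^esub> braid_class n w = braid_class n (u @ w)"
proof -
  have "braid_class n (u' @ w') = braid_class n (u @ w)"
    if "u' \<in> braid_class n u" "w' \<in> braid_class n w" for u' w'
  proof -
    have "braid_eq n (u @ w) (u' @ w')"
      using that by (auto simp: braid_class_def intro: braid_eq_append)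
    then show ?thesis
      using assms braid_class_eq_iff[of "u @ w" n "u' @ w'"] by simp
  qed
  moreover have "u \<in> braid_class n u" "w \<in> braid_class n w"
    using braid_eq.refl[OF assms(1)] braid_eq.refl[OF assms(2)]
    by (simp_all add: braid_class_def)
  ultimately have "(\<Union>u'\<in>braid_class n u. \<Union>w'\<in>braid_class n w. braid_class n (u' @ w'))
      = braid_class n (u @ w)"
    by blast
  then show ?thesis by (simp add: braid_monoid_def)
qed

lemma braid_monoid_carrierE:
  assumes "p \<in> carrier (braid_monoid n)"
  obtains w where "set w \<subseteq> {1..<n}" "p = braid_class n w"
  using assms by (auto simp: braid_monoid_def lists_eq_set)

lemma braid_class_carrier:
  "set w \<subseteq> {1..<n} \<Longrightarrow> braid_class n w \<in> carrier (braid_monoid n)"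
  by (auto simp: braid_monoid_def lists_eq_set)

lemma monoid_braid_monoid: "monoid (braid_monoid n)"
proof
  fix p q assume "p \<in> carrier (braid_monoid n)" "q \<in> carrier (braid_monoid n)"
  then obtain u w where "set u \<subseteq> {1..<n}" "p = braid_class n u"
    "set w \<subseteq> {1..<n}" "q = braid_class n w"
    by (elim braid_monoid_carrierE)
  then show "p \<otimes>\<^bsub>braid_monoid n\<^esub> q \<in> carrier (braid_monoid n)"
    by (simp add: braid_class_mult braid_class_carrier)
next
  fix p q r assume "p \<in> carrier (braid_monoid n)" "q \<in> carrier (braid_monoid n)"
    "r \<in> carrier (braid_monoid n)"
  then obtain u w x where "set u \<subseteq> {1..<n}" "p = braid_class n u"
    "set w \<subseteq> {1..<n}" "q = braid_class n w" "set x \<subseteq> {1..<n}" "r = braid_class n x"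
    by (elim braid_monoid_carrierE)
  then show "p \<otimes>\<^bsub>braid_monoid n\<^esub> q \<otimes>\<^bsub>braid_monoid n\<^esub> r
      = p \<otimes>\<^bsub>braid_monoid n\<^esub> (q \<otimes>\<^bsub>braid_monoid n\<^esub> r)"
    by (simp add: braid_class_mult)
next
  have one: "\<one>\<^bsub>braid_monoid n\<^esub> = braid_class n []" by (simp add: braid_monoid_def)
  show "\<one>\<^bsub>braid_monoid n\<^esub> \<in> carrier (braid_monoid n)"
    by (simp add: one braid_class_carrier)
  fix p assume "p \<in> carrier (braid_monoid n)"
  then obtain u where "set u \<subseteq> {1..<n}" "p = braid_class n u"
    by (elim braid_monoid_carrierE)
  then show "\<one>\<^bsub>braid_monoid n\<^esub> \<otimes>\<^bsub>braid_monoid n\<^esub> p = p" "p \<otimes>\<^bsub>braid_monoid n\<^esub> \<one>\<^bsub>braid_monoid n\<^esub> = p"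
    by (simp_all add: one braid_class_mult)
qed

lemma braid_length_class:
  assumes "set w \<subseteq> {1..<n}"
  shows "braid_length (braid_class n w) = length w"
proof -
  have "w \<in> braid_class n w"
    using assms by (simp add: braid_class_def braid_eq.refl)
  then have "length ` braid_class n w = {length w}"
    by (auto simp: braid_class_def dest: braid_eq_length)
  then show ?thesis by (simp add: braid_length_def)
qed

lemma braid_length_gen: "i \<in> {1..<n} \<Longrightarrow> braid_length (braid_gen n i) = 1"
  by (simp add: braid_gen_def braid_length_class)

lemma braid_length_one: "braid_length \<one>\<^bsub>braid_monoid n\<^esub> = 0"
  using braid_length_class[of "[]" n] by (simp add: braid_monoid_def)

lemma braid_length_mult:
  assumes "p \<in> carrier (braid_monoid n)" "q \<in> carrier (braid_monoid n)"
  shows "braid_length (p \<otimes>\<^bsub>braid_monoid n\<^esub> q) = braid_length p + braid_length q"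
  using assms by (elim braid_monoid_carrierE) (simp add: braid_class_mult braid_length_class)


section \<open>Least common right multiples and the clique polynomial\<close>

definition is_rlcm :: "'p monoid \<Rightarrow> 'p set \<Rightarrow> 'p \<Rightarrow> bool" where
  "is_rlcm P K m \<longleftrightarrow>
    m \<in> carrier P \<and> (\<Inter>k\<in>K. k <#\<^bsub>P\<^esub> carrier P) = m <#\<^bsub>P\<^esub> carrier P"

definition rlcm :: "'p monoid \<Rightarrow> 'p set \<Rightarrow> 'p" where
  "rlcm P K = (THE m. is_rlcm P K m)"

definition clique_polynomial :: "nat \<Rightarrow> real poly" where
  "clique_polynomial n =
    1 + (\<Sum>K \<in> Pow (braid_gen n ` {1..<n}) - {{}}.
          monom ((-1) ^ card K) (braid_length (rlcm (braid_monoid n) K)))"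

definition smallest_positive_root :: "real poly \<Rightarrow> real \<Rightarrow> bool" where
  "smallest_positive_root f r \<longleftrightarrow>
    r > 0 \<and> poly f r = 0 \<and> (\<forall>t. t > 0 \<and> poly f t = 0 \<longrightarrow> r \<le> t)"


section \<open>Unital C*-algebras\<close>

record 'a cstar = "'a ring" +
  cscale :: "complex \<Rightarrow> 'a \<Rightarrow> 'a"
  star :: "'a \<Rightarrow> 'a"
  cnorm :: "'a \<Rightarrow> real"

locale cstar_algebra = ring A for A :: "'a cstar" (structure) +
  assumes cscale_closed: "x \<in> carrier A \<Longrightarrow> cscale A c x \<in> carrier A"
    and cscale_add_right: "x \<in> carrier A \<Longrightarrow> y \<in> carrier A \<Longrightarrow>
      cscale A c (x \<oplus> y) = cscale A c x \<oplus> cscale A c y"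
    and cscale_add_left: "x \<in> carrier A \<Longrightarrow>
      cscale A (c + d) x = cscale A c x \<oplus> cscale A d x"
    and cscale_assoc: "x \<in> carrier A \<Longrightarrow> cscale A c (cscale A d x) = cscale A (c * d) x"
    and cscale_one: "x \<in> carrier A \<Longrightarrow> cscale A 1 x = x"
    and cscale_mult_left: "x \<in> carrier A \<Longrightarrow> y \<in> carrier A \<Longrightarrow>
      cscale A c x \<otimes> y = cscale A c (x \<otimes> y)"
    and cscale_mult_right: "x \<in> carrier A \<Longrightarrow> y \<in> carrier A \<Longrightarrow>
      x \<otimes> cscale A c y = cscale A c (x \<otimes> y)"
    and star_closed: "x \<in> carrier A \<Longrightarrow> star A x \<in> carrier A"
    and star_add: "x \<in> carrier A \<Longrightarrow> y \<in> carrier A \<Longrightarrow> star A (x \<oplus> y) = star A x \<oplus> star A y"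
    and star_cscale: "x \<in> carrier A \<Longrightarrow> star A (cscale A c x) = cscale A (cnj c) (star A x)"
    and star_mult: "x \<in> carrier A \<Longrightarrow> y \<in> carrier A \<Longrightarrow> star A (x \<otimes> y) = star A y \<otimes> star A x"
    and star_star: "x \<in> carrier A \<Longrightarrow> star A (star A x) = x"
    and cnorm_nonneg: "x \<in> carrier A \<Longrightarrow> 0 \<le> cnorm A x"
    and cnorm_eq_zero: "x \<in> carrier A \<Longrightarrow> cnorm A x = 0 \<longleftrightarrow> x = \<zero>"
    and cnorm_add: "x \<in> carrier A \<Longrightarrow> y \<in> carrier A \<Longrightarrow> cnorm A (x \<oplus> y) \<le> cnorm A x + cnorm A y"
    and cnorm_cscale: "x \<in> carrier A \<Longrightarrow> cnorm A (cscale A c x) = cmod c * cnorm A x"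
    and cnorm_mult: "x \<in> carrier A \<Longrightarrow> y \<in> carrier A \<Longrightarrow> cnorm A (x \<otimes> y) \<le> cnorm A x * cnorm A y"
    and cstar_identity: "x \<in> carrier A \<Longrightarrow> cnorm A (star A x \<otimes> x) = (cnorm A x)\<^sup>2"
    and complete: "(\<And>k. X k \<in> carrier A) \<Longrightarrow>
      (\<And>e. e > 0 \<Longrightarrow> \<exists>N. \<forall>i\<ge>N. \<forall>j\<ge>N. cnorm A (X i \<ominus> X j) < e) \<Longrightarrow>
      \<exists>x\<in>carrier A. (\<lambda>k. cnorm A (X k \<ominus> x)) \<longlonglongrightarrow> (0::real)"

definition star_hom :: "'a cstar \<Rightarrow> 'b cstar \<Rightarrow> ('a \<Rightarrow> 'b) \<Rightarrow> bool" where
  "star_hom A B f \<longleftrightarrow> f \<in> ring_hom A B \<and>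
    (\<forall>x\<in>carrier A. \<forall>c. f (cscale A c x) = cscale B c (f x)) \<and>
    (\<forall>x\<in>carrier A. f (star A x) = star B (f x))"

definition cstar_subalgebra :: "'a cstar \<Rightarrow> 'a set \<Rightarrow> bool" where
  "cstar_subalgebra A S \<longleftrightarrow> S \<subseteq> carrier A \<and> \<one>\<^bsub>A\<^esub> \<in> S \<and>
    (\<forall>x\<in>S. \<forall>y\<in>S. x \<oplus>\<^bsub>A\<^esub> y \<in> S \<and> x \<otimes>\<^bsub>A\<^esub> y \<in> S) \<and>
    (\<forall>x\<in>S. star A x \<in> S \<and> (\<forall>c. cscale A c x \<in> S)) \<and>
    (\<forall>X. \<forall>x\<in>carrier A. (\<forall>k::nat. X k \<in> S) \<and> (\<lambda>k. cnorm A (X k \<ominus>\<^bsub>A\<^esub> x)) \<longlonglongrightarrow> 0 \<longrightarrow> x \<in> S)"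


section \<open>The semigroup C*-algebra\<close>

text \<open>In a monoid such as \<open>braid_monoid n\<close>, where any two elements have a least common right
  multiple, the last clause is
  \<open>v\<^sub>p v\<^sub>p* v\<^sub>q v\<^sub>q* = v\<^sub>m v\<^sub>m*\<close> with \<open>m = p \<or> q\<close>, for all \<open>p\<close> and \<open>q\<close>.\<close>

definition nica_representation :: "'p monoid \<Rightarrow> 'a cstar \<Rightarrow> ('p \<Rightarrow> 'a) \<Rightarrow> bool" where
  "nica_representation P A v \<longleftrightarrow>
    (\<forall>p\<in>carrier P. v p \<in> carrier A \<and> star A (v p) \<otimes>\<^bsub>A\<^esub> v p = \<one>\<^bsub>A\<^esub>) \<and>
    v \<one>\<^bsub>P\<^esub> = \<one>\<^bsub>A\<^esub> \<and>
    (\<forall>p\<in>carrier P. \<forall>q\<in>carrier P. v p \<otimes>\<^bsub>A\<^esub> v q = v (p \<otimes>\<^bsub>P\<^esub> q)) \<and>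
    (\<forall>p\<in>carrier P. \<forall>q\<in>carrier P. \<forall>m. is_rlcm P {p, q} m \<longrightarrow>
      (v p \<otimes>\<^bsub>A\<^esub> star A (v p)) \<otimes>\<^bsub>A\<^esub> (v q \<otimes>\<^bsub>A\<^esub> star A (v q)) = v m \<otimes>\<^bsub>A\<^esub> star A (v m))"

text \<open>\<open>(A, v)\<close> is the universal unital C*-algebra generated by a Nica covariant representation
  of \<open>P\<close>. Universality can only be tested against algebras whose elements have one fixed type.
  For countable \<open>P\<close> the type \<open>nat \<Rightarrow> nat \<Rightarrow> complex\<close> loses nothing: a representation of \<open>P\<close> in any
  C*-algebra takes values in the separable C*-subalgebra it generates, and a separable C*-algebra
  is isomorphic to an algebra of bounded operators on \<open>l\<^sup>2(\<nat>)\<close>, i.e. of infinite matrices.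
  The homomorphism is unique because \<open>v\<close> generates \<open>A\<close>.\<close>

definition semigroup_cstar_algebra :: "'p monoid \<Rightarrow> 'a cstar \<Rightarrow> ('p \<Rightarrow> 'a) \<Rightarrow> bool" where
  "semigroup_cstar_algebra P A v \<longleftrightarrow>
    cstar_algebra A \<and> nica_representation P A v \<and>
    (\<forall>S. cstar_subalgebra A S \<and> v ` carrier P \<subseteq> S \<longrightarrow> S = carrier A) \<and>
    (\<forall>(B :: (nat \<Rightarrow> nat \<Rightarrow> complex) cstar) w. cstar_algebra B \<and> nica_representation P B w \<longrightarrow>
      (\<exists>f. star_hom A B f \<and> (\<forall>p\<in>carrier P. f (v p) = w p)))"


section \<open>Dynamics and KMS states\<close>

definition cstar_dynamics :: "'a cstar \<Rightarrow> (real \<Rightarrow> 'a \<Rightarrow> 'a) \<Rightarrow> bool" where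
  "cstar_dynamics A \<sigma> \<longleftrightarrow>
    (\<forall>t. star_hom A A (\<sigma> t)) \<and>
    (\<forall>x\<in>carrier A. \<sigma> 0 x = x) \<and>
    (\<forall>s t. \<forall>x\<in>carrier A. \<sigma> (s + t) x = \<sigma> s (\<sigma> t x)) \<and>
    (\<forall>x\<in>carrier A. \<forall>t. ((\<lambda>s. cnorm A (\<sigma> s x \<ominus>\<^bsub>A\<^esub> \<sigma> t x)) \<longlongrightarrow> 0) (at t))"

definition entire_into :: "'a cstar \<Rightarrow> (complex \<Rightarrow> 'a) \<Rightarrow> bool" where
  "entire_into A F \<longleftrightarrow> (\<forall>z. F z \<in> carrier A) \<and>
    (\<forall>z. \<exists>D\<in>carrier A.
      ((\<lambda>h. cnorm A (cscale A (inverse h) (F (z + h) \<ominus>\<^bsub>A\<^esub> F z) \<ominus>\<^bsub>A\<^esub> D)) \<longlongrightarrow> 0) (at 0))"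

text \<open>\<open>x\<close> is analytic iff such an \<open>F\<close> exists; then \<open>F\<close> is unique and
  \<open>\<sigma>\<^sub>z(x)\<close> denotes \<open>F z\<close>.\<close>

definition analytic_extension ::
  "'a cstar \<Rightarrow> (real \<Rightarrow> 'a \<Rightarrow> 'a) \<Rightarrow> 'a \<Rightarrow> (complex \<Rightarrow> 'a) \<Rightarrow> bool" where
  "analytic_extension A \<sigma> x F \<longleftrightarrow> entire_into A F \<and> (\<forall>t. F (complex_of_real t) = \<sigma> t x)"

definition cstar_state :: "'a cstar \<Rightarrow> ('a \<Rightarrow> complex) \<Rightarrow> bool" where
  "cstar_state A \<phi> \<longleftrightarrow>
    (\<forall>x\<in>carrier A. \<forall>y\<in>carrier A. \<phi> (x \<oplus>\<^bsub>A\<^esub> y) = \<phi> x + \<phi> y) \<and>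
    (\<forall>c. \<forall>x\<in>carrier A. \<phi> (cscale A c x) = c * \<phi> x) \<and>
    (\<forall>x\<in>carrier A. \<phi> (star A x \<otimes>\<^bsub>A\<^esub> x) \<in> \<real> \<and> 0 \<le> Re (\<phi> (star A x \<otimes>\<^bsub>A\<^esub> x))) \<and>
    \<phi> \<one>\<^bsub>A\<^esub> = 1"

definition kms_state ::
  "'a cstar \<Rightarrow> (real \<Rightarrow> 'a \<Rightarrow> 'a) \<Rightarrow> real \<Rightarrow> ('a \<Rightarrow> complex) \<Rightarrow> bool" where
  "kms_state A \<sigma> \<beta> \<phi> \<longleftrightarrow> cstar_state A \<phi> \<and>
    (\<forall>x\<in>carrier A. \<forall>y\<in>carrier A. \<forall>F. analytic_extension A \<sigma> x F \<longrightarrow>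
      \<phi> (x \<otimes>\<^bsub>A\<^esub> y) = \<phi> (y \<otimes>\<^bsub>A\<^esub> F (\<i> * complex_of_real \<beta>)))"

definition kms_infinity_state ::
  "'a cstar \<Rightarrow> (real \<Rightarrow> 'a \<Rightarrow> 'a) \<Rightarrow> ('a \<Rightarrow> complex) \<Rightarrow> bool" where
  "kms_infinity_state A \<sigma> \<phi> \<longleftrightarrow>
    (\<exists>(\<beta> :: nat \<Rightarrow> real) \<psi>. filterlim \<beta> at_top sequentially \<and>
      (\<forall>k. kms_state A \<sigma> (\<beta> k) (\<psi> k)) \<and>
      (\<forall>x\<in>carrier A. (\<lambda>k. \<psi> k x) \<longlonglongrightarrow> \<phi> x))"

definition inverse_temperature_space :: "'a cstar \<Rightarrow> (real \<Rightarrow> 'a \<Rightarrow> 'a) \<Rightarrow> ereal set" where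
  "inverse_temperature_space A \<sigma> =
    {ereal \<beta> | \<beta>. \<exists>\<phi>. kms_state A \<sigma> \<beta> \<phi>} \<union> {\<infinity> | \<phi>. kms_infinity_state A \<sigma> \<phi>}"

end

theory Submission
  imports Defs "HOL-Complex_Analysis.Complex_Analysis"
begin

text \<open>Write \<open>t = exp (- \<beta>)\<close> and \<open>|p|\<close> for the length of \<open>p\<close> in the braid monoid \<open>P\<close>.

  A KMS state at \<open>\<beta>\<close> is forced to satisfy \<open>\<phi> (v\<^sub>p v\<^sub>p\<^sup>*) = t ^ |p|\<close>, because \<open>v\<^sub>p\<close> is an eigenvector of the
  dynamics (\<open>kms_range_projection\<close>). The range projections \<open>v\<^sub>p v\<^sub>p\<^sup>*\<close> commute and multiply like least
  common multiples, so for a set \<open>S\<close> of generators the number \<open>\<phi> (\<Prod>s\<in>S. 1 - v\<^sub>s v\<^sub>s\<^sup>*)\<close>, which is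
  nonnegative, is the value at \<open>t\<close> of the clique polynomial of the submonoid generated by \<open>S\<close>.
  For \<open>S = {s\<^sub>1, s\<^sub>2}\<close> this is \<open>1 - 2 t + t\<^sup>3 = (1 - t) (1 - t - t\<^sup>2)\<close>, and for the three generators of
  the four strand monoid it is \<open>(1 - t) q t\<close> with \<open>q t = 1 - 2 t - t\<^sup>2 + t\<^sup>3 + t\<^sup>4 + t\<^sup>5\<close>. The latter becomes
  positive again close to \<open>1\<close>, but there the former is negative. Hence for \<open>\<beta> \<noteq> 0\<close> the number \<open>t\<close>
  cannot exceed the smallest root, and \<open>\<beta> < 0\<close> is excluded by \<open>t \<le> 1\<close>.

  Conversely, suppose that \<open>Z = (\<Sum>p. t ^ |p|)\<close> is finite. Left cancellation makes the left regular
  representation on \<open>\<ell>\<^sup>2(P)\<close> isometric and Nica covariant, so it extends to a representation \<open>\<pi>\<close> of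
  the universal algebra, and \<open>\<phi> x = (\<Sum>p. t ^ |p| * \<langle>\<pi> x \<delta>\<^sub>p, \<delta>\<^sub>p\<rangle>) / Z\<close> is a KMS state
  (\<open>gibbs_kms_state\<close>). The KMS identity is checked on matrix entries: the entry of \<open>\<pi> (\<sigma>\<^sub>z x)\<close> in row
  \<open>p\<close> and column \<open>q\<close> is \<open>exp (\<i> z (|p| - |q|))\<close> times that of \<open>\<pi> x\<close>, first for real \<open>z\<close>, then for complex
  \<open>z\<close> by analytic continuation; what remains is Fubini. As \<open>\<beta> \<rightarrow> \<infinity>\<close> these states converge to the
  vector state of the identity element. The threshold itself is reached by weak-* compactness
  (\<open>kms_state_limit\<close>), and at \<open>\<beta> = 0\<close> the character with \<open>v\<^sub>p \<mapsto> 1\<close> is a tracial state.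

  It remains to know when \<open>Z\<close> is finite. Every non-identity element is divisible by a generator, so
  inclusion-exclusion over the sets of generators that divide it shows that the growth series is the
  reciprocal of the clique polynomial. It converges at every \<open>t\<close> below the smallest positive root because
  the clique polynomial is a product of factors \<open>1 - g\<close> such that \<open>g\<close>, with its coefficients replaced by
  their absolute values, is less than \<open>1\<close> at \<open>t\<close> (\<open>fps_quotient_summable\<close>). Cancellation and the least
  common multiples come from Garside's theorem on common multiples (\<open>braid_common_multiple\<close>).\<close>

section \<open>States on C*-algebras\<close>

context cstar_algebra begin

lemma cscale_zero_left: "x \<in> carrier A \<Longrightarrow> cscale A 0 x = \<zero>"
  using cscale_add_left[of x 0 0] cscale_closed[of x 0] add.l_cancel_one[of "cscale A 0 x" "cscale A 0 x"]
  by simp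

lemma uminus_eq_cscale: 
  assumes "x \<in> carrier A" shows "\<ominus> x = cscale A (-1) x"
proof -
  have "cscale A (-1) x \<oplus> x = \<zero>"
    using cscale_add_left[OF assms, of "-1" 1] by (simp add: assms cscale_one cscale_zero_left)
  then show ?thesis using assms cscale_closed minus_equality by blast
qed

lemma cnorm_zero [simp]: "cnorm A \<zero> = 0" by (simp add: cnorm_eq_zero)

lemma cnorm_uminus: "x \<in> carrier A \<Longrightarrow> cnorm A (\<ominus> x) = cnorm A x"
  by (simp add: uminus_eq_cscale cnorm_cscale)

lemma cnorm_minus_commute:
  assumes "x \<in> carrier A" "y \<in> carrier A"
  shows "cnorm A (x \<ominus> y) = cnorm A (y \<ominus> x)"
proof -
  have "\<ominus> (x \<ominus> y) = y \<ominus> x" using assms by (simp add: minus_eq minus_add a_comm)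
  then show ?thesis using assms cnorm_uminus[of "x \<ominus> y"] by simp
qed

lemma cnorm_triangle3:
  assumes "x \<in> carrier A" "y \<in> carrier A" "z \<in> carrier A"
  shows "cnorm A (x \<ominus> z) \<le> cnorm A (x \<ominus> y) + cnorm A (y \<ominus> z)"
proof -
  have "x \<ominus> z = (x \<ominus> y) \<oplus> (y \<ominus> z)"
    using assms by (simp add: minus_eq a_assoc r_neg1)
  then show ?thesis using assms by (simp add: cnorm_add)
qed

lemma star_one: "star A \<one> = \<one>"
proof -
  have "star A (star A \<one>) = star A (star A \<one> \<otimes> \<one>)"
    by (simp add: star_closed)
  also have "\<dots> = star A \<one> \<otimes> star A (star A \<one>)" by (simp add: star_closed star_mult del: r_one)
  finally show ?thesis by (simp add: star_star star_closed)
qed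

lemma star_uminus: "x \<in> carrier A \<Longrightarrow> star A (\<ominus> x) = \<ominus> star A x"
  by (simp add: uminus_eq_cscale star_closed star_cscale)

lemma star_minus: "x \<in> carrier A \<Longrightarrow> y \<in> carrier A \<Longrightarrow> star A (x \<ominus> y) = star A x \<ominus> star A y"
  by (simp add: minus_eq star_add star_uminus)

lemma cnorm_star:
  assumes x: "x \<in> carrier A" shows "cnorm A (star A x) = cnorm A x"
proof -
  have *: "cnorm A y \<le> cnorm A (star A y)" if y: "y \<in> carrier A" for y
  proof (cases "cnorm A y = 0")
    case True then show ?thesis using cnorm_nonneg[OF star_closed[OF y]] by simp
  next
    case False
    then have "cnorm A y > 0" using cnorm_nonneg[OF y] by simp
    moreover have "cnorm A y * cnorm A y \<le> cnorm A (star A y) * cnorm A y"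
      using cstar_identity[OF y] cnorm_mult[OF star_closed[OF y] y] by (simp add: power2_eq_square)
    ultimately show ?thesis by simp
  qed
  from *[OF x] *[OF star_closed[OF x]] x show ?thesis by (simp add: star_star)
qed

lemma cscale_minus_right:
  assumes "x \<in> carrier A" "y \<in> carrier A"
  shows "cscale A c (x \<ominus> y) = cscale A c x \<ominus> cscale A c y"
  using assms by (simp add: minus_eq uminus_eq_cscale cscale_add_right cscale_closed cscale_assoc mult.commute)

lemma mult_minus_right:
  "x \<in> carrier A \<Longrightarrow> y \<in> carrier A \<Longrightarrow> z \<in> carrier A \<Longrightarrow> x \<otimes> (y \<ominus> z) = (x \<otimes> y) \<ominus> (x \<otimes> z)"
  by (simp add: minus_eq r_distr r_minus)

lemma mult_minus_left:
  "x \<in> carrier A \<Longrightarrow> y \<in> carrier A \<Longrightarrow> z \<in> carrier A \<Longrightarrow> (y \<ominus> z) \<otimes> x = (y \<otimes> x) \<ominus> (z \<otimes> x)"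
  by (simp add: minus_eq l_distr l_minus)

lemma minus_zero_iff: "x \<in> carrier A \<Longrightarrow> y \<in> carrier A \<Longrightarrow> x \<ominus> y = \<zero> \<longleftrightarrow> x = y"
  by (metis minus_eq minus_equality a_inv_closed minus_minus r_neg)

lemma eq_if_cnorm_small:
  assumes "x \<in> carrier A" "y \<in> carrier A" "(f :: nat \<Rightarrow> real) \<longlonglongrightarrow> 0"
    "\<And>k. cnorm A (x \<ominus> y) \<le> f k"
  shows "x = y"
proof -
  have "cnorm A (x \<ominus> y) \<le> 0" using assms(3,4) by (intro LIMSEQ_le_const[of f]) auto
  then show ?thesis using assms(1,2) cnorm_nonneg[of "x \<ominus> y"] cnorm_eq_zero[of "x \<ominus> y"] minus_zero_iff
    by simp
qed

lemma square_diff_bound: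
  assumes y: "y \<in> carrier A" "cnorm A y \<le> R" and z: "z \<in> carrier A" "cnorm A z \<le> R"
  shows "cnorm A (y \<otimes> y \<ominus> z \<otimes> z) \<le> 2 * R * cnorm A (y \<ominus> z)"
proof -
  have "y \<otimes> y \<ominus> z \<otimes> z = (y \<otimes> (y \<ominus> z)) \<oplus> ((y \<ominus> z) \<otimes> z)"
    using y z by (simp add: mult_minus_left mult_minus_right) (simp add: minus_eq a_assoc r_neg1)
  then have "cnorm A (y \<otimes> y \<ominus> z \<otimes> z) \<le> cnorm A (y \<otimes> (y \<ominus> z)) + cnorm A ((y \<ominus> z) \<otimes> z)"
    using y z by (simp add: cnorm_add)
  also have "\<dots> \<le> cnorm A y * cnorm A (y \<ominus> z) + cnorm A (y \<ominus> z) * cnorm A z"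
    using y z by (intro add_mono cnorm_mult) auto
  also have "\<dots> \<le> R * cnorm A (y \<ominus> z) + cnorm A (y \<ominus> z) * R"
    using y z by (intro add_mono mult_right_mono mult_left_mono cnorm_nonneg) auto
  finally show ?thesis by (simp add: algebra_simps)
qed

text \<open>A square root \<open>b = 1 - y\<close> of \<open>1 - a\<close> is found by solving \<open>y = (a + y\<^sup>2) / 2\<close>. On the ball of radius
  \<open>\<parallel>a\<parallel> < 1\<close> the right-hand side is a contraction with factor \<open>\<parallel>a\<parallel>\<close>, so iteration from \<open>0\<close> converges;
  all iterates are self-adjoint. This replaces functional calculus.\<close>

lemma sqrt_one_minus:
  assumes a: "a \<in> carrier A" and sa: "star A a = a" and norm: "cnorm A a < 1"
  obtains b where "b \<in> carrier A" "star A b = b" "b \<otimes> b = \<one> \<ominus> a"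
proof -
  define r where "r = cnorm A a"
  have r: "0 \<le> r" "r < 1" using norm cnorm_nonneg[OF a] by (auto simp: r_def)
  define f where "f y = cscale A (1/2) (a \<oplus> y \<otimes> y)" for y
  have f_closed: "f y \<in> carrier A" if "y \<in> carrier A" for y
    using that a by (simp add: f_def cscale_closed)
  have f_bound: "cnorm A (f y \<ominus> f z) \<le> R * cnorm A (y \<ominus> z)"
    if "y \<in> carrier A" "cnorm A y \<le> R" "z \<in> carrier A" "cnorm A z \<le> R" for y z R
  proof -
    have "f y \<ominus> f z = cscale A (1/2) ((a \<oplus> y \<otimes> y) \<ominus> (a \<oplus> z \<otimes> z))"
      using that a by (simp add: f_def cscale_minus_right)
    also have "(a \<oplus> y \<otimes> y) \<ominus> (a \<oplus> z \<otimes> z) = y \<otimes> y \<ominus> z \<otimes> z"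
      using that a by (simp add: minus_eq minus_add a_ac r_neg1 r_neg2)
        
    finally have "cnorm A (f y \<ominus> f z) = 1/2 * cnorm A (y \<otimes> y \<ominus> z \<otimes> z)"
      using that by (simp add: cnorm_cscale)
    then show ?thesis using square_diff_bound[OF that] by simp
  qed
  define y where "y k = (f ^^ k) \<zero>" for k :: nat
  have y_Suc: "y (Suc k) = f (y k)" and y_0: "y 0 = \<zero>" for k by (simp_all add: y_def)
  have y: "y k \<in> carrier A" for k by (induction k) (simp_all add: y_0 y_Suc f_closed)
  have y_bound: "cnorm A (y k) \<le> r" for k
  proof (induction k)
    case 0 then show ?case using r by (simp add: y_0)
  next
    case (Suc k)
    have "cnorm A (y (Suc k)) = 1/2 * cnorm A (a \<oplus> y k \<otimes> y k)"
      using a y by (simp add: y_Suc f_def cnorm_cscale)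
    also have "cnorm A (a \<oplus> y k \<otimes> y k) \<le> r + cnorm A (y k) * cnorm A (y k)"
      using a y by (intro order.trans[OF cnorm_add] add_mono cnorm_mult) (auto simp: r_def)
    also have "cnorm A (y k) * cnorm A (y k) \<le> r * 1"
      using Suc r y by (intro mult_mono) (auto intro: cnorm_nonneg)
    finally show ?case by simp
  qed
  have y_star: "star A (y k) = y k" for k
  proof (induction k)
    case 0 show ?case using star_uminus[of \<zero>] cscale_zero_left[of \<one>] star_cscale[of \<one> 0]
      by (simp add: y_0 star_one)
  next
    case (Suc k) then show ?case using a y sa by (simp add: y_Suc f_def star_cscale star_add star_mult)
  qed
  have y_cauchy: "cnorm A (y (m + k) \<ominus> y m) \<le> r ^ m" for m k
  proof (induction m)
    case 0 show ?case using y_bound[of k] r y by (simp add: y_0 minus_eq)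
  next
    case (Suc m)
    have "cnorm A (y (Suc m + k) \<ominus> y (Suc m)) \<le> r * cnorm A (y (m + k) \<ominus> y m)"
      using f_bound y y_bound by (simp add: y_Suc)
    also have "\<dots> \<le> r * r ^ m" using Suc r by (intro mult_left_mono) auto
    finally show ?case by simp
  qed
  have pow: "(\<lambda>m. r ^ m) \<longlonglongrightarrow> 0" using r by (intro LIMSEQ_realpow_zero) auto
  have "\<exists>Y\<in>carrier A. (\<lambda>k. cnorm A (y k \<ominus> Y)) \<longlonglongrightarrow> 0"
  proof (rule complete[OF y])
    fix e :: real assume "e > 0"
    then obtain N where N: "r ^ N < e / 2" using order_tendstoD(2)[OF pow, of "e/2"]
      by (auto simp: eventually_sequentially)
    have "cnorm A (y i \<ominus> y j) < e" if "i \<ge> N" "j \<ge> N" for i j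
    proof -
      have "cnorm A (y i \<ominus> y j) \<le> cnorm A (y i \<ominus> y N) + cnorm A (y j \<ominus> y N)"
        using cnorm_triangle3[OF y y y, of i j N] cnorm_minus_commute[OF y y] by metis
      also have "\<dots> \<le> r ^ N + r ^ N"
        using y_cauchy[of N "i - N"] y_cauchy[of N "j - N"] that by (intro add_mono) auto
      finally show ?thesis using N by simp
    qed
    then show "\<exists>N. \<forall>i\<ge>N. \<forall>j\<ge>N. cnorm A (y i \<ominus> y j) < e" by blast
  qed
  then obtain Y where Y: "Y \<in> carrier A" and lim: "(\<lambda>k. cnorm A (y k \<ominus> Y)) \<longlonglongrightarrow> 0" by blast
  have starY: "star A Y = Y"
  proof (rule eq_if_cnorm_small)
    show "cnorm A (star A Y \<ominus> Y) \<le> cnorm A (y k \<ominus> Y) + cnorm A (y k \<ominus> Y)" for k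
    proof -
      have "cnorm A (star A Y \<ominus> y k) = cnorm A (star A (Y \<ominus> y k))"
        using Y y by (simp add: star_minus y_star)
      then have "cnorm A (star A Y \<ominus> y k) = cnorm A (y k \<ominus> Y)"
        using Y y by (simp add: cnorm_star cnorm_minus_commute)
      then show ?thesis using cnorm_triangle3[OF star_closed[OF Y] y Y, of k] by simp
    qed
    show "(\<lambda>k. cnorm A (y k \<ominus> Y) + cnorm A (y k \<ominus> Y)) \<longlonglongrightarrow> 0"
      using tendsto_add[OF lim lim] by simp
  qed (use Y star_closed in auto)
  \<comment> \<open>The limit may a priori leave the ball, so the Lipschitz bound is applied on a larger one.\<close>
  define R where "R = max r (cnorm A Y)"
  have fix_point: "Y = f Y"
  proof (rule eq_if_cnorm_small)
    show "cnorm A (Y \<ominus> f Y) \<le> cnorm A (y (Suc k) \<ominus> Y) + R * cnorm A (y k \<ominus> Y)" for k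
    proof -
      have "cnorm A (f (y k) \<ominus> f Y) \<le> R * cnorm A (y k \<ominus> Y)"
        using y Y y_bound[of k] by (intro f_bound) (auto simp: R_def)
      then show ?thesis
        using cnorm_triangle3[OF Y y[of "Suc k"] f_closed[OF Y]] cnorm_minus_commute[OF Y y, of "Suc k"]
        by (simp add: y_Suc)
    qed
    show "(\<lambda>k. cnorm A (y (Suc k) \<ominus> Y) + R * cnorm A (y k \<ominus> Y)) \<longlonglongrightarrow> 0"
      using tendsto_add[OF LIMSEQ_Suc[OF lim] tendsto_mult_left[OF lim, of R]] by simp
  qed (use Y f_closed in auto)
  have "Y \<oplus> Y = cscale A 1 (a \<oplus> Y \<otimes> Y)"
    using cscale_add_left[of "a \<oplus> Y \<otimes> Y" "1/2" "1/2"] fix_point a Y by (simp add: f_def)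
  then have YY: "Y \<oplus> Y = a \<oplus> Y \<otimes> Y" using a Y by (simp add: cscale_one)
  show thesis
  proof (rule that[of "\<one> \<ominus> Y"])
    show "star A (\<one> \<ominus> Y) = \<one> \<ominus> Y" using Y by (simp add: star_minus star_one starY)
    have "(\<one> \<ominus> Y) \<otimes> (\<one> \<ominus> Y) = \<one> \<ominus> (Y \<oplus> Y) \<oplus> Y \<otimes> Y"
      using Y by (simp add: mult_minus_left mult_minus_right) (simp add: minus_eq minus_add a_ac)
    also have "\<dots> = \<one> \<ominus> a" using a Y by (simp add: YY) (simp add: minus_eq minus_add a_assoc l_neg)
    finally show "(\<one> \<ominus> Y) \<otimes> (\<one> \<ominus> Y) = \<one> \<ominus> a" .
  qed (use Y in simp)
qed

lemma state_uminus:
  assumes "cstar_state A \<phi>" "x \<in> carrier A" shows "\<phi> (\<ominus> x) = - \<phi> x"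
  using assms by (simp add: uminus_eq_cscale cstar_state_def)

lemma state_minus:
  assumes "cstar_state A \<phi>" "x \<in> carrier A" "y \<in> carrier A" shows "\<phi> (x \<ominus> y) = \<phi> x - \<phi> y"
  using assms state_uminus[OF assms(1,3)] by (simp add: minus_eq cstar_state_def)

text \<open>Polarisation: \<open>\<phi> ((c x + 1)\<^sup>* (c x + 1))\<close> is real, and \<open>c = 1\<close>, \<open>c = \<i>\<close> give the imaginary and the
  real part.\<close>

lemma state_star:
  assumes st: "cstar_state A \<phi>" and x: "x \<in> carrier A"
  shows "\<phi> (star A x) = cnj (\<phi> x)"
proof -
  have add: "\<phi> (x \<oplus> y) = \<phi> x + \<phi> y" if "x \<in> carrier A" "y \<in> carrier A" for x y
    using st that by (simp add: cstar_state_def)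
  have sc: "\<phi> (cscale A c x) = c * \<phi> x" if "x \<in> carrier A" for x c
    using st that by (simp add: cstar_state_def)
  have pos: "Im (\<phi> (star A x \<otimes> x)) = 0" if "x \<in> carrier A" for x
    using st that by (simp add: cstar_state_def complex_is_Real_iff)
  have *: "Im (c * \<phi> x) + Im (cnj c * \<phi> (star A x)) = 0" for c
  proof -
    have e: "star A (cscale A c x \<oplus> \<one>) \<otimes> (cscale A c x \<oplus> \<one>) =
      (star A (cscale A c x) \<otimes> cscale A c x \<oplus> \<one>) \<oplus> (cscale A c x \<oplus> cscale A (cnj c) (star A x))"
      using x by (simp add: star_add star_one l_distr r_distr cscale_closed star_closed star_cscale a_ac)
    have "\<phi> (star A (cscale A c x \<oplus> \<one>) \<otimes> (cscale A c x \<oplus> \<one>)) =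
      \<phi> (star A (cscale A c x) \<otimes> cscale A c x) + \<phi> \<one> + (c * \<phi> x + cnj c * \<phi> (star A x))"
      unfolding e using x by (simp add: add sc cscale_closed star_closed)
    moreover have "\<phi> \<one> = 1" using st by (simp add: cstar_state_def)
    ultimately show ?thesis using pos[of "cscale A c x \<oplus> \<one>"] pos[of "cscale A c x"] x
      by (simp add: cscale_closed)
  qed
  from *[of 1] *[of \<i>] show ?thesis by (simp add: complex_eq_iff)
qed

text \<open>The variance \<open>\<phi> ((x - \<phi> x)\<^sup>* (x - \<phi> x))\<close> is nonnegative.\<close>

lemma state_cauchy_schwarz:
  assumes st: "cstar_state A \<phi>" and x: "x \<in> carrier A"
  shows "(cmod (\<phi> x))\<^sup>2 \<le> Re (\<phi> (star A x \<otimes> x))"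
proof -
  have add: "\<phi> (x \<oplus> y) = \<phi> x + \<phi> y" if "x \<in> carrier A" "y \<in> carrier A" for x y
    using st that by (simp add: cstar_state_def)
  have sc: "\<phi> (cscale A c x) = c * \<phi> x" if "x \<in> carrier A" for x c
    using st that by (simp add: cstar_state_def)
  have one: "\<phi> \<one> = 1" using st by (simp add: cstar_state_def)
  define c where "c = - \<phi> x"
  define y where "y = x \<oplus> cscale A c \<one>"
  have y: "y \<in> carrier A" using x by (simp add: y_def cscale_closed)
  have e: "star A y \<otimes> y = star A x \<otimes> x \<oplus> (cscale A c (star A x) \<oplus> (cscale A (cnj c) x \<oplus> cscale A (cnj c * c) \<one>))"
    using x by (simp add: y_def star_add star_cscale star_one l_distr r_distr cscale_closed star_closed
        cscale_mult_left cscale_mult_right cscale_assoc cscale_add_right a_ac mult.commute)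
  have "\<phi> (star A y \<otimes> y) = \<phi> (star A x \<otimes> x) + c * cnj (\<phi> x) + cnj c * \<phi> x + cnj c * c"
    unfolding e using x by (simp add: add sc cscale_closed star_closed state_star[OF st] one)
  also have "\<dots> = \<phi> (star A x \<otimes> x) - \<phi> x * cnj (\<phi> x)" by (simp add: c_def)
  finally have "Re (\<phi> (star A y \<otimes> y)) = Re (\<phi> (star A x \<otimes> x)) - (cmod (\<phi> x))\<^sup>2"
    by (simp add: cmod_power2) (simp add: power2_eq_square)
  moreover have "0 \<le> Re (\<phi> (star A y \<otimes> y))" using st y by (simp add: cstar_state_def)
  ultimately show ?thesis by simp
qed

text \<open>For \<open>K > \<parallel>x\<parallel>\<^sup>2\<close> the element \<open>1 - x\<^sup>* x / K\<close> is a square of a self-adjoint element, so \<open>\<phi>\<close> is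
  nonnegative on it.\<close>

lemma state_square_le:
  assumes st: "cstar_state A \<phi>" and x: "x \<in> carrier A"
  shows "Re (\<phi> (star A x \<otimes> x)) \<le> (cnorm A x)\<^sup>2"
proof (rule field_le_epsilon)
  fix e :: real assume e: "e > 0"
  define K where "K = (cnorm A x)\<^sup>2 + e"
  have K: "K > 0" using e by (simp add: K_def add_nonneg_pos)
  define a where "a = cscale A (of_real (1/K)) (star A x \<otimes> x)"
  have a: "a \<in> carrier A" "star A a = a" using x by (simp_all add: a_def cscale_closed star_closed star_cscale star_mult star_star)
  have "cnorm A a = (cnorm A x)\<^sup>2 / K"
    using x K by (simp add: a_def cnorm_cscale star_closed cstar_identity norm_divide)
  then have "cnorm A a < 1" using K e by (simp add: K_def)
  then obtain b where b: "b \<in> carrier A" "star A b = b" "b \<otimes> b = \<one> \<ominus> a"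
    using sqrt_one_minus a by blast
  have "0 \<le> Re (\<phi> (star A b \<otimes> b))" using st b(1) by (simp add: cstar_state_def)
  also have "\<phi> (star A b \<otimes> b) = 1 - \<phi> a"
    using st a b by (simp add: state_minus) (simp add: cstar_state_def)
  also have "\<phi> a = of_real (1/K) * \<phi> (star A x \<otimes> x)"
    unfolding a_def using st x by (simp add: cstar_state_def star_closed)
  finally show "Re (\<phi> (star A x \<otimes> x)) \<le> (cnorm A x)\<^sup>2 + e" using K by (simp add: K_def field_simps)
qed

text \<open>Automatic continuity of states. Applied to the diagonal matrix entries of a representation, it lets
  identities extend from the generators to the whole algebra.\<close>

lemma state_contractive:
  assumes "cstar_state A \<phi>" "x \<in> carrier A" shows "cmod (\<phi> x) \<le> cnorm A x"
  using order.trans[OF state_cauchy_schwarz[OF assms] state_square_le[OF assms]] cnorm_nonneg[OF assms(2)]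
  by (simp add: power2_le_iff_abs_le)

end

section \<open>The C*-algebra of bounded infinite matrices\<close>

text \<open>Square-summable sequences and bounded operators on \<open>\<ell>\<^sup>2(\<nat>)\<close> are described through their finite
  sections, so that no completed sequence space has to be constructed.\<close>

abbreviation (input) norm_upto :: "nat \<Rightarrow> (nat \<Rightarrow> complex) \<Rightarrow> real" where
  "norm_upto N a \<equiv> L2_set (\<lambda>i. cmod (a i)) {..<N}"

definition l2_bound :: "real \<Rightarrow> (nat \<Rightarrow> complex) \<Rightarrow> bool" where
  "l2_bound K a \<longleftrightarrow> (\<forall>N. norm_upto N a \<le> K)"

definition mat_vec :: "(nat \<Rightarrow> nat \<Rightarrow> complex) \<Rightarrow> (nat \<Rightarrow> complex) \<Rightarrow> nat \<Rightarrow> complex" where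
  "mat_vec x a i = (\<Sum>k. x i k * a k)"

definition mat_bound :: "real \<Rightarrow> (nat \<Rightarrow> nat \<Rightarrow> complex) \<Rightarrow> bool" where
  "mat_bound C x \<longleftrightarrow> 0 \<le> C \<and> (\<forall>a M N.
    L2_set (\<lambda>i. cmod (\<Sum>j<N. x i j * a j)) {..<M} \<le> C * norm_upto N a)"

definition mat_adj :: "(nat \<Rightarrow> nat \<Rightarrow> complex) \<Rightarrow> nat \<Rightarrow> nat \<Rightarrow> complex" where
  "mat_adj x i j = cnj (x j i)"

definition mat_mult :: "(nat \<Rightarrow> nat \<Rightarrow> complex) \<Rightarrow> (nat \<Rightarrow> nat \<Rightarrow> complex) \<Rightarrow> nat \<Rightarrow> nat \<Rightarrow> complex" where
  "mat_mult x y i j = mat_vec x (\<lambda>k. y k j) i"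

definition mat_norm :: "(nat \<Rightarrow> nat \<Rightarrow> complex) \<Rightarrow> real" where
  "mat_norm x = Inf {C. mat_bound C x}"

definition \<B> :: "(nat \<Rightarrow> nat \<Rightarrow> complex) cstar" where
  "\<B> =
    \<lparr> carrier = {x. \<exists>C. mat_bound C x}, monoid.mult = mat_mult,
      one = (\<lambda>i j. if i = j then 1 else 0), zero = (\<lambda>i j. 0), add = (\<lambda>x y i j. x i j + y i j),
      cscale = (\<lambda>c x i j. c * x i j), star = mat_adj, cnorm = mat_norm \<rparr>"

lemma l2_bound_nonneg: "l2_bound K a \<Longrightarrow> 0 \<le> K"
  unfolding l2_bound_def using L2_set_nonneg order.trans by blast

lemma l2_bound_summable_sq:
  assumes "l2_bound K a" shows "summable (\<lambda>i. (cmod (a i))\<^sup>2)"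
proof (rule bounded_imp_summable)
  show "(\<Sum>i\<le>n. (cmod (a i))\<^sup>2) \<le> K\<^sup>2" for n
  proof -
    have "L2_set (\<lambda>i. cmod (a i)) {..<Suc n} \<le> K" using assms by (simp add: l2_bound_def)
    then have "(L2_set (\<lambda>i. cmod (a i)) {..<Suc n})\<^sup>2 \<le> K\<^sup>2"
      by (intro power_mono) auto
    then show ?thesis by (simp add: L2_set_def sum_nonneg lessThan_Suc_atMost)
  qed
qed auto

lemma
  assumes a: "l2_bound K a" and b: "l2_bound L b"
  shows l2_bound_summable_mult: "summable (\<lambda>i. cmod (a i * b i))"
    and l2_bound_summable: "summable (\<lambda>i. a i * b i)"
    and l2_bound_suminf_abs: "(\<Sum>i. cmod (a i * b i)) \<le> K * L"
    and l2_bound_suminf: "cmod (\<Sum>i. a i * b i) \<le> K * L"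
proof -
  have part: "(\<Sum>i<n. cmod (a i * b i)) \<le> K * L" for n
  proof -
    have "(\<Sum>i<n. cmod (a i * b i)) \<le> L2_set (\<lambda>i. cmod (a i)) {..<n} * L2_set (\<lambda>i. cmod (b i)) {..<n}"
      using L2_set_mult_ineq[of "\<lambda>i. cmod (a i)" "\<lambda>i. cmod (b i)" "{..<n}"] by (simp add: norm_mult)
    also have "\<dots> \<le> K * L"
      using a b l2_bound_nonneg[OF a] by (intro mult_mono) (auto simp: l2_bound_def)
    finally show ?thesis .
  qed
  show s: "summable (\<lambda>i. cmod (a i * b i))"
    using part by (intro summableI_nonneg_bounded) auto
  then show "summable (\<lambda>i. a i * b i)" by (rule summable_norm_cancel)
  show le: "(\<Sum>i. cmod (a i * b i)) \<le> K * L" using s part by (rule suminf_le_const)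
  show "cmod (\<Sum>i. a i * b i) \<le> K * L"
    using summable_norm[OF s] le by simp
qed

text \<open>The sequence of squares is summable, hence Cauchy.\<close>

lemma l2_bound_tail:
  assumes a: "l2_bound K a" and e: "e > 0"
  shows "\<forall>\<^sub>F N in sequentially. l2_bound e (\<lambda>i. if i < N then 0 else a i)"
proof -
  have "e\<^sup>2 > 0" using e by simp
  then obtain N0 where N0: "\<And>m n. m \<ge> N0 \<Longrightarrow> norm (\<Sum>i\<in>{m..<n}. (cmod (a i))\<^sup>2) < e\<^sup>2"
    using l2_bound_summable_sq[OF a] unfolding summable_Cauchy by metis
  have "l2_bound e (\<lambda>i. if i < N then 0 else a i)" if "N \<ge> N0" for N
    unfolding l2_bound_def
  proof
    fix M
    have "(\<Sum>i<M. (cmod (if i < N then 0 else a i))\<^sup>2) = (\<Sum>i\<in>{N..<M}. (cmod (a i))\<^sup>2)"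
      by (rule sum.mono_neutral_cong_right) auto
    also have "\<dots> \<le> e\<^sup>2" using N0[OF that, of M] by simp
    finally show "L2_set (\<lambda>i. cmod (if i < N then 0 else a i)) {..<M} \<le> e"
      unfolding L2_set_def using e by (intro real_le_lsqrt) auto
  qed
  then show ?thesis unfolding eventually_sequentially by blast
qed

lemma l2_bound_finite:
  "l2_bound (norm_upto N a) (\<lambda>j. if j < N then a j else 0)"
  unfolding l2_bound_def
proof
  fix M
  have "(\<Sum>i<M. (cmod (if i < N then a i else 0))\<^sup>2) \<le> (\<Sum>i<N. (cmod (a i))\<^sup>2)"
  proof -
    have "(\<Sum>i<M. (cmod (if i < N then a i else 0))\<^sup>2) = (\<Sum>i\<in>{..<M} \<inter> {..<N}. (cmod (a i))\<^sup>2)"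
      by (rule sum.mono_neutral_cong_right) auto
    then show ?thesis by (simp add: sum_mono2)
  qed
  then show "L2_set (\<lambda>i. cmod (if i < N then a i else 0)) {..<M} \<le> norm_upto N a"
    by (simp add: L2_set_def)
qed

lemma mat_bound_form:
  assumes "mat_bound C x"
  shows "cmod (\<Sum>i<M. \<Sum>j<N. b i * x i j * a j)
    \<le> C * norm_upto M b * norm_upto N a"
proof -
  have "cmod (\<Sum>i<M. \<Sum>j<N. b i * x i j * a j) = cmod (\<Sum>i<M. b i * (\<Sum>j<N. x i j * a j))"
    by (simp add: sum_distrib_left mult.assoc)
  also have "\<dots> \<le> (\<Sum>i<M. cmod (b i) * cmod (\<Sum>j<N. x i j * a j))"
    by (rule order.trans[OF norm_sum]) (simp add: norm_mult)
  also have "\<dots> \<le> norm_upto M b * L2_set (\<lambda>i. cmod (\<Sum>j<N. x i j * a j)) {..<M}"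
    using L2_set_mult_ineq[of "\<lambda>i. cmod (b i)" "\<lambda>i. cmod (\<Sum>j<N. x i j * a j)" "{..<M}"] by simp
  also have "\<dots> \<le> norm_upto M b * (C * norm_upto N a)"
    using assms by (intro mult_left_mono) (auto simp: mat_bound_def)
  finally show ?thesis by (simp add: mult_ac)
qed

text \<open>Testing the sesquilinear form against \<open>b = x a\<close> recovers the bound on \<open>\<parallel>x a\<parallel>\<close>. The form is symmetric in
  rows and columns, which is why the adjoint satisfies the same bound.\<close>

lemma mat_bound_formI:
  assumes C: "0 \<le> C" and form: "\<And>a b M N. cmod (\<Sum>i<M. \<Sum>j<N. b i * x i j * a j)
    \<le> C * norm_upto M b * norm_upto N a"
  shows "mat_bound C x"
  unfolding mat_bound_def
proof (intro conjI allI C)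
  fix a M N
  define c where "c i = (\<Sum>j<N. x i j * a j)" for i
  define s where "s = norm_upto M c"
  have "s\<^sup>2 = (\<Sum>i<M. (cmod (c i))\<^sup>2)" by (simp add: s_def L2_set_def sum_nonneg)
  also have "complex_of_real \<dots> = (\<Sum>i<M. \<Sum>j<N. cnj (c i) * x i j * a j)"
  proof -
    have "d * c i = (\<Sum>j<N. d * x i j * a j)" for d i by (simp add: c_def sum_distrib_left mult.assoc)
    then show ?thesis by (simp add: complex_norm_square mult.commute[of "c _"] del: of_real_power)
  qed
  finally have "s\<^sup>2 = cmod (\<Sum>i<M. \<Sum>j<N. cnj (c i) * x i j * a j)"
    by (metis norm_of_real abs_of_nonneg zero_le_power2)
  also have "\<dots> \<le> C * s * norm_upto N a"
    using form[where a = a and b = "\<lambda>i. cnj (c i)" and M = M and N = N] by (simp add: s_def)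
  finally have "s * s \<le> s * (C * norm_upto N a)"
    by (simp add: power2_eq_square mult_ac)
  moreover have "s \<ge> 0" by (simp add: s_def L2_set_nonneg)
  ultimately have "s \<le> C * norm_upto N a"
    using C by (cases "s = 0") (auto simp: L2_set_nonneg)
  then show "L2_set (\<lambda>i. cmod (\<Sum>j<N. x i j * a j)) {..<M} \<le> C * norm_upto N a"
    by (simp add: s_def c_def)
qed

lemma mat_bound_adj:
  assumes "mat_bound C x" shows "mat_bound C (mat_adj x)"
proof (rule mat_bound_formI)
  show "0 \<le> C" using assms by (simp add: mat_bound_def)
  fix a b M N
  have "(\<Sum>i<M. \<Sum>j<N. b i * mat_adj x i j * a j) = cnj (\<Sum>j<N. \<Sum>i<M. cnj (a j) * x j i * cnj (b i))"
    by (subst sum.swap) (simp add: mat_adj_def mult_ac)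
  then have "cmod (\<Sum>i<M. \<Sum>j<N. b i * mat_adj x i j * a j)
      = cmod (\<Sum>j<N. \<Sum>i<M. cnj (a j) * x j i * cnj (b i))"
    by (simp only: complex_mod_cnj)
  also have "\<dots> \<le> C * L2_set (\<lambda>i. cmod (cnj (a i))) {..<N} * L2_set (\<lambda>j. cmod (cnj (b j))) {..<M}"
    by (rule mat_bound_form[OF assms])
  finally show "cmod (\<Sum>i<M. \<Sum>j<N. b i * mat_adj x i j * a j)
    \<le> C * norm_upto M b * norm_upto N a" by (simp add: mult_ac)
qed

lemma mat_bound_mono: "mat_bound C x \<Longrightarrow> C \<le> D \<Longrightarrow> mat_bound D x"
  unfolding mat_bound_def by (meson L2_set_nonneg mult_right_mono order.trans)

lemma mat_bound_column:
  assumes "mat_bound C x" shows "l2_bound C (\<lambda>i. x i j)"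
  unfolding l2_bound_def
proof
  fix M
  define a where "a k = (if k = j then 1 else 0 :: complex)" for k
  have "L2_set (\<lambda>i. cmod (\<Sum>k<Suc j. x i k * a k)) {..<M} \<le> C * L2_set (\<lambda>k. cmod (a k)) {..<Suc j}"
    using assms unfolding mat_bound_def by blast
  moreover have "(\<Sum>k<Suc j. x i k * a k) = x i j" for i by (simp add: a_def)
  moreover have "L2_set (\<lambda>k. cmod (a k)) {..<Suc j} = 1" by (simp add: a_def L2_set_def)
  ultimately show "L2_set (\<lambda>i. cmod (x i j)) {..<M} \<le> C" by simp
qed

lemma mat_bound_row:
  assumes "mat_bound C x" shows "l2_bound C (\<lambda>j. x i j)"
  using mat_bound_column[OF mat_bound_adj[OF assms], of i] by (simp add: mat_adj_def l2_bound_def)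

lemma mat_bound_entry:
  assumes "mat_bound C x" shows "cmod (x i j) \<le> C"
proof -
  have "cmod (x i j) \<le> L2_set (\<lambda>i. cmod (x i j)) {..<Suc i}"
    by (rule member_le_L2_set) auto
  also have "\<dots> \<le> C" using mat_bound_column[OF assms] by (simp add: l2_bound_def)
  finally show ?thesis .
qed

lemma l2_bound_mat_vec:
  assumes x: "mat_bound C x" and a: "l2_bound K a"
  shows "l2_bound (C * K) (mat_vec x a)"
  unfolding l2_bound_def
proof
  fix M
  have "(\<lambda>N. \<Sum>j<N. x i j * a j) \<longlonglongrightarrow> mat_vec x a i" for i
    unfolding mat_vec_def using l2_bound_summable[OF mat_bound_row[OF x] a] by (rule summable_LIMSEQ)
  then have "(\<lambda>N. L2_set (\<lambda>i. cmod (\<Sum>j<N. x i j * a j)) {..<M}) \<longlonglongrightarrow> L2_set (\<lambda>i. cmod (mat_vec x a i)) {..<M}"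
    unfolding L2_set_def by (intro tendsto_intros)
  moreover have "L2_set (\<lambda>i. cmod (\<Sum>j<N. x i j * a j)) {..<M} \<le> C * K" for N
  proof -
    have "C * norm_upto N a \<le> C * K"
      using a x by (intro mult_left_mono) (auto simp: l2_bound_def mat_bound_def)
    then show ?thesis using x unfolding mat_bound_def by (meson order.trans)
  qed
  ultimately show "L2_set (\<lambda>i. cmod (mat_vec x a i)) {..<M} \<le> C * K"
    by (blast intro: LIMSEQ_le_const2)
qed

lemma mat_vec_finite_sum:
  assumes x: "mat_bound C x" and y: "\<And>j. j < N \<Longrightarrow> l2_bound (K j) (\<lambda>k. y k j)"
  shows "(\<Sum>j<N. mat_vec x (\<lambda>k. y k j) i * a j) = mat_vec x (\<lambda>k. \<Sum>j<N. y k j * a j) i"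
proof -
  have s: "summable (\<lambda>k. x i k * y k j)" if "j < N" for j
    using l2_bound_summable[OF mat_bound_row[OF x] y[OF that]] .
  have "(\<Sum>j<N. mat_vec x (\<lambda>k. y k j) i * a j) = (\<Sum>j<N. \<Sum>k. x i k * y k j * a j)"
    unfolding mat_vec_def using s by (intro sum.cong refl suminf_mult2) auto
  also have "\<dots> = (\<Sum>k. \<Sum>j<N. x i k * y k j * a j)"
    using s by (intro suminf_sum[symmetric] summable_mult2) auto
  finally show ?thesis by (simp add: mat_vec_def sum_distrib_left mult.assoc)
qed

lemma mat_bound_sum_column:
  assumes "mat_bound C x"
  shows "l2_bound (C * norm_upto N a) (\<lambda>i. \<Sum>j<N. x i j * a j)"
  using assms by (simp add: l2_bound_def mat_bound_def)

lemma mat_bound_mult: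
  assumes x: "mat_bound C x" and y: "mat_bound D y"
  shows "mat_bound (C * D) (mat_mult x y)"
  unfolding mat_bound_def
proof (intro conjI allI)
  show "0 \<le> C * D" using x y by (simp add: mat_bound_def)
  fix a M N
  have "(\<Sum>j<N. mat_mult x y i j * a j) = mat_vec x (\<lambda>k. \<Sum>j<N. y k j * a j) i" for i
    unfolding mat_mult_def using mat_vec_finite_sum[OF x mat_bound_column[OF y]] .
  then show "L2_set (\<lambda>i. cmod (\<Sum>j<N. mat_mult x y i j * a j)) {..<M} \<le> C * D * norm_upto N a"
    using l2_bound_mat_vec[OF x mat_bound_sum_column[OF y, of a N]]
    by (simp add: l2_bound_def mult.assoc)
qed

text \<open>The double series behind associativity need not converge absolutely. For finitely supported
  vectors the identity is a rearrangement of finitely many convergent series; in general the tail \<open>a\<close> beyond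
  \<open>N\<close> contributes at most \<open>C * D\<close> times its norm, which tends to \<open>0\<close>.\<close>

lemma mat_vec_mult:
  assumes x: "mat_bound C x" and y: "mat_bound D y" and a: "l2_bound K a"
  shows "mat_vec (mat_mult x y) a i = mat_vec x (mat_vec y a) i"
proof (rule LIMSEQ_unique)
  define S where "S N = (\<Sum>j<N. mat_mult x y i j * a j)" for N
  show "S \<longlonglongrightarrow> mat_vec (mat_mult x y) a i"
    unfolding S_def mat_vec_def
    using l2_bound_summable[OF mat_bound_row[OF mat_bound_mult[OF x y]] a] by (rule summable_LIMSEQ)
  define tail where "tail N j = (if j < N then 0 else a j)" for N j
  have diff: "mat_vec x (mat_vec y a) i - S N = mat_vec x (mat_vec y (tail N)) i"
    if tb: "l2_bound e (tail N)" for N e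
  proof -
    have "S N = mat_vec x (\<lambda>k. \<Sum>j<N. y k j * a j) i"
      unfolding S_def mat_mult_def using mat_vec_finite_sum[OF x mat_bound_column[OF y]] .
    moreover have "mat_vec y (tail N) k = mat_vec y a k - (\<Sum>j<N. y k j * a j)" for k
    proof -
      have "mat_vec y a k = (\<Sum>j. y k j * (if j < N then a j else 0) + y k j * tail N j)"
        unfolding mat_vec_def tail_def by (intro suminf_cong) auto
      also have "\<dots> = (\<Sum>j. y k j * (if j < N then a j else 0)) + mat_vec y (tail N) k"
        unfolding mat_vec_def
        by (rule suminf_add[symmetric, OF l2_bound_summable[OF mat_bound_row[OF y] l2_bound_finite]
              l2_bound_summable[OF mat_bound_row[OF y] tb]])
      also have "(\<Sum>j. y k j * (if j < N then a j else 0)) = (\<Sum>j<N. y k j * a j)"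
        by (subst suminf_finite[of "{..<N}"]) auto
      finally show ?thesis by simp
    qed
    ultimately show ?thesis
      unfolding mat_vec_def[of x]
      using suminf_diff[OF l2_bound_summable[OF mat_bound_row[OF x] l2_bound_mat_vec[OF y a]]
        l2_bound_summable[OF mat_bound_row[OF x] mat_bound_sum_column[OF y, of a N]], of i i]
      by (simp add: right_diff_distrib)
  qed
  show "S \<longlonglongrightarrow> mat_vec x (mat_vec y a) i"
  proof (rule tendstoI)
    fix e :: real assume e: "e > 0"
    have nn: "C \<ge> 0" "D \<ge> 0" using x y by (simp_all add: mat_bound_def)
    define d where "d = e / (C * D + 1)"
    have cd: "C * D + 1 > 0" using nn by (simp add: add_nonneg_pos)
    then have "d > 0" using e by (simp add: d_def)
    from l2_bound_tail[OF a this] show "\<forall>\<^sub>F N in sequentially. dist (S N) (mat_vec x (mat_vec y a) i) < e"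
    proof eventually_elim
      case (elim N)
      then have tb: "l2_bound d (tail N)" by (simp add: tail_def[abs_def])
      have "cmod (mat_vec x (mat_vec y (tail N)) i) \<le> C * (D * d)"
        unfolding mat_vec_def[of x]
        by (rule l2_bound_suminf[OF mat_bound_row[OF x] l2_bound_mat_vec[OF y tb]])
      also have "\<dots> = (C * D) / (C * D + 1) * e" by (simp add: d_def)
      also have "\<dots> < 1 * e" using e cd by (intro mult_strict_right_mono) auto
      finally show ?case
        using diff[OF tb] unfolding dist_norm norm_minus_commute[of "S N"] by simp
    qed
  qed
qed

lemma mat_mult_assoc:
  assumes "mat_bound C x" "mat_bound D y" "mat_bound E z"
  shows "mat_mult (mat_mult x y) z = mat_mult x (mat_mult y z)"
  using mat_vec_mult[OF assms(1,2) mat_bound_column[OF assms(3)]]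
  by (simp add: mat_mult_def fun_eq_iff)

lemma mat_bound_add:
  assumes x: "mat_bound C x" and y: "mat_bound D y"
  shows "mat_bound (C + D) (\<lambda>i j. x i j + y i j)"
  unfolding mat_bound_def
proof (intro conjI allI)
  show "0 \<le> C + D" using x y by (simp add: mat_bound_def)
  fix a M N
  have "L2_set (\<lambda>i. cmod (\<Sum>j<N. (x i j + y i j) * a j)) {..<M} \<le>
    L2_set (\<lambda>i. cmod (\<Sum>j<N. x i j * a j) + cmod (\<Sum>j<N. y i j * a j)) {..<M}"
    by (intro L2_set_mono) (auto simp: distrib_right sum.distrib intro: norm_triangle_ineq)
  also have "\<dots> \<le> L2_set (\<lambda>i. cmod (\<Sum>j<N. x i j * a j)) {..<M} + L2_set (\<lambda>i. cmod (\<Sum>j<N. y i j * a j)) {..<M}"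
    by (rule L2_set_triangle_ineq)
  also have "\<dots> \<le> C * norm_upto N a + D * norm_upto N a"
    using x y unfolding mat_bound_def by (intro add_mono) blast+
  finally show "L2_set (\<lambda>i. cmod (\<Sum>j<N. (x i j + y i j) * a j)) {..<M} \<le> (C + D) * norm_upto N a"
    by (simp add: algebra_simps)
qed

lemma mat_bound_cscale:
  assumes x: "mat_bound C x"
  shows "mat_bound (cmod c * C) (\<lambda>i j. c * x i j)"
  unfolding mat_bound_def
proof (intro conjI allI)
  show "0 \<le> cmod c * C" using x by (simp add: mat_bound_def)
  fix a M N
  have "L2_set (\<lambda>i. cmod (\<Sum>j<N. c * x i j * a j)) {..<M} = cmod c * L2_set (\<lambda>i. cmod (\<Sum>j<N. x i j * a j)) {..<M}"
  proof -
    have "(\<Sum>j<N. c * x i j * a j) = c * (\<Sum>j<N. x i j * a j)" for i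
      by (simp add: sum_distrib_left mult.assoc)
    then show ?thesis by (simp add: L2_set_right_distrib norm_mult)
  qed
  also have "\<dots> \<le> cmod c * (C * norm_upto N a)"
    using x unfolding mat_bound_def by (intro mult_left_mono) auto
  finally show "L2_set (\<lambda>i. cmod (\<Sum>j<N. c * x i j * a j)) {..<M} \<le> cmod c * C * norm_upto N a"
    by (simp add: algebra_simps)
qed

lemma mat_bound_injection:
  assumes "inj \<alpha>" shows "mat_bound 1 (\<lambda>i j. if i = \<alpha> j then 1 else 0)"
  unfolding mat_bound_def
proof (intro conjI allI)
  fix a :: "nat \<Rightarrow> complex" and M N
  define c where "c i = (\<Sum>j<N. (if i = \<alpha> j then 1 else 0) * a j)" for i
  have c: "c (\<alpha> j) = a j" if "j < N" for j
  proof -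
    have "c (\<alpha> j) = (\<Sum>k<N. if k = j then a k else 0)"
      unfolding c_def using assms by (intro sum.cong) (auto simp: inj_def)
    then show ?thesis using that by simp
  qed
  have c0: "c i = 0" if "i \<notin> \<alpha> ` {..<N}" for i
    unfolding c_def using that by (intro sum.neutral) auto
  have "(\<Sum>i<M. (cmod (c i))\<^sup>2) = (\<Sum>i\<in>{..<M} \<inter> \<alpha> ` {..<N}. (cmod (c i))\<^sup>2)"
    using c0 by (intro sum.mono_neutral_right) auto
  also have "\<dots> \<le> (\<Sum>i\<in>\<alpha> ` {..<N}. (cmod (c i))\<^sup>2)"
    by (intro sum_mono2) auto
  also have "\<dots> = (\<Sum>j<N. (cmod (a j))\<^sup>2)"
    using assms c by (subst sum.reindex) (auto intro: inj_on_subset)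
  finally show "L2_set (\<lambda>i. cmod (\<Sum>j<N. (if i = \<alpha> j then 1 else 0) * a j)) {..<M}
      \<le> 1 * norm_upto N a"
    by (simp add: L2_set_def c_def)
qed simp

lemma mat_bound_norm:
  assumes "mat_bound C x" shows "mat_bound (mat_norm x) x"
  unfolding mat_bound_def
proof (intro conjI allI)
  have ne: "{C. mat_bound C x} \<noteq> {}" using assms by auto
  show nn: "0 \<le> mat_norm x"
    unfolding mat_norm_def using ne by (intro cInf_greatest) (auto simp: mat_bound_def)
  fix a M N
  let ?l = "L2_set (\<lambda>i. cmod (\<Sum>j<N. x i j * a j)) {..<M}" and ?r = "norm_upto N a"
  have le: "?l \<le> D * ?r" if "mat_bound D x" for D using that by (simp add: mat_bound_def)
  show "?l \<le> mat_norm x * ?r"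
  proof (cases "?r = 0")
    case True then show ?thesis using le[OF assms] by simp
  next
    case False
    then have r: "?r > 0" using L2_set_nonneg[of "\<lambda>j. cmod (a j)" "{..<N}"] by linarith
    have "?l / ?r \<le> mat_norm x"
      unfolding mat_norm_def using ne le r by (intro cInf_greatest) (auto simp: field_simps)
    then show ?thesis using r by (simp add: field_simps)
  qed
qed

lemma mat_norm_le: "mat_bound C x \<Longrightarrow> mat_norm x \<le> C"
  unfolding mat_norm_def by (intro cInf_lower) (auto intro!: bdd_belowI[of _ 0] simp: mat_bound_def)

lemma mat_adj_mult:
  assumes x: "mat_bound C x" and y: "mat_bound D y"
  shows "mat_adj (mat_mult x y) = mat_mult (mat_adj y) (mat_adj x)"
proof (intro ext)
  fix i j
  have "summable (\<lambda>k. x j k * y k i)"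
    using l2_bound_summable[OF mat_bound_row[OF x] mat_bound_column[OF y]] .
  then have "(\<lambda>k. cnj (x j k * y k i)) sums cnj (\<Sum>k. x j k * y k i)"
    unfolding sums_cnj by (rule summable_sums)
  then show "mat_adj (mat_mult x y) i j = mat_mult (mat_adj y) (mat_adj x) i j"
    by (simp add: mat_adj_def mat_mult_def mat_vec_def sums_iff mult.commute)
qed

lemma mat_adj_mult_diag:
  assumes x: "mat_bound C x"
  shows "(\<lambda>i. of_real ((cmod (x i j))\<^sup>2)) sums (mat_mult (mat_adj x) x j j)"
proof -
  have "summable (\<lambda>k. mat_adj x j k * x k j)"
    using l2_bound_summable[OF mat_bound_row[OF mat_bound_adj[OF x]] mat_bound_column[OF x]] .
  then show ?thesis
    by (simp add: mat_mult_def mat_vec_def mat_adj_def sums_iff complex_norm_square mult.commute del: of_real_power)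
qed

text \<open>The identity \<open>\<parallel>x a\<parallel>\<^sup>2 = \<langle>x\<^sup>* x a, a\<rangle>\<close>, the nontrivial half of the C*-identity.\<close>

lemma mat_bound_adj_mult:
  assumes x: "mat_bound C x" and b: "mat_bound D (mat_mult (mat_adj x) x)"
  shows "mat_bound (sqrt D) x"
  unfolding mat_bound_def
proof (intro conjI allI)
  show "0 \<le> sqrt D" using b by (simp add: mat_bound_def)
  fix a M N
  define c where "c i = (\<Sum>j<N. x i j * a j)" for i
  define s where "s = norm_upto N a"
  have c2: "l2_bound (C * s) c" unfolding c_def s_def by (rule mat_bound_sum_column[OF x])
  have "(\<Sum>i. cnj (c i) * c i) = (\<Sum>i. \<Sum>j<N. cnj (a j) * (mat_adj x j i * c i))"
  proof -
    have "cnj (c i) * d = (\<Sum>j<N. cnj (a j) * (mat_adj x j i * d))" for i d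
      by (simp add: c_def mat_adj_def sum_distrib_left mult_ac)
    then show ?thesis by simp
  qed
  also have "\<dots> = (\<Sum>j<N. cnj (a j) * mat_vec (mat_adj x) c j)"
    unfolding mat_vec_def
    using l2_bound_summable[OF mat_bound_row[OF mat_bound_adj[OF x]] c2]
    by (subst suminf_sum) (auto intro: summable_mult simp: suminf_mult)
  also have "\<dots> = (\<Sum>j<N. \<Sum>k<N. cnj (a j) * mat_mult (mat_adj x) x j k * a k)"
    unfolding mat_mult_def c_def
    by (simp add: mat_vec_finite_sum[OF mat_bound_adj[OF x] mat_bound_column[OF x], symmetric]
        sum_distrib_left mult.assoc)
  finally have "cmod (\<Sum>i. cnj (c i) * c i) \<le> D * L2_set (\<lambda>j. cmod (cnj (a j))) {..<N} * s"
    unfolding s_def using mat_bound_form[OF b, where a = a and b = "\<lambda>j. cnj (a j)" and M = N and N = N] by simp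
  moreover have "(\<Sum>i. cnj (c i) * c i) = of_real (\<Sum>i. (cmod (c i))\<^sup>2)"
  proof -
    have "(\<lambda>i. of_real ((cmod (c i))\<^sup>2)) sums (of_real (\<Sum>i. (cmod (c i))\<^sup>2) :: complex)"
      using l2_bound_summable_sq[OF c2] by (intro sums_of_real summable_sums)
    then show ?thesis by (simp add: sums_iff complex_norm_square mult.commute del: of_real_power)
  qed
  ultimately have le: "(\<Sum>i. (cmod (c i))\<^sup>2) \<le> D * s\<^sup>2"
    using suminf_nonneg[OF l2_bound_summable_sq[OF c2]] by (simp add: s_def power2_eq_square mult.assoc)
  have "(\<Sum>i<M. (cmod (c i))\<^sup>2) \<le> D * s\<^sup>2"
    using sum_le_suminf[OF l2_bound_summable_sq[OF c2], of "{..<M}"] le by simp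
  then have "norm_upto M c \<le> sqrt (D * s\<^sup>2)" by (simp add: L2_set_def)
  also have "\<dots> = sqrt D * s" by (simp add: real_sqrt_mult s_def L2_set_nonneg)
  finally show "L2_set (\<lambda>i. cmod (\<Sum>j<N. x i j * a j)) {..<M} \<le> sqrt D * norm_upto N a"
    by (simp add: c_def s_def)
qed


lemma bounded_matrices_simps [simp]:
  "x \<otimes>\<^bsub>\<B>\<^esub> y = mat_mult x y"
  "\<one>\<^bsub>\<B>\<^esub> = (\<lambda>i j. if i = j then 1 else 0)"
  "\<zero>\<^bsub>\<B>\<^esub> = (\<lambda>i j. 0)"
  "x \<oplus>\<^bsub>\<B>\<^esub> y = (\<lambda>i j. x i j + y i j)"
  "cscale \<B> c x = (\<lambda>i j. c * x i j)"
  "star \<B> = mat_adj"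
  "cnorm \<B> = mat_norm"
  by (simp_all add: \<B>_def)

lemma bounded_matrices_carrier: "x \<in> carrier \<B> \<longleftrightarrow> (\<exists>C. mat_bound C x)"
  by (simp add: \<B>_def)

lemma mat_mult_add_left:
  assumes "mat_bound C x" "mat_bound D y" "mat_bound E z"
  shows "mat_mult (\<lambda>i j. x i j + y i j) z = (\<lambda>i j. mat_mult x z i j + mat_mult y z i j)"
  using suminf_add[OF l2_bound_summable[OF mat_bound_row[OF assms(1)] mat_bound_column[OF assms(3)]]
      l2_bound_summable[OF mat_bound_row[OF assms(2)] mat_bound_column[OF assms(3)]]]
  by (simp add: mat_mult_def mat_vec_def fun_eq_iff distrib_right)

lemma mat_mult_add_right:
  assumes "mat_bound C x" "mat_bound D y" "mat_bound E z"
  shows "mat_mult z (\<lambda>i j. x i j + y i j) = (\<lambda>i j. mat_mult z x i j + mat_mult z y i j)"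
  using suminf_add[OF l2_bound_summable[OF mat_bound_row[OF assms(3)] mat_bound_column[OF assms(1)]]
      l2_bound_summable[OF mat_bound_row[OF assms(3)] mat_bound_column[OF assms(2)]]]
  by (simp add: mat_mult_def mat_vec_def fun_eq_iff distrib_left)

lemma mat_bound_zero: "mat_bound 0 (\<lambda>i j. 0)"
  by (simp add: mat_bound_def L2_set_def)

lemma mat_bound_one: "mat_bound 1 (\<lambda>i j. if i = j then 1 else 0)"
  using mat_bound_injection[of id] by simp

lemma mat_mult_injection_left:
  assumes "inj \<alpha>" shows "mat_mult (\<lambda>i j. if i = \<alpha> j then 1 else 0) x (\<alpha> i) j = x i j"
proof -
  have "(\<Sum>k. (if \<alpha> i = \<alpha> k then 1 else 0) * x k j) = (\<Sum>k\<in>{i}. (if \<alpha> i = \<alpha> k then 1 else 0) * x k j)"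
    using assms by (intro suminf_finite) (auto simp: inj_def)
  then show ?thesis by (simp add: mat_mult_def mat_vec_def)
qed

lemma mat_mult_injection_right: "mat_mult x (\<lambda>i j. if i = \<alpha> j then 1 else 0) i j = x i (\<alpha> j)"
proof -
  have "(\<Sum>k. x i k * (if k = \<alpha> j then 1 else 0)) = (\<Sum>k\<in>{\<alpha> j}. x i k * (if k = \<alpha> j then 1 else 0))"
    by (intro suminf_finite) auto
  then show ?thesis by (simp add: mat_mult_def mat_vec_def)
qed

lemma ring_bounded_matrices: "ring \<B>"
proof (rule ringI)
  show "abelian_group \<B>"
  proof (rule abelian_groupI)
    fix x assume "x \<in> carrier \<B>"
    then obtain C where "mat_bound C x" by (auto simp: bounded_matrices_carrier)
    from mat_bound_cscale[OF this, of "-1"]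
    have "(\<lambda>i j. - x i j) \<in> carrier \<B>" by (auto simp: bounded_matrices_carrier)
    then show "\<exists>y\<in>carrier \<B>. y \<oplus>\<^bsub>\<B>\<^esub> x = \<zero>\<^bsub>\<B>\<^esub>"
      by (rule bexI[rotated]) simp
  qed (auto simp: bounded_matrices_carrier add_ac intro: mat_bound_add mat_bound_zero)
  show "monoid \<B>"
  proof
    fix x y z assume "x \<in> carrier \<B>" "y \<in> carrier \<B>" "z \<in> carrier \<B>"
    then show "x \<otimes>\<^bsub>\<B>\<^esub> y \<otimes>\<^bsub>\<B>\<^esub> z = x \<otimes>\<^bsub>\<B>\<^esub> (y \<otimes>\<^bsub>\<B>\<^esub> z)"
      by (auto simp: bounded_matrices_carrier intro: mat_mult_assoc)
  next
    fix x :: "nat \<Rightarrow> nat \<Rightarrow> complex"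
    show "\<one>\<^bsub>\<B>\<^esub> \<otimes>\<^bsub>\<B>\<^esub> x = x"
      using mat_mult_injection_left[of id x] by (simp add: fun_eq_iff)
    show "x \<otimes>\<^bsub>\<B>\<^esub> \<one>\<^bsub>\<B>\<^esub> = x"
      using mat_mult_injection_right[of x id] by (simp add: fun_eq_iff)
  qed (auto simp: bounded_matrices_carrier intro: mat_bound_mult mat_bound_one)
qed (auto simp: bounded_matrices_carrier intro: mat_mult_add_left mat_mult_add_right)

lemma bounded_matrices_minus:
  assumes "x \<in> carrier \<B>" "y \<in> carrier \<B>"
  shows "x \<ominus>\<^bsub>\<B>\<^esub> y = (\<lambda>i j. x i j - y i j)"
proof -
  interpret ring \<B> by (rule ring_bounded_matrices)
  obtain C where C: "mat_bound C y" using assms(2) by (auto simp: bounded_matrices_carrier)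
  have "(\<lambda>i j. - y i j) \<in> carrier \<B>"
    using mat_bound_cscale[OF C, of "-1"] by (auto simp: bounded_matrices_carrier)
  then have "\<ominus>\<^bsub>\<B>\<^esub> y = (\<lambda>i j. - y i j)"
    using assms(2) by (intro minus_equality) auto
  then show ?thesis by (simp add: minus_eq)
qed

lemma mat_norm_adj_le:
  assumes "mat_bound C x" shows "mat_norm (mat_adj x) \<le> mat_norm x"
  using mat_norm_le[OF mat_bound_adj[OF mat_bound_norm[OF assms]]] .

text \<open>Entries are dominated by the norm, so a Cauchy sequence converges entrywise; the bounds on the finite
  sections of the differences pass to the limit.\<close>

lemma mat_norm_cauchy_limit:
  assumes X: "\<And>k. mat_bound (B k) (X k)"
    and cauchy: "\<And>e. e > 0 \<Longrightarrow> \<exists>N. \<forall>i\<ge>N. \<forall>j\<ge>N. mat_norm (\<lambda>p q. X i p q - X j p q) < e"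
  shows "\<exists>x C. mat_bound C x \<and> (\<lambda>k. mat_norm (\<lambda>p q. X k p q - x p q)) \<longlonglongrightarrow> 0"
proof -
  have diff: "mat_bound (mat_norm (\<lambda>p q. X i p q - X j p q)) (\<lambda>p q. X i p q - X j p q)" for i j
    using mat_bound_norm[OF mat_bound_add[OF X[of i] mat_bound_cscale[OF X[of j], of "-1"]]] by simp
  have "convergent (\<lambda>k. X k p q)" for p q
  proof (rule Cauchy_convergent, rule metric_CauchyI)
    fix e :: real assume "e > 0"
    with cauchy obtain N where N: "\<And>i j. i \<ge> N \<Longrightarrow> j \<ge> N \<Longrightarrow> mat_norm (\<lambda>p q. X i p q - X j p q) < e"
      by blast
    have "dist (X i p q) (X j p q) < e" if "i \<ge> N" "j \<ge> N" for i j
      using mat_bound_entry[OF diff[of i j], of p q] N[OF that] by (simp add: dist_norm)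
    then show "\<exists>M. \<forall>m\<ge>M. \<forall>n\<ge>M. dist (X m p q) (X n p q) < e" by blast
  qed
  then obtain x where x: "\<And>p q. (\<lambda>k. X k p q) \<longlonglongrightarrow> x p q" unfolding convergent_def by metis
  have close: "\<exists>N. \<forall>i\<ge>N. mat_bound e (\<lambda>p q. X i p q - x p q)" if e: "e > 0" for e
  proof -
    obtain N where N: "\<And>i j. i \<ge> N \<Longrightarrow> j \<ge> N \<Longrightarrow> mat_norm (\<lambda>p q. X i p q - X j p q) < e"
      using cauchy[OF e] by blast
    have "mat_bound e (\<lambda>p q. X i p q - x p q)" if i: "i \<ge> N" for i
      unfolding mat_bound_def
    proof (intro conjI allI)
      fix a M M'
      have "(\<lambda>j. L2_set (\<lambda>p. cmod (\<Sum>q<M'. (X i p q - X j p q) * a q)) {..<M})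
        \<longlonglongrightarrow> L2_set (\<lambda>p. cmod (\<Sum>q<M'. (X i p q - x p q) * a q)) {..<M}"
        unfolding L2_set_def by (intro tendsto_intros x)
      moreover have "L2_set (\<lambda>p. cmod (\<Sum>q<M'. (X i p q - X j p q) * a q)) {..<M}
        \<le> e * L2_set (\<lambda>q. cmod (a q)) {..<M'}" if "j \<ge> N" for j
        using mat_bound_mono[OF diff[of i j]] N[OF i that] by (simp add: mat_bound_def)
      ultimately show "L2_set (\<lambda>p. cmod (\<Sum>q<M'. (X i p q - x p q) * a q)) {..<M}
        \<le> e * L2_set (\<lambda>q. cmod (a q)) {..<M'}"
        by (blast intro: LIMSEQ_le_const2)
    qed (use e in simp)
    then show ?thesis by blast
  qed
  obtain N where N: "mat_bound 1 (\<lambda>p q. X N p q - x p q)" using close[of 1] by auto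
  have "mat_bound (B N + cmod (-1) * 1) (\<lambda>p q. X N p q + (-1) * (X N p q - x p q))"
    by (intro mat_bound_add mat_bound_cscale X N)
  then have "mat_bound (B N + 1) x" by simp
  moreover have "(\<lambda>k. mat_norm (\<lambda>p q. X k p q - x p q)) \<longlonglongrightarrow> 0"
  proof (rule tendstoI)
    fix e :: real assume e: "e > 0"
    then obtain M where M: "\<And>i. i \<ge> M \<Longrightarrow> mat_bound (e/2) (\<lambda>p q. X i p q - x p q)"
      using close[of "e/2"] by auto
    have "dist (mat_norm (\<lambda>p q. X k p q - x p q)) 0 < e" if "k \<ge> M" for k
      using mat_norm_le[OF M[OF that]] mat_bound_norm[OF M[OF that]] e by (simp add: mat_bound_def)
    then show "\<forall>\<^sub>F k in sequentially. dist (mat_norm (\<lambda>p q. X k p q - x p q)) 0 < e"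
      unfolding eventually_sequentially by blast
  qed
  ultimately show ?thesis by blast
qed

lemma cstar_algebra_bounded_matrices: "cstar_algebra \<B>"
proof (intro cstar_algebra.intro ring_bounded_matrices cstar_algebra_axioms.intro)
  note car = bounded_matrices_carrier
  fix x y :: "nat \<Rightarrow> nat \<Rightarrow> complex" and c d :: complex
  assume "x \<in> carrier \<B>"
  then obtain C where C: "mat_bound C x" by (auto simp: car)
  show "cscale \<B> c x \<in> carrier \<B>"
    using mat_bound_cscale[OF C] by (auto simp: car)
  show "star \<B> x \<in> carrier \<B>"
    using mat_bound_adj[OF C] by (auto simp: car)
  show "0 \<le> cnorm \<B> x"
    using mat_bound_norm[OF C] by (simp add: mat_bound_def)
  show "cnorm \<B> x = 0 \<longleftrightarrow> x = \<zero>\<^bsub>\<B>\<^esub>"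
  proof
    assume "cnorm \<B> x = 0"
    then show "x = \<zero>\<^bsub>\<B>\<^esub>"
      using mat_bound_entry[OF mat_bound_norm[OF C]] by (simp add: fun_eq_iff)
  next
    assume "x = \<zero>\<^bsub>\<B>\<^esub>"
    then show "cnorm \<B> x = 0"
      using mat_norm_le[OF mat_bound_zero] mat_bound_norm[OF mat_bound_zero] by (simp add: mat_bound_def)
  qed
  show "cnorm \<B> (cscale \<B> c x) = cmod c * cnorm \<B> x"
  proof (rule antisym)
    show le: "cnorm \<B> (cscale \<B> c x) \<le> cmod c * cnorm \<B> x"
      using mat_norm_le[OF mat_bound_cscale[OF mat_bound_norm[OF C], of c]] by simp
    show "cmod c * cnorm \<B> x \<le> cnorm \<B> (cscale \<B> c x)"
    proof (cases "c = 0")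
      case True
      then show ?thesis using mat_bound_norm[OF mat_bound_cscale[OF C, of c]] by (simp add: mat_bound_def)
    next
      case False
      then have "mat_norm x \<le> inverse (cmod c) * mat_norm (\<lambda>i j. c * x i j)"
        using mat_norm_le[OF mat_bound_cscale[OF mat_bound_norm[OF mat_bound_cscale[OF C, of c]], of "inverse c"]]
        by (simp add: norm_inverse flip: mult.assoc)
      then show ?thesis using False by (simp add: field_simps)
    qed
  qed
  show "cnorm \<B> (star \<B> x \<otimes>\<^bsub>\<B>\<^esub> x) = (cnorm \<B> x)\<^sup>2"
  proof (rule antisym)
    have "mat_norm (mat_mult (mat_adj x) x) \<le> mat_norm (mat_adj x) * mat_norm x"
      by (intro mat_norm_le mat_bound_mult mat_bound_norm[OF C] mat_bound_norm[OF mat_bound_adj[OF C]])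
    also have "\<dots> \<le> mat_norm x * mat_norm x"
      using mat_norm_adj_le[OF C] mat_bound_norm[OF C] by (intro mult_right_mono) (auto simp: mat_bound_def)
    finally show "cnorm \<B> (star \<B> x \<otimes>\<^bsub>\<B>\<^esub> x) \<le> (cnorm \<B> x)\<^sup>2"
      by (simp add: power2_eq_square)
    have b: "mat_bound (mat_norm (mat_mult (mat_adj x) x)) (mat_mult (mat_adj x) x)"
      by (rule mat_bound_norm[OF mat_bound_mult[OF mat_bound_adj[OF C] C]])
    have "(mat_norm x)\<^sup>2 \<le> (sqrt (mat_norm (mat_mult (mat_adj x) x)))\<^sup>2"
      using mat_norm_le[OF mat_bound_adj_mult[OF C b]] mat_bound_norm[OF C]
      by (intro power_mono) (auto simp: mat_bound_def)
    then show "(cnorm \<B> x)\<^sup>2 \<le> cnorm \<B> (star \<B> x \<otimes>\<^bsub>\<B>\<^esub> x)"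
      using b by (simp add: mat_bound_def)
  qed
  assume "y \<in> carrier \<B>"
  then obtain D where D: "mat_bound D y" by (auto simp: car)
  show "cscale \<B> c x \<otimes>\<^bsub>\<B>\<^esub> y = cscale \<B> c (x \<otimes>\<^bsub>\<B>\<^esub> y)"
    using suminf_mult[OF l2_bound_summable[OF mat_bound_row[OF C] mat_bound_column[OF D]], where c = c]
    by (simp add: mat_mult_def mat_vec_def fun_eq_iff mult.assoc)
  show "x \<otimes>\<^bsub>\<B>\<^esub> cscale \<B> c y = cscale \<B> c (x \<otimes>\<^bsub>\<B>\<^esub> y)"
    using suminf_mult[OF l2_bound_summable[OF mat_bound_row[OF C] mat_bound_column[OF D]], where c = c]
    by (simp add: mat_mult_def mat_vec_def fun_eq_iff mult.left_commute)
  show "star \<B> (x \<otimes>\<^bsub>\<B>\<^esub> y) = star \<B> y \<otimes>\<^bsub>\<B>\<^esub> star \<B> x"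
    using mat_adj_mult[OF C D] by simp
  show "cnorm \<B> (x \<oplus>\<^bsub>\<B>\<^esub> y) \<le> cnorm \<B> x + cnorm \<B> y"
    using mat_norm_le[OF mat_bound_add[OF mat_bound_norm[OF C] mat_bound_norm[OF D]]] by simp
  show "cnorm \<B> (x \<otimes>\<^bsub>\<B>\<^esub> y) \<le> cnorm \<B> x * cnorm \<B> y"
    using mat_norm_le[OF mat_bound_mult[OF mat_bound_norm[OF C] mat_bound_norm[OF D]]] by simp
next
  fix X :: "nat \<Rightarrow> nat \<Rightarrow> nat \<Rightarrow> complex"
  assume X: "\<And>k. X k \<in> carrier \<B>"
    and cauchy: "\<And>e. e > 0 \<Longrightarrow> \<exists>N. \<forall>i\<ge>N. \<forall>j\<ge>N. cnorm \<B> (X i \<ominus>\<^bsub>\<B>\<^esub> X j) < e"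
  obtain B where B: "\<And>k. mat_bound (B k) (X k)" using X unfolding bounded_matrices_carrier by metis
  have "\<exists>N. \<forall>i\<ge>N. \<forall>j\<ge>N. mat_norm (\<lambda>p q. X i p q - X j p q) < e" if "e > 0" for e
    using cauchy[OF that] by (simp add: bounded_matrices_minus[OF X X])
  from mat_norm_cauchy_limit[OF B this] obtain x C
    where "mat_bound C x" and lim: "(\<lambda>k. mat_norm (\<lambda>p q. X k p q - x p q)) \<longlonglongrightarrow> 0" by blast
  then have x: "x \<in> carrier \<B>" by (auto simp: bounded_matrices_carrier)
  with lim show "\<exists>x\<in>carrier \<B>. (\<lambda>k. cnorm \<B> (X k \<ominus>\<^bsub>\<B>\<^esub> x)) \<longlonglongrightarrow> 0"
    by (intro bexI[OF _ x]) (simp add: bounded_matrices_minus[OF X x])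
qed (auto simp: fun_eq_iff distrib_left distrib_right mat_adj_def)

section \<open>Gibbs states of representations by matrices\<close>

text \<open>Fubini for absolutely convergent double series, transferred from unordered summation.\<close>

lemma suminf_swap:
  fixes f :: "nat \<Rightarrow> nat \<Rightarrow> complex"
  assumes row: "\<And>k. summable (\<lambda>l. norm (f k l))" and total: "summable (\<lambda>k. \<Sum>l. norm (f k l))"
  shows "(\<Sum>k. \<Sum>l. f k l) = (\<Sum>l. \<Sum>k. f k l)"
proof -
  have inf_eq: "infsum g UNIV = suminf g" if "summable (\<lambda>n. norm (g n))" for g :: "nat \<Rightarrow> complex"
    using norm_summable_imp_has_sum[OF that] that
    by (metis infsumI summable_norm_cancel summable_sums)
  have inf_eq': "infsum g UNIV = suminf g" if "summable (\<lambda>n. norm (g n))" for g :: "nat \<Rightarrow> real"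
    using norm_summable_imp_has_sum[OF that] that
    by (metis infsumI summable_norm_cancel summable_sums)
  have abs_iff: "(\<lambda>x. norm (g x)) summable_on UNIV \<longleftrightarrow> summable (\<lambda>n. norm (g n))" for g :: "nat \<Rightarrow> complex"
    by (subst summable_on_UNIV_nonneg_real_iff) auto
  have abs_iff': "(\<lambda>x. \<bar>g x\<bar>) summable_on UNIV \<longleftrightarrow> summable (\<lambda>n. \<bar>g n\<bar>)" for g :: "nat \<Rightarrow> real"
    by (subst summable_on_UNIV_nonneg_real_iff) auto
  have total': "summable (\<lambda>k. norm (\<Sum>l. norm (f k l)))"
    using total by (subst real_norm_def, subst abs_of_nonneg) (auto intro: suminf_nonneg row)
  have abs: "(\<lambda>x. norm (case x of (k, l) \<Rightarrow> f k l)) summable_on UNIV \<times> UNIV"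
    unfolding Infinite_Sum.abs_summable_on_Sigma_iff
    using row total' by (simp add: inf_eq' abs_iff abs_iff')
  have abs': "(\<lambda>x. norm (case x of (l, k) \<Rightarrow> f k l)) summable_on UNIV \<times> UNIV"
  proof -
    have "(\<lambda>x. norm (case prod.swap x of (k, l) \<Rightarrow> f k l)) summable_on UNIV \<times> UNIV"
      using abs by (subst summable_on_reindex_bij_betw[of prod.swap "UNIV \<times> UNIV"])
        (auto simp: bij_betw_def inj_on_def image_iff)
    then show ?thesis by (simp add: case_prod_unfold)
  qed
  have col: "summable (\<lambda>k. norm (f k l))" for l
    using abs' unfolding Infinite_Sum.abs_summable_on_Sigma_iff by (simp add: abs_iff)
  have col_total: "summable (\<lambda>l. norm (\<Sum>k. norm (f k l)))"
    using abs' unfolding Infinite_Sum.abs_summable_on_Sigma_iff by (simp add: abs_iff abs_iff' inf_eq' col)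
  have "(\<Sum>k. \<Sum>l. f k l) = (\<Sum>\<^sub>\<infinity>k. \<Sum>\<^sub>\<infinity>l. f k l)"
  proof -
    have "summable (\<lambda>k. norm (\<Sum>l. f k l))"
      using summable_norm[OF row] by (intro summable_comparison_test'[OF total]) auto
    then show ?thesis by (simp add: inf_eq row)
  qed
  also have "\<dots> = (\<Sum>\<^sub>\<infinity>l. \<Sum>\<^sub>\<infinity>k. f k l)"
    by (rule infsum_swap_banach[OF abs_summable_summable[OF abs]])
  also have "\<dots> = (\<Sum>l. \<Sum>k. f k l)"
  proof -
    have "summable (\<lambda>l. norm (\<Sum>k. f k l))"
      using summable_norm[OF col] by (intro summable_comparison_test'[OF col_total]) (auto intro: order.trans[OF _ abs_ge_self])
    then show ?thesis by (simp add: inf_eq col)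
  qed
  finally show ?thesis .
qed

locale matrix_representation = cstar_algebra A for A :: "'a cstar" (structure) +
  fixes \<pi> :: "'a \<Rightarrow> nat \<Rightarrow> nat \<Rightarrow> complex"
  assumes rep: "star_hom A \<B> \<pi>"
begin

lemma rep_closed: "x \<in> carrier A \<Longrightarrow> \<pi> x \<in> carrier \<B>"
  using rep by (auto simp: star_hom_def ring_hom_def)

lemma rep_bound: assumes "x \<in> carrier A" obtains C where "mat_bound C (\<pi> x)"
  using rep_closed[OF assms] by (auto simp: bounded_matrices_carrier)

lemma rep_add: "x \<in> carrier A \<Longrightarrow> y \<in> carrier A \<Longrightarrow> \<pi> (x \<oplus> y) i j = \<pi> x i j + \<pi> y i j"
  using rep by (auto simp: star_hom_def ring_hom_def)

lemma rep_cscale: "x \<in> carrier A \<Longrightarrow> \<pi> (cscale A c x) i j = c * \<pi> x i j"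
  using rep by (auto simp: star_hom_def)

lemma rep_star: "x \<in> carrier A \<Longrightarrow> \<pi> (star A x) = mat_adj (\<pi> x)"
  using rep by (auto simp: star_hom_def)

lemma rep_mult: "x \<in> carrier A \<Longrightarrow> y \<in> carrier A \<Longrightarrow> \<pi> (x \<otimes> y) = mat_mult (\<pi> x) (\<pi> y)"
  using rep by (auto simp: star_hom_def ring_hom_def)

lemma rep_one: "\<pi> \<one> i j = (if i = j then 1 else 0)"
  using rep by (auto simp: star_hom_def ring_hom_def)

lemma rep_minus:
  assumes "x \<in> carrier A" "y \<in> carrier A" shows "\<pi> (x \<ominus> y) i j = \<pi> x i j - \<pi> y i j"
  using assms by (simp add: minus_eq uminus_eq_cscale rep_add rep_cscale cscale_closed)

text \<open>The diagonal entries of \<open>\<pi> (x\<^sup>* x)\<close> are the squared norms of the columns of \<open>\<pi> x\<close>.\<close>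

lemma rep_square_diag:
  assumes "x \<in> carrier A"
  shows "(\<lambda>i. of_real ((cmod (\<pi> x i j))\<^sup>2)) sums (\<pi> (star A x \<otimes> x) j j)"
  using rep_bound[OF assms] mat_adj_mult_diag assms by (metis rep_mult rep_star star_closed)

lemma rep_square_diag_real:
  assumes "x \<in> carrier A"
  shows "(\<lambda>i. (cmod (\<pi> x i j))\<^sup>2) sums Re (\<pi> (star A x \<otimes> x) j j)" "\<pi> (star A x \<otimes> x) j j \<in> \<real>"
proof -
  show "(\<lambda>i. (cmod (\<pi> x i j))\<^sup>2) sums Re (\<pi> (star A x \<otimes> x) j j)"
    using sums_Re[OF rep_square_diag[OF assms, of j]] by (simp del: of_real_power)
  show "\<pi> (star A x \<otimes> x) j j \<in> \<real>"
    using sums_Im[OF rep_square_diag[OF assms, of j]] by (simp add: sums_iff complex_is_Real_iff del: of_real_power)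
qed

lemma diag_state: "cstar_state A (\<lambda>x. \<pi> x j j)"
  unfolding cstar_state_def
  using rep_square_diag_real suminf_nonneg[OF sums_summable[OF rep_square_diag_real(1)]]
  by (auto simp: rep_add rep_cscale rep_one sums_iff)

text \<open>Diagonal entries are states of \<open>A\<close>, so columns, rows and entries of \<open>\<pi> x\<close> are bounded by the norm
  of \<open>x\<close> in \<open>A\<close> itself.\<close>

lemma rep_column:
  assumes x: "x \<in> carrier A" shows "l2_bound (cnorm A x) (\<lambda>i. \<pi> x i j)"
  unfolding l2_bound_def
proof
  fix N
  have "(\<Sum>i<N. (cmod (\<pi> x i j))\<^sup>2) \<le> Re (\<pi> (star A x \<otimes> x) j j)"
    using rep_square_diag_real(1)[OF x, of j]
    by (metis sum_le_suminf[of _ "{..<N}"] finite_lessThan sums_iff zero_le_power2)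
  also have "\<dots> \<le> (cnorm A x)\<^sup>2" by (rule state_square_le[OF diag_state x])
  finally show "L2_set (\<lambda>i. cmod (\<pi> x i j)) {..<N} \<le> cnorm A x"
    unfolding L2_set_def by (intro real_le_lsqrt) (auto simp: x cnorm_nonneg sum_nonneg)
qed

lemma rep_row:
  assumes x: "x \<in> carrier A" shows "l2_bound (cnorm A x) (\<lambda>j. \<pi> x i j)"
  using rep_column[OF star_closed[OF x], of i] x
  by (simp add: rep_star mat_adj_def l2_bound_def cnorm_star)

lemma rep_entry:
  assumes x: "x \<in> carrier A" shows "cmod (\<pi> x i j) \<le> cnorm A x"
proof -
  have "cmod (\<pi> x i j) \<le> L2_set (\<lambda>i. cmod (\<pi> x i j)) {..<Suc i}" by (rule member_le_L2_set) auto
  also have "\<dots> \<le> cnorm A x" using rep_column[OF x] by (simp add: l2_bound_def)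
  finally show ?thesis .
qed

lemma rep_mult_entry:
  assumes "x \<in> carrier A" "y \<in> carrier A"
  shows "(\<lambda>k. \<pi> x i k * \<pi> y k j) sums \<pi> (x \<otimes> y) i j"
  using l2_bound_summable[OF rep_row[OF assms(1)] rep_column[OF assms(2)]] assms
  by (simp add: rep_mult mat_mult_def mat_vec_def summable_sums)

lemma weighted_trace_summable:
  assumes w: "\<And>k. 0 \<le> w k" "summable w" and x: "x \<in> carrier A"
  shows "summable (\<lambda>k. of_real (w k) * \<pi> x k k)"
proof (rule summable_comparison_test'[OF summable_mult2[OF w(2), of "cnorm A x"]])
  show "norm (of_real (w k) * \<pi> x k k) \<le> w k * cnorm A x" for k
    using w(1) rep_entry[OF x] by (simp add: norm_mult mult_left_mono)
qed

lemma weighted_trace_state: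
  assumes w: "\<And>k. 0 \<le> w k" "w sums 1"
  shows "cstar_state A (\<lambda>x. \<Sum>k. of_real (w k) * \<pi> x k k)"
  unfolding cstar_state_def
proof (intro conjI ballI allI)
  note sm = weighted_trace_summable[OF w(1) sums_summable[OF w(2)]]
  fix x y c assume x: "x \<in> carrier A" and y: "y \<in> carrier A"
  show "(\<Sum>k. of_real (w k) * \<pi> (x \<oplus> y) k k) = (\<Sum>k. of_real (w k) * \<pi> x k k) + (\<Sum>k. of_real (w k) * \<pi> y k k)"
    using suminf_add[OF sm[OF x] sm[OF y]] x y by (simp add: rep_add distrib_left)
next
  note sm = weighted_trace_summable[OF w(1) sums_summable[OF w(2)]]
  fix x c assume x: "x \<in> carrier A"
  show "(\<Sum>k. of_real (w k) * \<pi> (cscale A c x) k k) = c * (\<Sum>k. of_real (w k) * \<pi> x k k)"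
    using suminf_mult[OF sm[OF x], of c] x by (simp add: rep_cscale mult.left_commute)
next
  fix x assume x: "x \<in> carrier A"
  define r where "r k = w k * Re (\<pi> (star A x \<otimes> x) k k)" for k
  have r: "0 \<le> r k" for k
  proof -
    have "0 \<le> Re (\<pi> (star A x \<otimes> x) k k)"
      using rep_square_diag_real(1)[OF x, of k] suminf_nonneg[of "\<lambda>i. (cmod (\<pi> x i k))\<^sup>2"]
      by (auto simp: sums_iff)
    then show ?thesis using w(1) by (simp add: r_def)
  qed
  have eq: "of_real (w k) * \<pi> (star A x \<otimes> x) k k = of_real (r k)" for k
    using rep_square_diag_real(2)[OF x, of k] by (simp add: r_def complex_is_Real_iff complex_eq_iff)
  have "summable (\<lambda>k. of_real (r k) :: complex)"
    using weighted_trace_summable[OF w(1) sums_summable[OF w(2)], of "star A x \<otimes> x"] x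
    by (simp add: eq star_closed)
  then have "summable r" by (simp only: summable_of_real_iff)
  then have "(\<Sum>k. of_real (r k)) = complex_of_real (suminf r)" by (rule suminf_of_real[symmetric])
  with r suminf_nonneg[OF \<open>summable r\<close>] show "(\<Sum>k. of_real (w k) * \<pi> (star A x \<otimes> x) k k) \<in> \<real>"
    "0 \<le> Re (\<Sum>k. of_real (w k) * \<pi> (star A x \<otimes> x) k k)" by (simp_all add: eq)
next
  have "(\<lambda>k. complex_of_real (w k)) sums 1" using sums_of_real[OF w(2), where 'a = complex] by simp
  then show "(\<Sum>k. of_real (w k) * \<pi> \<one> k k) = 1" by (simp add: rep_one sums_iff)
qed

lemma rep_star_hom_comp:
  assumes "star_hom A A s" shows "matrix_representation A (\<lambda>x. \<pi> (s x))"
proof -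
  have "star_hom A \<B> (\<lambda>x. \<pi> (s x))"
    using assms rep unfolding star_hom_def ring_hom_def by (auto simp: Pi_iff)
  then show ?thesis by unfold_locales
qed

end

text \<open>Homogeneity of the generators makes \<open>\<pi>\<close> covariant: the dynamics is implemented by the diagonal
  unitary matrices with entries \<open>exp (\<i> t d k)\<close>.\<close>

locale graded_representation = matrix_representation +
  fixes P :: "'p monoid" and v :: "'p \<Rightarrow> 'a" and \<sigma> :: "real \<Rightarrow> 'a \<Rightarrow> 'a" and len :: "'p \<Rightarrow> nat"
    and d :: "nat \<Rightarrow> nat"
  assumes generates: "\<And>S. cstar_subalgebra A S \<Longrightarrow> v ` carrier P \<subseteq> S \<Longrightarrow> S = carrier A"
    and v_closed: "p \<in> carrier P \<Longrightarrow> v p \<in> carrier A"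
    and dyn: "cstar_dynamics A \<sigma>"
    and dyn_gen: "p \<in> carrier P \<Longrightarrow> \<sigma> t (v p) = cscale A (exp (\<i> * complex_of_real t * of_nat (len p))) (v p)"
    and homogeneous: "p \<in> carrier P \<Longrightarrow> \<pi> (v p) i j \<noteq> 0 \<Longrightarrow> d i = len p + d j"
begin

text \<open>Both sides are *-homomorphisms in \<open>x\<close> with contractive entries, so the elements on which they agree
  form a C*-subalgebra; it contains the generators.\<close>

lemma rep_dynamics:
  assumes x: "x \<in> carrier A"
  shows "\<pi> (\<sigma> t x) i j = exp (\<i> * of_real t * (of_nat (d i) - of_nat (d j))) * \<pi> x i j"
proof -
  define u where "u i j = exp (\<i> * of_real t * (of_nat (d i) - of_nat (d j)))" for i j
  have u_mult: "u i k * u k j = u i j" for i k j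
    unfolding u_def mult_exp_exp by (simp add: algebra_simps)
  have u_cnj: "cnj (u i j) = u j i" for i j
    by (simp add: u_def exp_cnj algebra_simps)
  have u_one: "u i i = 1" for i by (simp add: u_def)
  have u_norm: "cmod (u i j) = 1" for i j by (simp add: u_def norm_exp_eq_Re)
  have hom: "star_hom A A (\<sigma> t)" using dyn by (simp add: cstar_dynamics_def)
  interpret s: matrix_representation A "\<lambda>x. \<pi> (\<sigma> t x)" by (rule rep_star_hom_comp[OF hom])
  define S where "S = {x \<in> carrier A. \<forall>i j. \<pi> (\<sigma> t x) i j = u i j * \<pi> x i j}"
  have "cstar_subalgebra A S"
    unfolding cstar_subalgebra_def
  proof (intro conjI ballI allI impI)
    show "S \<subseteq> carrier A" by (auto simp: S_def)
    show "\<one> \<in> S" by (simp add: S_def s.rep_one rep_one u_one)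
  next
    fix x y assume "x \<in> S" "y \<in> S"
    then have x: "x \<in> carrier A" "\<And>i j. \<pi> (\<sigma> t x) i j = u i j * \<pi> x i j"
      and y: "y \<in> carrier A" "\<And>i j. \<pi> (\<sigma> t y) i j = u i j * \<pi> y i j" by (auto simp: S_def)
    show "x \<oplus> y \<in> S" using x y by (simp add: S_def s.rep_add rep_add distrib_left)
    have "\<pi> (\<sigma> t (x \<otimes> y)) i j = u i j * \<pi> (x \<otimes> y) i j" for i j
    proof (rule sums_unique2)
      show "(\<lambda>k. \<pi> (\<sigma> t x) i k * \<pi> (\<sigma> t y) k j) sums \<pi> (\<sigma> t (x \<otimes> y)) i j"
        by (rule s.rep_mult_entry[OF x(1) y(1)])
      have "(\<lambda>k. u i j * (\<pi> x i k * \<pi> y k j)) sums (u i j * \<pi> (x \<otimes> y) i j)"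
        by (rule sums_mult[OF rep_mult_entry[OF x(1) y(1)]])
      also have "(\<lambda>k. u i j * (\<pi> x i k * \<pi> y k j)) = (\<lambda>k. \<pi> (\<sigma> t x) i k * \<pi> (\<sigma> t y) k j)"
        by (simp add: fun_eq_iff x y flip: u_mult[of i _ j])
      finally show "(\<lambda>k. \<pi> (\<sigma> t x) i k * \<pi> (\<sigma> t y) k j) sums (u i j * \<pi> (x \<otimes> y) i j)" .
    qed
    then show "x \<otimes> y \<in> S" using x y by (simp add: S_def)
  next
    fix x c assume "x \<in> S"
    then have x: "x \<in> carrier A" "\<And>i j. \<pi> (\<sigma> t x) i j = u i j * \<pi> x i j" by (auto simp: S_def)
    show "star A x \<in> S"
      using x by (simp add: S_def star_closed s.rep_star rep_star mat_adj_def u_cnj)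
    show "cscale A c x \<in> S"
      using x by (simp add: S_def cscale_closed s.rep_cscale rep_cscale mult.left_commute)
  next
    fix X x assume x: "x \<in> carrier A" and X: "(\<forall>k::nat. X k \<in> S) \<and> (\<lambda>k. cnorm A (X k \<ominus> x)) \<longlonglongrightarrow> 0"
    then have Xc: "X k \<in> carrier A" and Xe: "\<pi> (\<sigma> t (X k)) i j = u i j * \<pi> (X k) i j" for k i j
      by (auto simp: S_def)
    have "\<pi> (\<sigma> t x) i j = u i j * \<pi> x i j" for i j
    proof -
      have "cmod (\<pi> (\<sigma> t x) i j - u i j * \<pi> x i j) \<le> 2 * cnorm A (X k \<ominus> x)" for k
      proof -
        have "\<pi> (\<sigma> t x) i j - u i j * \<pi> x i j = u i j * \<pi> (X k \<ominus> x) i j - \<pi> (\<sigma> t (X k \<ominus> x)) i j"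
          using x Xc by (simp add: rep_minus s.rep_minus Xe algebra_simps)
        also have "cmod \<dots> \<le> cmod (u i j * \<pi> (X k \<ominus> x) i j) + cmod (\<pi> (\<sigma> t (X k \<ominus> x)) i j)"
          by (rule norm_triangle_ineq4)
        also have "\<dots> \<le> 2 * cnorm A (X k \<ominus> x)"
          using rep_entry[of "X k \<ominus> x" i j] s.rep_entry[of "X k \<ominus> x" i j] x Xc
          by (simp add: norm_mult u_norm)
        finally show ?thesis .
      qed
      moreover have "(\<lambda>k. 2 * cnorm A (X k \<ominus> x)) \<longlonglongrightarrow> 0"
        using tendsto_mult_left[OF conjunct2[OF X], of 2] by simp
      ultimately have "cmod (\<pi> (\<sigma> t x) i j - u i j * \<pi> x i j) \<le> 0"
        by (intro LIMSEQ_le_const[of "\<lambda>k. 2 * cnorm A (X k \<ominus> x)"]) auto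
      then show ?thesis by simp
    qed
    then show "x \<in> S" using x by (simp add: S_def)
  qed
  moreover have "v ` carrier P \<subseteq> S"
  proof
    fix y assume "y \<in> v ` carrier P"
    then obtain p where p: "p \<in> carrier P" "y = v p" by auto
    have "\<pi> (\<sigma> t (v p)) i j = u i j * \<pi> (v p) i j" for i j
    proof (cases "\<pi> (v p) i j = 0")
      case False
      from homogeneous[OF p(1) this] show ?thesis
        by (simp add: dyn_gen[OF p(1)] rep_cscale v_closed[OF p(1)] u_def)
    qed (simp add: dyn_gen[OF p(1)] rep_cscale v_closed[OF p(1)])
    then show "y \<in> S" using v_closed[OF p(1)] by (simp add: S_def p(2))
  qed
  ultimately have "S = carrier A" by (rule generates)
  then show ?thesis using x by (auto simp: S_def u_def)
qed

text \<open>Both sides are entire functions of \<open>z\<close> which agree on the real line.\<close>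

lemma rep_analytic_extension:
  assumes x: "x \<in> carrier A" and F: "analytic_extension A \<sigma> x F"
  shows "\<pi> (F z) i j = exp (\<i> * z * (of_nat (d i) - of_nat (d j))) * \<pi> x i j"
proof -
  define g where "g z = \<pi> (F z) i j - exp (\<i> * z * (of_nat (d i) - of_nat (d j))) * \<pi> x i j" for z
  have Fc: "F z \<in> carrier A" for z using F by (simp add: analytic_extension_def entire_into_def)
  have deriv: "\<exists>D. ((\<lambda>z. \<pi> (F z) i j) has_field_derivative D) (at z)" for z
  proof -
    from F obtain D where D: "D \<in> carrier A"
      and lim: "((\<lambda>h. cnorm A (cscale A (inverse h) (F (z + h) \<ominus> F z) \<ominus> D)) \<longlongrightarrow> 0) (at 0)"
      unfolding analytic_extension_def entire_into_def by blast
    have "((\<lambda>h. (\<pi> (F (z + h)) i j - \<pi> (F z) i j) / h - \<pi> D i j) \<longlongrightarrow> 0) (at 0)"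
    proof (rule Lim_null_comparison[OF always_eventually lim], rule allI)
      fix h
      have "(\<pi> (F (z + h)) i j - \<pi> (F z) i j) / h - \<pi> D i j = \<pi> (cscale A (inverse h) (F (z + h) \<ominus> F z) \<ominus> D) i j"
        using Fc D by (simp add: rep_minus rep_cscale cscale_closed divide_inverse mult.commute)
      then show "norm ((\<pi> (F (z + h)) i j - \<pi> (F z) i j) / h - \<pi> D i j)
          \<le> cnorm A (cscale A (inverse h) (F (z + h) \<ominus> F z) \<ominus> D)"
        using rep_entry[of "cscale A (inverse h) (F (z + h) \<ominus> F z) \<ominus> D" i j] Fc D by (simp add: cscale_closed)
    qed
    then have "((\<lambda>h. (\<pi> (F (z + h)) i j - \<pi> (F z) i j) / h) \<longlongrightarrow> \<pi> D i j) (at 0)"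
      by (rule LIM_zero_cancel)
    then show ?thesis unfolding DERIV_def by blast
  qed
  have "(\<lambda>z. \<pi> (F z) i j) holomorphic_on UNIV"
    using deriv by (auto simp: holomorphic_on_def field_differentiable_def)
  then have "g holomorphic_on UNIV" unfolding g_def by (intro holomorphic_intros)
  moreover have "(0::complex) islimpt range complex_of_real"
    unfolding islimpt_approachable
  proof (intro allI impI)
    fix e :: real assume "e > 0"
    then show "\<exists>x'\<in>range complex_of_real. x' \<noteq> 0 \<and> dist x' 0 < e"
      by (intro bexI[OF _ rangeI[of _ "e/2"]]) (auto simp: dist_norm)
  qed
  moreover have "g w = 0" if "w \<in> range complex_of_real" for w
  proof -
    from that obtain t where "w = of_real t" by auto
    then show ?thesis using F rep_dynamics[OF x, of t i j] by (simp add: g_def analytic_extension_def)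
  qed
  ultimately have "g z = 0" by (intro analytic_continuation[of g UNIV "range of_real" 0 z]) auto
  then show ?thesis by (simp add: g_def)
qed

text \<open>Moving \<open>x\<close> to the right multiplies its \<open>(k, l)\<close> entry by \<open>exp (- \<beta> (d k - d l))\<close>, exactly the factor
  that turns the weight of \<open>l\<close> into that of \<open>k\<close>. The double series converges absolutely because rows and
  columns are square-summable and the weights are summable.\<close>

lemma gibbs_kms_state:
  assumes sm: "(\<lambda>k. exp (- \<beta> * real (d k))) sums Z" and Z: "Z > 0"
  shows "kms_state A \<sigma> \<beta> (\<lambda>x. \<Sum>k. of_real (exp (- \<beta> * real (d k)) / Z) * \<pi> x k k)"
proof -
  define w where "w k = exp (- \<beta> * real (d k)) / Z" for k
  have w0: "0 \<le> w k" for k using Z by (simp add: w_def)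
  have w1: "w sums 1" using sums_divide[OF sm, of Z] Z by (simp add: w_def[abs_def])
  show ?thesis
    unfolding kms_state_def w_def[symmetric]
  proof (intro conjI ballI allI impI)
    show "cstar_state A (\<lambda>x. \<Sum>k. of_real (w k) * \<pi> x k k)" by (rule weighted_trace_state[OF w0 w1])
    fix x y F assume x: "x \<in> carrier A" and y: "y \<in> carrier A" and F: "analytic_extension A \<sigma> x F"
    define z where "z = \<i> * complex_of_real \<beta>"
    have Fz: "F z \<in> carrier A" using F by (simp add: analytic_extension_def entire_into_def)
    define f where "f k l = of_real (w k) * (\<pi> x k l * \<pi> y l k)" for k l
    have f_norm: "norm (f k l) = w k * cmod (\<pi> x k l * \<pi> y l k)" for k l
      using w0 by (simp add: f_def norm_mult)
    have row: "summable (\<lambda>l. norm (f k l))" for k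
      unfolding f_norm by (intro summable_mult l2_bound_summable_mult[OF rep_row[OF x] rep_column[OF y]])
    have total: "summable (\<lambda>k. \<Sum>l. norm (f k l))"
    proof (rule summable_comparison_test'[OF summable_mult2[OF sums_summable[OF w1], of "cnorm A x * cnorm A y"]])
      fix k
      have "(\<Sum>l. norm (f k l)) = w k * (\<Sum>l. cmod (\<pi> x k l * \<pi> y l k))"
        unfolding f_norm by (intro suminf_mult l2_bound_summable_mult[OF rep_row[OF x] rep_column[OF y]])
      also have "\<dots> \<le> w k * (cnorm A x * cnorm A y)"
        by (intro mult_left_mono l2_bound_suminf_abs[OF rep_row[OF x] rep_column[OF y]] w0)
      finally show "norm (\<Sum>l. norm (f k l)) \<le> w k * (cnorm A x * cnorm A y)"
        using suminf_nonneg[OF row[of k]] by simp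
    qed
    have "(\<Sum>k. of_real (w k) * \<pi> (x \<otimes> y) k k) = (\<Sum>k. \<Sum>l. f k l)"
      unfolding f_def using rep_mult_entry[OF x y] by (intro suminf_cong) (simp add: sums_iff suminf_mult)
    also have "\<dots> = (\<Sum>l. \<Sum>k. f k l)" by (rule suminf_swap[OF row total])
    also have "\<dots> = (\<Sum>l. of_real (w l) * \<pi> (y \<otimes> F z) l l)"
    proof (rule suminf_cong)
      fix l
      have "f k l = of_real (w l) * (\<pi> y l k * \<pi> (F z) k l)" for k
      proof -
        have "complex_of_real (exp (- \<beta> * real (d l))) * exp (\<i> * z * (of_nat (d k) - of_nat (d l)))
            = of_real (exp (- \<beta> * real (d k)))"
          unfolding exp_of_real[symmetric] mult_exp_exp by (simp add: z_def algebra_simps)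
        then show ?thesis
          unfolding f_def w_def rep_analytic_extension[OF x F] by (simp add: field_simps Z)
      qed
      then show "(\<Sum>k. f k l) = of_real (w l) * \<pi> (y \<otimes> F z) l l"
        using rep_mult_entry[OF y Fz, of l l] by (simp add: sums_iff suminf_mult)
    qed
    finally show "(\<Sum>k. of_real (w k) * \<pi> (x \<otimes> y) k k) = (\<Sum>k. of_real (w k) * \<pi> (y \<otimes> F (\<i> * of_real \<beta>)) k k)"
      by (simp add: z_def)
  qed
qed

text \<open>Every basis vector other than \<open>k0\<close> has degree at least \<open>1\<close>, so raising the inverse temperature by
  \<open>n\<close> multiplies its weight by at most \<open>exp (- n)\<close>, while the total weight stays at least \<open>1\<close>.\<close>

lemma gibbs_kms_infinity_state:
  assumes sm: "summable (\<lambda>k. exp (- \<beta> * real (d k)))" and ground: "\<And>k. d k = 0 \<longleftrightarrow> k = k0"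
  shows "kms_infinity_state A \<sigma> (\<lambda>x. \<pi> x k0 k0)"
proof -
  \<comment> \<open>Inverse temperatures tending to infinity, starting where the partition function is finite.\<close>
  define \<beta>' where "\<beta>' n = \<beta> + real n" for n
  define w where "w n k = exp (- \<beta>' n * real (d k))" for n k
  define B where "B = (\<Sum>k. exp (- \<beta> * real (d k)))"
  define r where "r n k = (if k = k0 then 0 else w n k)" for n k
  have r_le: "r n k \<le> exp (- real n) * exp (- \<beta> * real (d k))" for n k
  proof (cases "k = k0")
    case False
    then have "real (d k) \<ge> 1" using ground[of k] by simp
    then have "real n * real (d k) \<ge> real n * 1" by (intro mult_left_mono) auto
    then show ?thesis using False by (simp add: r_def w_def \<beta>'_def algebra_simps flip: exp_add)
  qed (simp add: r_def)
  have r0: "0 \<le> r n k" for n k by (simp add: r_def w_def)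
  have r_sm: "summable (r n)" for n
    using r_le r0 by (intro summable_comparison_test'[OF summable_mult[OF sm, of "exp (- real n)"]]) auto
  have r_sum: "(\<Sum>k. r n k) \<le> exp (- real n) * B" for n
    unfolding B_def suminf_mult[OF sm, symmetric] by (intro suminf_le r_le r_sm summable_mult sm)
  have w_eq: "w n k = r n k + (if k = k0 then 1 else 0)" for n k
    using ground[of k0] by (simp add: r_def w_def)
  have w_sums: "w n sums ((\<Sum>k. r n k) + 1)" for n
    unfolding w_eq[abs_def] by (intro sums_add summable_sums r_sm sums_single)
  define Z where "Z n = (\<Sum>k. r n k) + 1" for n
  have Z: "Z n \<ge> 1" for n using suminf_nonneg[OF r_sm r0] by (simp add: Z_def)
  define \<psi> where "\<psi> n x = (\<Sum>k. of_real (w n k / Z n) * \<pi> x k k)" for n x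
  have kms: "kms_state A \<sigma> (\<beta>' n) (\<psi> n)" for n
  proof -
    have "w n = (\<lambda>k. exp (- \<beta>' n * real (d k)))" by (simp add: w_def fun_eq_iff)
    then have "(\<lambda>k. exp (- \<beta>' n * real (d k))) sums Z n" using w_sums[of n] by (simp add: Z_def)
    from gibbs_kms_state[OF this] show ?thesis using Z[of n] by (simp add: \<psi>_def[abs_def] w_def)
  qed
  have lim: "(\<lambda>n. \<psi> n x) \<longlonglongrightarrow> \<pi> x k0 k0" if x: "x \<in> carrier A" for x
  proof -
    have est: "cmod (\<psi> n x - \<pi> x k0 k0) \<le> exp (- real n) * (B * (2 * cnorm A x))" for n
    proof -
      have Z0: "Z n > 0" using Z[of n] by simp
      have "0 \<le> w n k / Z n" for k using Z0 by (simp add: w_def)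
      then have s1: "summable (\<lambda>k. of_real (w n k / Z n) * \<pi> x k k)"
        using w_sums[of n] by (intro weighted_trace_summable[OF _ _ x]) (auto simp: sums_iff summable_divide)
      have "(\<lambda>k. of_real (w n k / Z n)) sums complex_of_real ((\<Sum>k. w n k) / Z n)"
        using w_sums[of n] by (intro sums_of_real sums_divide) (auto simp: sums_iff)
      also have "(\<Sum>k. w n k) / Z n = 1" using w_sums[of n] Z0 by (simp add: sums_iff Z_def)
      finally have "(\<lambda>k. of_real (w n k / Z n) * \<pi> x k0 k0) sums (complex_of_real 1 * \<pi> x k0 k0)"
        by (rule sums_mult2)
      then have "\<psi> n x - \<pi> x k0 k0 = (\<Sum>k. of_real (w n k / Z n) * \<pi> x k k - of_real (w n k / Z n) * \<pi> x k0 k0)"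
        unfolding \<psi>_def using s1 by (subst suminf_diff[symmetric]) (auto simp: sums_iff)
      also have "\<dots> = (\<Sum>k. of_real (r n k / Z n) * (\<pi> x k k - \<pi> x k0 k0))"
        by (intro suminf_cong) (simp add: w_eq algebra_simps)
      also have "cmod \<dots> \<le> (\<Sum>k. r n k * (2 * cnorm A x))"
      proof (rule order.trans[OF norm_suminf_le])
        show "norm (complex_of_real (r n k / Z n) * (\<pi> x k k - \<pi> x k0 k0)) \<le> r n k * (2 * cnorm A x)" for k
        proof -
          have "cmod (\<pi> x k k - \<pi> x k0 k0) \<le> 2 * cnorm A x"
            using norm_triangle_ineq4[of "\<pi> x k k" "\<pi> x k0 k0"] rep_entry[OF x, of k k] rep_entry[OF x, of k0 k0]
            by linarith
          moreover have "r n k / Z n \<le> r n k"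
            using mult_right_mono[OF Z[of n] r0[of n k]] Z0 by (simp add: field_simps)
          ultimately show ?thesis
            unfolding norm_mult norm_of_real using r0[of n k] Z0 by (intro mult_mono) auto
        qed
      qed (use summable_mult2[OF r_sm] in auto)
      also have "\<dots> = (\<Sum>k. r n k) * (2 * cnorm A x)" by (rule suminf_mult2[OF r_sm, symmetric])
      also have "\<dots> \<le> exp (- real n) * B * (2 * cnorm A x)"
        using r_sum cnorm_nonneg[OF x] by (intro mult_right_mono) auto
      finally show ?thesis by (simp add: mult.assoc)
    qed
    have "(\<lambda>n. exp (- real n)) \<longlonglongrightarrow> 0"
      using filterlim_compose[OF exp_at_bot filterlim_compose[OF filterlim_uminus_at_bot_at_top filterlim_real_sequentially]]
      by simp
    from tendsto_mult_right[OF this, of "B * (2 * cnorm A x)"]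
    have "(\<lambda>n. exp (- real n) * (B * (2 * cnorm A x))) \<longlonglongrightarrow> 0" by simp
    then have "(\<lambda>n. \<psi> n x - \<pi> x k0 k0) \<longlonglongrightarrow> 0"
      by (rule Lim_null_comparison[OF always_eventually, rotated]) (use est in blast)
    then show ?thesis by (rule LIM_zero_cancel)
  qed
  have "filterlim \<beta>' at_top sequentially"
    unfolding \<beta>'_def[abs_def] by (intro filterlim_tendsto_add_at_top[OF tendsto_const filterlim_real_sequentially])
  then show ?thesis unfolding kms_infinity_state_def using kms lim by blast
qed

end

section \<open>Limits of KMS states\<close>

context cstar_algebra begin

lemma entire_continuous:
  assumes F: "entire_into A F"
  shows "((\<lambda>w. cnorm A (F w \<ominus> F z)) \<longlongrightarrow> 0) (at z)"
proof -
  have Fc: "F z \<in> carrier A" for z using F by (simp add: entire_into_def)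
  obtain D where D: "D \<in> carrier A"
    and lim: "((\<lambda>h. cnorm A (cscale A (inverse h) (F (z + h) \<ominus> F z) \<ominus> D)) \<longlongrightarrow> 0) (at 0)"
    using F unfolding entire_into_def by blast
  let ?q = "\<lambda>h. cscale A (inverse h) (F (z + h) \<ominus> F z)"
  have "cnorm A (F (z + h) \<ominus> F z) \<le> cmod h * (cnorm A (?q h \<ominus> D) + cnorm A D)" if "h \<noteq> 0" for h
  proof -
    have q: "?q h \<in> carrier A" using Fc by (simp add: cscale_closed)
    have e: "F (z + h) \<ominus> F z = cscale A h (?q h)"
      using that Fc by (simp add: cscale_assoc cscale_one)
    have "cnorm A (F (z + h) \<ominus> F z) = cmod h * cnorm A (?q h)"
      by (subst e) (rule cnorm_cscale[OF q])
    also have "cnorm A (?q h) \<le> cnorm A (?q h \<ominus> D) + cnorm A D"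
    proof -
      have "?q h = (?q h \<ominus> D) \<oplus> D" using q D by (simp add: minus_eq a_assoc l_neg)
      then show ?thesis using cnorm_add[of "?q h \<ominus> D" D] q D by simp
    qed
    finally show ?thesis by (simp add: mult_left_mono)
  qed
  then have ev: "\<forall>\<^sub>F h in at 0. norm (cnorm A (F (z + h) \<ominus> F z)) \<le> cmod h * (cnorm A (?q h \<ominus> D) + cnorm A D)"
    unfolding eventually_at_filter using Fc cnorm_nonneg by (intro always_eventually) simp
  have "((\<lambda>h. cmod h * (cnorm A (?q h \<ominus> D) + cnorm A D)) \<longlongrightarrow> cmod 0 * (0 + cnorm A D)) (at 0)"
    by (intro tendsto_intros lim)
  then have "((\<lambda>h. cnorm A (F (z + h) \<ominus> F z)) \<longlongrightarrow> 0) (at 0)"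
    using Lim_null_comparison[OF ev] by simp
  then show ?thesis by (rule LIM_offset_zero_cancel)
qed

text \<open>Tychonoff's theorem. The space of functions need not be first countable, so in place of a convergent
  subsequence there is only a filter finer than the sequential one.\<close>

lemma cluster_point_filter:
  fixes \<psi> :: "nat \<Rightarrow> 'c \<Rightarrow> complex"
  assumes bound: "\<And>k x. cmod (\<psi> k x) \<le> R x"
  obtains \<phi> G where "G \<noteq> bot" "G \<le> sequentially" "\<And>x. ((\<lambda>k. \<psi> k x) \<longlongrightarrow> \<phi> x) G"
proof -
  \<comment> \<open>The product of discs that contains the whole sequence.\<close>
  define K where "K = (\<Pi>\<^sub>E x\<in>UNIV. cball (0::complex) (R x))"
  have "compactin (product_topology (\<lambda>_. euclidean) UNIV) K"
    unfolding K_def compactin_PiE by simp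
  then have "compact K" by (simp add: euclidean_product_topology)
  moreover have "filtermap \<psi> sequentially \<noteq> bot" by (simp add: filtermap_bot_iff)
  moreover have "eventually (\<lambda>f. f \<in> K) (filtermap \<psi> sequentially)"
    unfolding eventually_filtermap using bound by (intro always_eventually) (auto simp: K_def)
  ultimately obtain \<phi> where \<phi>: "inf (nhds \<phi>) (filtermap \<psi> sequentially) \<noteq> bot"
    unfolding compact_filter by blast
  define G where "G = inf (filtercomap \<psi> (nhds \<phi>)) sequentially"
  show thesis
  proof (rule that[of G \<phi>])
    show "G \<noteq> bot"
    proof
      assume "G = bot"
      then have "eventually (\<lambda>_. False) G" by simp
      then obtain Q R where Q: "eventually Q (filtercomap \<psi> (nhds \<phi>))" and R: "eventually R sequentially"
        and QR: "\<And>k. Q k \<Longrightarrow> R k \<Longrightarrow> False"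
        unfolding G_def eventually_inf by blast
      from Q obtain Q' where Q': "eventually Q' (nhds \<phi>)" "\<And>k. Q' (\<psi> k) \<Longrightarrow> Q k"
        unfolding eventually_filtercomap by blast
      have "eventually (\<lambda>f. \<not> Q' f) (filtermap \<psi> sequentially)"
        unfolding eventually_filtermap using R by eventually_elim (use Q' QR in blast)
      with Q'(1) have "eventually (\<lambda>_. False) (inf (nhds \<phi>) (filtermap \<psi> sequentially))"
        unfolding eventually_inf by blast
      then show False using \<phi> by (simp add: trivial_limit_def)
    qed
    show "G \<le> sequentially" by (simp add: G_def)
    fix x
    have "filterlim \<psi> (nhds \<phi>) G"
      unfolding filterlim_iff_le_filtercomap by (simp add: G_def)
    then show "((\<lambda>k. \<psi> k x) \<longlongrightarrow> \<phi> x) G"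
    proof (intro topological_tendstoI)
      fix S :: "complex set" assume S: "open S" "\<phi> x \<in> S"
      have "open ((\<lambda>f. f x) -` S)"
        by (rule open_vimage[OF S(1) continuous_on_product_coordinates])
      then have "\<forall>\<^sub>F f in nhds \<phi>. f x \<in> S"
        using eventually_nhds_in_open[of "(\<lambda>f. f x) -` S" \<phi>] S(2) by simp
      then show "\<forall>\<^sub>F k in G. \<psi> k x \<in> S"
        using \<open>filterlim \<psi> (nhds \<phi>) G\<close> by (rule eventually_compose_filterlim)
    qed
  qed
qed

text \<open>The set of states is weak-* compact. The KMS identity passes to a cluster point although the point
  \<open>\<i> \<beta>\<close> moves: \<open>F\<close> is norm continuous and the states are uniformly bounded.\<close>

lemma kms_state_limit:
  assumes kms: "\<And>k. kms_state A \<sigma> (\<beta> k) (\<psi> k)" and lim: "\<beta> \<longlonglongrightarrow> b"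
  shows "\<exists>\<phi>. kms_state A \<sigma> b \<phi>"
proof -
  \<comment> \<open>Outside the carrier the values of a state are arbitrary and could be unbounded.\<close>
  define \<psi>' where "\<psi>' k x = (if x \<in> carrier A then \<psi> k x else 0)" for k x
  have st: "cstar_state A (\<psi> k)" for k using kms by (simp add: kms_state_def)
  have "cmod (\<psi>' k x) \<le> (if x \<in> carrier A then cnorm A x else 0)" for k x
    using state_contractive[OF st] by (simp add: \<psi>'_def)
  then obtain \<phi> G where G: "G \<noteq> bot" "G \<le> sequentially" and \<phi>': "\<And>x. ((\<lambda>k. \<psi>' k x) \<longlongrightarrow> \<phi> x) G"
    by (rule cluster_point_filter[of \<psi>' "\<lambda>x. if x \<in> carrier A then cnorm A x else 0"]) blast
  have \<phi>: "((\<lambda>k. \<psi> k x) \<longlongrightarrow> \<phi> x) G" if "x \<in> carrier A" for x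
    using \<phi>'[of x] that by (simp add: \<psi>'_def)
  note uniq = tendsto_unique[OF G(1)]
  have \<phi>_add: "\<phi> (x \<oplus> y) = \<phi> x + \<phi> y" if "x \<in> carrier A" "y \<in> carrier A" for x y
  proof (rule uniq)
    show "((\<lambda>k. \<psi> k (x \<oplus> y)) \<longlongrightarrow> \<phi> (x \<oplus> y)) G" using that by (simp add: \<phi>)
    show "((\<lambda>k. \<psi> k (x \<oplus> y)) \<longlongrightarrow> \<phi> x + \<phi> y) G"
      using tendsto_add[OF \<phi>[OF that(1)] \<phi>[OF that(2)]] st that by (simp add: cstar_state_def)
  qed
  have \<phi>_scale: "\<phi> (cscale A c x) = c * \<phi> x" if "x \<in> carrier A" for c x
  proof (rule uniq)
    show "((\<lambda>k. \<psi> k (cscale A c x)) \<longlongrightarrow> \<phi> (cscale A c x)) G" using that by (simp add: \<phi> cscale_closed)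
    show "((\<lambda>k. \<psi> k (cscale A c x)) \<longlongrightarrow> c * \<phi> x) G"
      using tendsto_mult_left[OF \<phi>[OF that], of c] st that by (simp add: cstar_state_def)
  qed
  have \<phi>_pos: "\<phi> (star A x \<otimes> x) \<in> \<real> \<and> 0 \<le> Re (\<phi> (star A x \<otimes> x))" if x: "x \<in> carrier A" for x
  proof
    have c: "star A x \<otimes> x \<in> carrier A" using x by (simp add: star_closed)
    have pos: "\<psi> k (star A x \<otimes> x) \<in> \<real>" "0 \<le> Re (\<psi> k (star A x \<otimes> x))" for k
      using st[of k] x by (simp_all add: cstar_state_def)
    have "Im (\<phi> (star A x \<otimes> x)) = 0"
      using uniq[OF tendsto_Im[OF \<phi>[OF c]]] pos by (simp add: complex_is_Real_iff)
    then show "\<phi> (star A x \<otimes> x) \<in> \<real>" by (simp add: complex_is_Real_iff)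
    show "0 \<le> Re (\<phi> (star A x \<otimes> x))"
      using pos by (intro tendsto_lowerbound[OF tendsto_Re[OF \<phi>[OF c]] _ G(1)]) simp
  qed
  have \<phi>_one: "\<phi> \<one> = 1"
    using uniq[OF \<phi>[OF one_closed], of 1] st by (simp add: cstar_state_def)
  have \<phi>_state: "cstar_state A \<phi>"
    unfolding cstar_state_def using \<phi>_add \<phi>_scale \<phi>_pos \<phi>_one by blast
  have "\<phi> (x \<otimes> y) = \<phi> (y \<otimes> F (\<i> * of_real b))"
    if x: "x \<in> carrier A" and y: "y \<in> carrier A" and F: "analytic_extension A \<sigma> x F" for x y F
  proof (rule uniq)
    have Fe: "entire_into A F" using F by (simp add: analytic_extension_def)
    then have Fc: "F z \<in> carrier A" for z by (simp add: entire_into_def)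
    let ?z = "\<i> * of_real b" and ?w = "\<lambda>k. \<i> * complex_of_real (\<beta> k)"
    show "((\<lambda>k. \<psi> k (x \<otimes> y)) \<longlongrightarrow> \<phi> (x \<otimes> y)) G" using x y by (simp add: \<phi>)
    have \<beta>G: "(\<beta> \<longlongrightarrow> b) G" using lim G(2) by (rule tendsto_mono[rotated])
    have "(?w \<longlongrightarrow> ?z) G" by (intro tendsto_intros \<beta>G)
    moreover have "isCont (\<lambda>w. cnorm A (F w \<ominus> F ?z)) ?z"
      unfolding isCont_def using entire_continuous[OF Fe, of ?z] Fc by (simp add: minus_eq r_neg)
    ultimately have "((\<lambda>k. cnorm A (F (?w k) \<ominus> F ?z)) \<longlongrightarrow> cnorm A (F ?z \<ominus> F ?z)) G"
      by (rule isCont_tendsto_compose[rotated])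
    then have lim0: "((\<lambda>k. cnorm A y * cnorm A (F (?w k) \<ominus> F ?z)) \<longlongrightarrow> 0) G"
      using Fc tendsto_mult_left[of "\<lambda>k. cnorm A (F (?w k) \<ominus> F ?z)" 0 G "cnorm A y"]
      by (simp add: minus_eq r_neg)
    have est: "norm (\<psi> k (x \<otimes> y) - \<psi> k (y \<otimes> F ?z)) \<le> cnorm A y * cnorm A (F (?w k) \<ominus> F ?z)" for k
    proof -
      have "\<psi> k (x \<otimes> y) = \<psi> k (y \<otimes> F (?w k))"
        using kms[of k] x y F by (simp add: kms_state_def)
      then have "\<psi> k (x \<otimes> y) - \<psi> k (y \<otimes> F ?z) = \<psi> k (y \<otimes> (F (?w k) \<ominus> F ?z))"
        using Fc y by (simp add: mult_minus_right state_minus[OF st])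
      also have "cmod \<dots> \<le> cnorm A (y \<otimes> (F (?w k) \<ominus> F ?z))"
        using Fc y by (intro state_contractive[OF st]) auto
      also have "\<dots> \<le> cnorm A y * cnorm A (F (?w k) \<ominus> F ?z)"
        using Fc y by (intro cnorm_mult) auto
      finally show ?thesis .
    qed
    have "((\<lambda>k. \<psi> k (x \<otimes> y) - \<psi> k (y \<otimes> F ?z)) \<longlongrightarrow> 0) G"
      by (rule Lim_null_comparison[OF always_eventually lim0]) (use est in blast)
    moreover have "((\<lambda>k. \<psi> k (y \<otimes> F ?z)) \<longlongrightarrow> \<phi> (y \<otimes> F ?z)) G" using y Fc by (simp add: \<phi>)
    ultimately have "((\<lambda>k. (\<psi> k (x \<otimes> y) - \<psi> k (y \<otimes> F ?z)) + \<psi> k (y \<otimes> F ?z)) \<longlongrightarrow> 0 + \<phi> (y \<otimes> F ?z)) G"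
      by (rule tendsto_add)
    then show "((\<lambda>k. \<psi> k (x \<otimes> y)) \<longlongrightarrow> \<phi> (y \<otimes> F ?z)) G" by simp
  qed
  with \<phi>_state have "kms_state A \<sigma> b \<phi>" by (simp add: kms_state_def)
  then show ?thesis by blast
qed

end

section \<open>Graded cancellative monoids and their regular representation\<close>

text \<open>Left cancellation makes the left regular representation isometric. The carrier is enumerated by the
  natural numbers because the universal property is tested on matrices indexed by them.\<close>

locale graded_cancellative_monoid = monoid P for P :: "'p monoid" (structure) +
  fixes len :: "'p \<Rightarrow> nat"
  assumes countable_carrier: "countable (carrier P)" and infinite_carrier: "infinite (carrier P)"
    and cancel: "p \<in> carrier P \<Longrightarrow> x \<in> carrier P \<Longrightarrow> y \<in> carrier P \<Longrightarrow> p \<otimes> x = p \<otimes> y \<Longrightarrow> x = y"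
    and len_mult: "p \<in> carrier P \<Longrightarrow> q \<in> carrier P \<Longrightarrow> len (p \<otimes> q) = len p + len q"
begin

definition enum :: "nat \<Rightarrow> 'p" where "enum = from_nat_into (carrier P)"
definition index :: "'p \<Rightarrow> nat" where "index = to_nat_on (carrier P)"
definition act :: "'p \<Rightarrow> nat \<Rightarrow> nat" where "act p k = index (p \<otimes> enum k)"
definition regular :: "'p \<Rightarrow> nat \<Rightarrow> nat \<Rightarrow> complex" where
  "regular p i j = (if i = act p j then 1 else 0)"

lemma enum_closed [simp]: "enum k \<in> carrier P"
  unfolding enum_def using infinite_carrier by (intro from_nat_into) auto

lemma enum_index [simp]: "p \<in> carrier P \<Longrightarrow> enum (index p) = p"
  by (simp add: enum_def index_def countable_carrier)

lemma index_enum [simp]: "index (enum k) = k"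
  by (simp add: enum_def index_def countable_carrier infinite_carrier)

lemma bij_enum: "bij_betw enum UNIV (carrier P)"
  unfolding enum_def by (rule bij_betw_from_nat_into[OF countable_carrier infinite_carrier])

lemma enum_act: "p \<in> carrier P \<Longrightarrow> enum (act p k) = p \<otimes> enum k"
  by (simp add: act_def)

lemma act_mult: "p \<in> carrier P \<Longrightarrow> q \<in> carrier P \<Longrightarrow> act p (act q k) = act (p \<otimes> q) k"
  by (simp add: act_def m_assoc)

lemma act_one: "act \<one> k = k" by (simp add: act_def)

lemma inj_act: assumes p: "p \<in> carrier P" shows "inj (act p)"
proof (rule injI)
  fix i j assume "act p i = act p j"
  then have "enum (act p i) = enum (act p j)" by simp
  then have "p \<otimes> enum i = p \<otimes> enum j" by (simp only: enum_act[OF p])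
  then have "enum i = enum j" using cancel[OF p] by simp
  then show "i = j" by (metis index_enum)
qed

lemma range_act: "p \<in> carrier P \<Longrightarrow> range (act p) = index ` (p <# carrier P)"
proof -
  have "carrier P = enum ` UNIV" using bij_enum by (simp add: bij_betw_def)
  then show ?thesis by (auto simp: l_coset_def act_def image_iff)
qed

lemma index_inj: "inj_on index (carrier P)"
  by (rule inj_on_inverseI[of _ enum]) simp

lemma regular_bound: "p \<in> carrier P \<Longrightarrow> mat_bound 1 (regular p)"
  using mat_bound_injection[OF inj_act] unfolding regular_def[abs_def] by blast

lemma regular_range_projection:
  assumes p: "p \<in> carrier P"
  shows "mat_mult (regular p) (mat_adj (regular p)) = (\<lambda>i j. if i = j \<and> i \<in> range (act p) then 1 else 0)"
proof (intro ext)
  fix i j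
  show "mat_mult (regular p) (mat_adj (regular p)) i j = (if i = j \<and> i \<in> range (act p) then 1 else 0)"
  proof (cases "i \<in> range (act p)")
    case True
    then obtain m where m: "i = act p m" by auto
    have "mat_mult (regular p) (mat_adj (regular p)) i j = mat_adj (regular p) m j"
      unfolding m regular_def[abs_def] by (rule mat_mult_injection_left[OF inj_act[OF p]])
    then show ?thesis by (auto simp: mat_adj_def regular_def m)
  next
    case False
    then have "regular p i k = 0" for k by (auto simp: regular_def)
    with False show ?thesis by (simp add: mat_mult_def mat_vec_def)
  qed
qed

lemma diagonal_mult:
  "mat_mult (\<lambda>i j. if i = j \<and> i \<in> S then 1 else 0) (\<lambda>i j. if i = j \<and> i \<in> T then 1 else 0)
    = (\<lambda>i j. if i = j \<and> i \<in> S \<inter> T then 1 else 0)"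
proof (intro ext)
  fix i j :: nat
  have "(\<Sum>k. (if i = k \<and> i \<in> S then 1 else 0) * (if k = j \<and> k \<in> T then 1 else 0 :: complex))
    = (\<Sum>k\<in>{i}. (if i = k \<and> i \<in> S then 1 else 0) * (if k = j \<and> k \<in> T then 1 else 0))"
    by (rule suminf_finite) auto
  then show "mat_mult (\<lambda>i j. if i = j \<and> i \<in> S then 1 else 0) (\<lambda>i j. if i = j \<and> i \<in> T then 1 else 0) i j
    = (if i = j \<and> i \<in> S \<inter> T then 1 else 0)"
    by (auto simp: mat_mult_def mat_vec_def)
qed

text \<open>The range projection of \<open>p\<close> is the diagonal projection onto the right ideal generated by \<open>p\<close>, and a least
  common multiple is by definition a generator of the intersection of two such ideals.\<close>

lemma nica_regular: "nica_representation P \<B> regular"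
  unfolding nica_representation_def
proof (intro conjI ballI allI impI)
  fix p assume p: "p \<in> carrier P"
  show "regular p \<in> carrier \<B>"
    using regular_bound[OF p] by (auto simp: bounded_matrices_carrier)
  have "mat_mult (mat_adj (regular p)) (regular p) i j = (if i = j then 1 else 0)" for i j
  proof -
    have "mat_mult (mat_adj (regular p)) (regular p) i j = mat_adj (regular p) i (act p j)"
      unfolding regular_def[abs_def] by (rule mat_mult_injection_right)
    then show ?thesis using inj_act[OF p] by (auto simp: mat_adj_def regular_def inj_def)
  qed
  then show "star \<B> (regular p) \<otimes>\<^bsub>\<B>\<^esub> regular p = \<one>\<^bsub>\<B>\<^esub>"
    by (simp add: fun_eq_iff)
next
  show "regular \<one> = \<one>\<^bsub>\<B>\<^esub>" by (simp add: fun_eq_iff regular_def act_one)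
next
  fix p q assume p: "p \<in> carrier P" and q: "q \<in> carrier P"
  have "mat_mult (regular p) (regular q) i j = regular (p \<otimes> q) i j" for i j
  proof -
    have "mat_mult (regular p) (regular q) i j = regular p i (act q j)"
      unfolding regular_def[of q, abs_def] by (rule mat_mult_injection_right)
    then show ?thesis by (simp add: regular_def act_mult[OF p q])
  qed
  then show "regular p \<otimes>\<^bsub>\<B>\<^esub> regular q = regular (p \<otimes> q)" by (simp add: fun_eq_iff)
next
  fix p q m assume p: "p \<in> carrier P" and q: "q \<in> carrier P" and "is_rlcm P {p, q} m"
  then have m: "m \<in> carrier P" and lcm: "(p <# carrier P) \<inter> (q <# carrier P) = m <# carrier P"
    by (simp_all add: is_rlcm_def)
  have sub: "x <# carrier P \<subseteq> carrier P" if "x \<in> carrier P" for x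
    using that by (auto simp: l_coset_def)
  have "range (act p) \<inter> range (act q) = range (act m)"
    unfolding range_act[OF p] range_act[OF q] range_act[OF m] lcm[symmetric]
    by (rule inj_on_image_Int[OF index_inj sub[OF p] sub[OF q], symmetric])
  then show "(regular p \<otimes>\<^bsub>\<B>\<^esub> star \<B> (regular p)) \<otimes>\<^bsub>\<B>\<^esub>
      (regular q \<otimes>\<^bsub>\<B>\<^esub> star \<B> (regular q))
    = regular m \<otimes>\<^bsub>\<B>\<^esub> star \<B> (regular m)"
    by (simp add: regular_range_projection p q m diagonal_mult)
qed

end

locale graded_dynamics = graded_cancellative_monoid P len
  for P :: "'p monoid" (structure) and len :: "'p \<Rightarrow> nat" +
  fixes A :: "'a cstar" and v :: "'p \<Rightarrow> 'a" and \<sigma> :: "real \<Rightarrow> 'a \<Rightarrow> 'a"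
  assumes universal: "semigroup_cstar_algebra P A v"
    and dynamics: "cstar_dynamics A \<sigma>"
    and dynamics_gen: "p \<in> carrier P \<Longrightarrow>
      \<sigma> t (v p) = cscale A (exp (\<i> * complex_of_real t * of_nat (len p))) (v p)"
begin

lemma cstar_algebra: "cstar_algebra A"
  using universal by (simp add: semigroup_cstar_algebra_def)

lemma gen_closed: "p \<in> carrier P \<Longrightarrow> v p \<in> carrier A"
  using universal by (simp add: semigroup_cstar_algebra_def nica_representation_def)

lemma generates_all: "cstar_subalgebra A S \<Longrightarrow> v ` carrier P \<subseteq> S \<Longrightarrow> S = carrier A"
  using universal by (simp add: semigroup_cstar_algebra_def)

lemma universal_rep:
  fixes w :: "'p \<Rightarrow> nat \<Rightarrow> nat \<Rightarrow> complex"
  assumes "nica_representation P \<B> w"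
  obtains \<pi> where "matrix_representation A \<pi>" "\<And>p. p \<in> carrier P \<Longrightarrow> \<pi> (v p) = w p"
proof -
  obtain f where "star_hom A \<B> f" "\<forall>p\<in>carrier P. f (v p) = w p"
    using universal assms cstar_algebra_bounded_matrices unfolding semigroup_cstar_algebra_def by blast
  then show thesis
    using that cstar_algebra by (simp add: matrix_representation_def matrix_representation_axioms_def)
qed

lemma regular_rep:
  obtains \<pi> where "graded_representation A \<pi> P v \<sigma> len (\<lambda>k. len (enum k))"
proof -
  obtain \<pi> where \<pi>: "matrix_representation A \<pi>" and gen: "\<And>p. p \<in> carrier P \<Longrightarrow> \<pi> (v p) = regular p"
    using universal_rep[OF nica_regular] by blast
  interpret matrix_representation A \<pi> by (rule \<pi>)
  have "graded_representation A \<pi> P v \<sigma> len (\<lambda>k. len (enum k))"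
  proof
    fix p i j assume p: "p \<in> carrier P" and "\<pi> (v p) i j \<noteq> 0"
    then have "i = act p j" by (simp add: gen regular_def split: if_splits)
    then show "len (enum i) = len p + len (enum j)" by (simp add: enum_act p len_mult)
  qed (use generates_all gen_closed dynamics dynamics_gen in auto)
  then show thesis by (rule that)
qed

lemma partition_function_sums:
  assumes "(\<lambda>p. exp (- \<beta> * real (len p))) summable_on carrier P"
  shows "summable (\<lambda>k. exp (- \<beta> * real (len (enum k))))"
  using assms unfolding summable_on_reindex_bij_betw[OF bij_enum, symmetric]
  by (subst (asm) summable_on_UNIV_nonneg_real_iff) auto

theorem kms_state_exists:
  assumes "(\<lambda>p. exp (- \<beta> * real (len p))) summable_on carrier P"
  shows "\<exists>\<phi>. kms_state A \<sigma> \<beta> \<phi>"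
proof -
  obtain \<pi> where "graded_representation A \<pi> P v \<sigma> len (\<lambda>k. len (enum k))" by (rule regular_rep)
  then interpret graded_representation A \<pi> P v \<sigma> len "\<lambda>k. len (enum k)" .
  note sm = partition_function_sums[OF assms]
  have "(\<Sum>k. exp (- \<beta> * real (len (enum k)))) > 0" using sm by (intro suminf_pos) auto
  from gibbs_kms_state[OF summable_sums[OF sm] this] show ?thesis by blast
qed

theorem kms_infinity_state_exists:
  assumes sm: "(\<lambda>p. exp (- \<beta> * real (len p))) summable_on carrier P"
    and ground: "\<And>p. p \<in> carrier P \<Longrightarrow> len p = 0 \<longleftrightarrow> p = \<one>"
  shows "\<exists>\<phi>. kms_infinity_state A \<sigma> \<phi>"
proof -
  have ground': "len (enum k) = 0 \<longleftrightarrow> k = index \<one>" for k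
    using ground[of "enum k"] by (metis enum_closed enum_index index_enum one_closed)
  obtain \<pi> where "graded_representation A \<pi> P v \<sigma> len (\<lambda>k. len (enum k))" by (rule regular_rep)
  then interpret graded_representation A \<pi> P v \<sigma> len "\<lambda>k. len (enum k)" .
  from gibbs_kms_infinity_state[OF partition_function_sums[OF sm] ground'] show ?thesis by blast
qed

lemma nica_trivial: "nica_representation P \<B> (\<lambda>p i j. if i = j then 1 else 0)"
proof -
  have "mat_mult (\<lambda>i j. if i = j then 1 else 0) (\<lambda>i j. if i = j then 1 else 0 :: complex) = (\<lambda>i j. if i = j then 1 else 0)"
    using diagonal_mult[of UNIV UNIV] by simp
  moreover have "mat_adj (\<lambda>i j. if i = j then 1 else 0) = (\<lambda>i j. if i = j then 1 else 0)"
    by (simp add: mat_adj_def fun_eq_iff)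
  ultimately show ?thesis
    using mat_bound_one by (auto simp: nica_representation_def bounded_matrices_carrier)
qed

text \<open>All generators act as the identity matrix, so \<open>\<pi>\<close> is diagonal and each diagonal entry is a character,
  in particular a trace; a trace is a KMS state at \<open>0\<close>.\<close>

theorem kms_state_zero_exists: "\<exists>\<phi>. kms_state A \<sigma> 0 \<phi>"
proof -
  obtain \<pi> where \<pi>: "matrix_representation A \<pi>"
    and gen: "\<And>p. p \<in> carrier P \<Longrightarrow> \<pi> (v p) = (\<lambda>i j. if i = j then 1 else 0)"
    using universal_rep[OF nica_trivial] by blast
  interpret matrix_representation A \<pi> by (rule \<pi>)
  define S where "S = {x \<in> carrier A. \<forall>i j. i \<noteq> j \<longrightarrow> \<pi> x i j = 0}"
  have diag_mult: "\<pi> (x \<otimes>\<^bsub>A\<^esub> y) i j = \<pi> x i i * \<pi> y i j" if "x \<in> S" "y \<in> S" for x y i j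
  proof -
    have "(\<lambda>k. \<pi> x i k * \<pi> y k j) sums \<pi> (x \<otimes>\<^bsub>A\<^esub> y) i j"
      using that by (intro rep_mult_entry) (auto simp: S_def)
    moreover have "(\<lambda>k. \<pi> x i k * \<pi> y k j) sums (\<Sum>k\<in>{i}. \<pi> x i k * \<pi> y k j)"
      using that by (intro sums_finite) (auto simp: S_def)
    ultimately show ?thesis using sums_unique2 by fastforce
  qed
  have "cstar_subalgebra A S"
    unfolding cstar_subalgebra_def
  proof (intro conjI ballI allI impI)
    fix X x assume x: "x \<in> carrier A" and X: "(\<forall>k::nat. X k \<in> S) \<and> (\<lambda>k. cnorm A (X k \<ominus>\<^bsub>A\<^esub> x)) \<longlonglongrightarrow> 0"
    have "\<pi> x i j = 0" if "i \<noteq> j" for i j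
    proof -
      have "cmod (\<pi> x i j) \<le> cnorm A (X k \<ominus>\<^bsub>A\<^esub> x)" for k
        using rep_entry[of "X k \<ominus>\<^bsub>A\<^esub> x" i j] X x that by (simp add: rep_minus S_def)
      with X have "cmod (\<pi> x i j) \<le> 0" by (intro LIMSEQ_le_const[of "\<lambda>k. cnorm A (X k \<ominus>\<^bsub>A\<^esub> x)"]) auto
      then show ?thesis by simp
    qed
    then show "x \<in> S" using x by (simp add: S_def)
  next
    fix x y assume xy: "x \<in> S" "y \<in> S"
    then show "x \<otimes>\<^bsub>A\<^esub> y \<in> S" using diag_mult[OF xy] by (simp add: S_def)
  qed (auto simp: S_def rep_one rep_add rep_cscale rep_star mat_adj_def cscale_closed star_closed)
  moreover have "v ` carrier P \<subseteq> S" by (auto simp: S_def gen gen_closed)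
  ultimately have S: "S = carrier A" by (rule generates_all)
  have "kms_state A \<sigma> 0 (\<lambda>x. \<pi> x 0 0)"
    unfolding kms_state_def
  proof (intro conjI ballI allI impI diag_state)
    fix x y F assume x: "x \<in> carrier A" and y: "y \<in> carrier A" and F: "analytic_extension A \<sigma> x F"
    have "F (\<i> * complex_of_real 0) = \<sigma> 0 x" using F by (metis analytic_extension_def mult_zero_right of_real_0)
    also have "\<dots> = x" using dynamics x by (simp add: cstar_dynamics_def)
    finally show "\<pi> (x \<otimes>\<^bsub>A\<^esub> y) 0 0 = \<pi> (y \<otimes>\<^bsub>A\<^esub> F (\<i> * complex_of_real 0)) 0 0"
      using x y diag_mult[of x y 0 0] diag_mult[of y x 0 0] by (simp add: S mult.commute)
  qed
  then show ?thesis by blast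
qed

end

section \<open>Range projections under a KMS state\<close>

context cstar_algebra begin

definition projection :: "'a \<Rightarrow> bool" where
  "projection p \<longleftrightarrow> p \<in> carrier A \<and> star A p = p \<and> p \<otimes> p = p"

lemma projection_one: "projection \<one>"
  by (simp add: projection_def star_one)

lemma projection_remove:
  assumes p: "projection p" and q: "projection q" and comm: "p \<otimes> q = q \<otimes> p"
  shows "projection (p \<ominus> p \<otimes> q)"
proof -
  have c: "p \<in> carrier A" "q \<in> carrier A" "star A p = p" "star A q = q" "p \<otimes> p = p" "q \<otimes> q = q"
    using p q by (simp_all add: projection_def)
  have 1: "p \<otimes> (p \<otimes> q) = p \<otimes> q" using c by (simp flip: m_assoc)
  have 2: "p \<otimes> q \<otimes> p = p \<otimes> q" using c comm 1 by (simp add: m_assoc)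
  have 3: "p \<otimes> q \<otimes> (p \<otimes> q) = p \<otimes> q"
    using c 2 by (metis m_assoc m_closed)
  have "(p \<ominus> p \<otimes> q) \<otimes> (p \<ominus> p \<otimes> q) = (p \<ominus> p \<otimes> q) \<ominus> (p \<otimes> q \<ominus> p \<otimes> q)"
    using c 1 2 3 by (simp add: mult_minus_left mult_minus_right)
  also have "\<dots> = p \<ominus> p \<otimes> q" using c by (simp add: minus_eq r_neg)
  finally show ?thesis using c comm by (simp add: projection_def star_minus star_mult)
qed

lemma projection_state_nonneg:
  assumes "cstar_state A \<phi>" "projection p" shows "0 \<le> Re (\<phi> p)"
  using assms unfolding cstar_state_def projection_def by metis

lemma state_one: "cstar_state A \<phi> \<Longrightarrow> \<phi> \<one> = 1"
  by (simp add: cstar_state_def)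

lemma state_projection_le_one:
  assumes st: "cstar_state A \<phi>" and p: "projection p" shows "Re (\<phi> p) \<le> 1"
proof -
  have pc: "p \<in> carrier A" using p by (simp add: projection_def)
  have "projection (\<one> \<ominus> \<one> \<otimes> p)" using pc by (intro projection_remove projection_one p) simp
  from projection_state_nonneg[OF st this] show ?thesis
    using pc by (simp add: state_minus[OF st] state_one[OF st])
qed

text \<open>Inclusion-exclusion for the projection \<open>(1 - p) (1 - q)\<close>.\<close>

lemma state_two_projections:
  assumes st: "cstar_state A \<phi>" and p: "projection p" and q: "projection q" and pq: "p \<otimes> q = q \<otimes> p"
  shows "Re (\<phi> p) + Re (\<phi> q) \<le> 1 + Re (\<phi> (p \<otimes> q))"
proof -
  have c: "p \<in> carrier A" "q \<in> carrier A" using p q by (simp_all add: projection_def)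
  have "projection (\<one> \<ominus> \<one> \<otimes> p)" using c by (intro projection_remove projection_one p) simp
  then have e: "projection (\<one> \<ominus> p)" using c by simp
  have "projection ((\<one> \<ominus> p) \<ominus> (\<one> \<ominus> p) \<otimes> q)"
    using c pq by (intro projection_remove e q) (simp add: mult_minus_left mult_minus_right)
  from projection_state_nonneg[OF st this] show ?thesis
    using c by (simp add: state_minus[OF st] state_one[OF st] mult_minus_left)
qed

text \<open>Inclusion-exclusion for the projection \<open>(1 - p) (1 - q) (1 - r)\<close>.\<close>

lemma state_three_projections:
  assumes st: "cstar_state A \<phi>" and p: "projection p" and q: "projection q" and r: "projection r"
    and pq: "p \<otimes> q = q \<otimes> p" and pr: "p \<otimes> r = r \<otimes> p" and qr: "q \<otimes> r = r \<otimes> q"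
  shows "Re (\<phi> p) + Re (\<phi> q) + Re (\<phi> r) + Re (\<phi> (p \<otimes> q \<otimes> r))
    \<le> 1 + Re (\<phi> (p \<otimes> q)) + Re (\<phi> (p \<otimes> r)) + Re (\<phi> (q \<otimes> r))"
proof -
  have c: "p \<in> carrier A" "q \<in> carrier A" "r \<in> carrier A" using p q r by (simp_all add: projection_def)
  have "projection (\<one> \<ominus> \<one> \<otimes> p)" using c by (intro projection_remove projection_one p) simp
  then have e: "projection (\<one> \<ominus> p)" using c by simp
  have f: "projection ((\<one> \<ominus> p) \<ominus> (\<one> \<ominus> p) \<otimes> q)"
    using c pq by (intro projection_remove e q) (simp add: mult_minus_left mult_minus_right)
  have pqr: "r \<otimes> (p \<otimes> q) = p \<otimes> (q \<otimes> r)" using c pr qr by (metis m_assoc)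
  have "projection (((\<one> \<ominus> p) \<ominus> (\<one> \<ominus> p) \<otimes> q) \<ominus> ((\<one> \<ominus> p) \<ominus> (\<one> \<ominus> p) \<otimes> q) \<otimes> r)"
    using c pr qr pqr by (intro projection_remove f r) (simp add: mult_minus_left mult_minus_right m_assoc)
  from projection_state_nonneg[OF st this] show ?thesis
    using c by (simp add: state_minus[OF st] state_one[OF st] mult_minus_left m_assoc)
qed

end

context graded_dynamics begin

text \<open>The curve \<open>z \<mapsto> exp (\<i> z |p|) v\<^sub>p\<close> extends the dynamics analytically, so the KMS identity moves \<open>v\<^sub>p\<close> past
  \<open>v\<^sub>p\<^sup>*\<close> at the cost of \<open>exp (- \<beta> |p|)\<close>.\<close>

lemma kms_range_projection:
  assumes kms: "kms_state A \<sigma> \<beta> \<phi>" and p: "p \<in> carrier P"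
  shows "\<phi> (v p \<otimes>\<^bsub>A\<^esub> star A (v p)) = exp (- \<beta> * real (len p))"
proof -
  interpret cstar_algebra A by (rule cstar_algebra)
  have vp: "v p \<in> carrier A" by (rule gen_closed[OF p])
  have iso: "star A (v p) \<otimes>\<^bsub>A\<^esub> v p = \<one>\<^bsub>A\<^esub>"
    using universal p by (simp add: semigroup_cstar_algebra_def nica_representation_def)
  define e where "e z = exp (\<i> * z * of_nat (len p))" for z :: complex
  define F where "F z = cscale A (e z) (v p)" for z
  have "entire_into A F"
    unfolding entire_into_def
  proof (intro conjI allI)
    fix z
    show "F z \<in> carrier A" using vp by (simp add: F_def cscale_closed)
    define D where "D = e z * (\<i> * of_nat (len p))"
    have "(e has_field_derivative D) (at z)"
      unfolding e_def D_def by (auto intro!: derivative_eq_intros)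
    then have "((\<lambda>h. (e (z + h) - e z) / h - D) \<longlongrightarrow> 0) (at 0)"
      unfolding DERIV_def by (rule LIM_zero)
    from tendsto_mult_right[OF tendsto_norm_zero[OF this], of "cnorm A (v p)"]
    have "((\<lambda>h. cmod ((e (z + h) - e z) / h - D) * cnorm A (v p)) \<longlongrightarrow> 0) (at 0)" by simp
    moreover have "cnorm A (cscale A (inverse h) (F (z + h) \<ominus>\<^bsub>A\<^esub> F z) \<ominus>\<^bsub>A\<^esub> cscale A D (v p))
        = cmod ((e (z + h) - e z) / h - D) * cnorm A (v p)" for h
    proof -
      have sub: "cscale A a (v p) \<ominus>\<^bsub>A\<^esub> cscale A b (v p) = cscale A (a - b) (v p)" for a b
        using cscale_add_left[OF vp, of a "- b"] vp
        by (simp add: a_minus_def uminus_eq_cscale cscale_closed cscale_assoc)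
      have "cscale A (inverse h) (F (z + h) \<ominus>\<^bsub>A\<^esub> F z) \<ominus>\<^bsub>A\<^esub> cscale A D (v p)
          = cscale A ((e (z + h) - e z) / h - D) (v p)"
        using vp by (simp add: F_def sub cscale_assoc divide_inverse mult.commute)
      then show ?thesis using vp by (simp add: cnorm_cscale)
    qed
    ultimately have "((\<lambda>h. cnorm A (cscale A (inverse h) (F (z + h) \<ominus>\<^bsub>A\<^esub> F z) \<ominus>\<^bsub>A\<^esub> cscale A D (v p))) \<longlongrightarrow> 0) (at 0)"
      by simp
    then show "\<exists>D\<in>carrier A. ((\<lambda>h. cnorm A (cscale A (inverse h) (F (z + h) \<ominus>\<^bsub>A\<^esub> F z) \<ominus>\<^bsub>A\<^esub> D)) \<longlongrightarrow> 0) (at 0)"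
      using cscale_closed[OF vp] by blast
  qed
  then have "analytic_extension A \<sigma> (v p) F"
    unfolding analytic_extension_def by (simp add: F_def e_def dynamics_gen[OF p])
  then have "\<phi> (v p \<otimes>\<^bsub>A\<^esub> star A (v p)) = \<phi> (star A (v p) \<otimes>\<^bsub>A\<^esub> F (\<i> * of_real \<beta>))"
    using kms vp by (simp add: kms_state_def star_closed)
  also have "star A (v p) \<otimes>\<^bsub>A\<^esub> F (\<i> * of_real \<beta>) = cscale A (e (\<i> * of_real \<beta>)) \<one>\<^bsub>A\<^esub>"
    using vp by (simp add: F_def cscale_mult_right star_closed iso)
  also have "\<phi> \<dots> = e (\<i> * of_real \<beta>)"
    using kms by (simp add: kms_state_def cstar_state_def)
  also have "\<dots> = exp (- \<beta> * real (len p))"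
    unfolding e_def exp_of_real[symmetric] by (simp add: mult.assoc)
  finally show ?thesis .
qed

definition range_projection :: "'p \<Rightarrow> 'a" where
  "range_projection p = v p \<otimes>\<^bsub>A\<^esub> star A (v p)"

lemma range_projection: assumes p: "p \<in> carrier P" shows "cstar_algebra.projection A (range_projection p)"
proof -
  interpret cstar_algebra A by (rule cstar_algebra)
  have vp: "v p \<in> carrier A" by (rule gen_closed[OF p])
  have iso: "star A (v p) \<otimes>\<^bsub>A\<^esub> v p = \<one>\<^bsub>A\<^esub>"
    using universal p by (simp add: semigroup_cstar_algebra_def nica_representation_def)
  have "range_projection p \<otimes>\<^bsub>A\<^esub> range_projection p
      = v p \<otimes>\<^bsub>A\<^esub> ((star A (v p) \<otimes>\<^bsub>A\<^esub> v p) \<otimes>\<^bsub>A\<^esub> star A (v p))"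
    using vp star_closed[OF vp] unfolding range_projection_def by (simp only: m_assoc m_closed)
  then show ?thesis
    using vp star_closed[OF vp] by (simp add: projection_def range_projection_def iso star_mult star_star)
qed

lemma range_projection_mult:
  assumes "p \<in> carrier P" "q \<in> carrier P" "is_rlcm P {p, q} m"
  shows "range_projection p \<otimes>\<^bsub>A\<^esub> range_projection q = range_projection m"
    "range_projection q \<otimes>\<^bsub>A\<^esub> range_projection p = range_projection m"
proof -
  have "\<forall>p\<in>carrier P. \<forall>q\<in>carrier P. \<forall>m. is_rlcm P {p, q} m \<longrightarrow>
      range_projection p \<otimes>\<^bsub>A\<^esub> range_projection q = range_projection m"
    using universal by (simp add: semigroup_cstar_algebra_def nica_representation_def range_projection_def)
  then show "range_projection p \<otimes>\<^bsub>A\<^esub> range_projection q = range_projection m"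
    "range_projection q \<otimes>\<^bsub>A\<^esub> range_projection p = range_projection m"
    using assms by (auto simp: insert_commute)
qed

lemma kms_range:
  assumes "kms_state A \<sigma> \<beta> \<phi>" "p \<in> carrier P"
  shows "Re (\<phi> (range_projection p)) = exp (- \<beta>) ^ len p"
  using kms_range_projection[OF assms]
  by (simp add: range_projection_def mult.commute flip: exp_of_nat_mult)

lemma kms_one_generator:
  assumes kms: "kms_state A \<sigma> \<beta> \<phi>" and p: "p \<in> carrier P"
  shows "exp (- \<beta>) ^ len p \<le> 1"
  using cstar_algebra.state_projection_le_one[OF cstar_algebra _ range_projection[OF p], of \<phi>]
    kms kms_range[OF kms p] by (simp add: kms_state_def)

lemma kms_two_generators:
  assumes kms: "kms_state A \<sigma> \<beta> \<phi>" and p: "p \<in> carrier P" and q: "q \<in> carrier P"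
    and pq: "is_rlcm P {p, q} m"
  shows "exp (- \<beta>) ^ len p + exp (- \<beta>) ^ len q \<le> 1 + exp (- \<beta>) ^ len m"
proof -
  have "m \<in> carrier P" using pq by (simp add: is_rlcm_def)
  then show ?thesis
    using cstar_algebra.state_two_projections[OF cstar_algebra _ range_projection[OF p] range_projection[OF q], of \<phi>]
      kms by (simp add: kms_state_def range_projection_mult[OF p q pq] kms_range[OF kms] p q)
qed

lemma kms_three_generators:
  assumes kms: "kms_state A \<sigma> \<beta> \<phi>" and p: "p \<in> carrier P" and q: "q \<in> carrier P" and r: "r \<in> carrier P"
    and pq: "is_rlcm P {p, q} m1" and pr: "is_rlcm P {p, r} m2" and qr: "is_rlcm P {q, r} m3"
    and pqr: "is_rlcm P {m1, r} m"
  shows "exp (- \<beta>) ^ len p + exp (- \<beta>) ^ len q + exp (- \<beta>) ^ len r + exp (- \<beta>) ^ len m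
    \<le> 1 + exp (- \<beta>) ^ len m1 + exp (- \<beta>) ^ len m2 + exp (- \<beta>) ^ len m3"
proof -
  have m: "m1 \<in> carrier P" "m2 \<in> carrier P" "m3 \<in> carrier P" "m \<in> carrier P"
    using pq pr qr pqr by (simp_all add: is_rlcm_def)
  then show ?thesis
    using cstar_algebra.state_three_projections[OF cstar_algebra _ range_projection[OF p] range_projection[OF q]
        range_projection[OF r], of \<phi>] kms
    by (simp add: kms_state_def range_projection_mult[OF p q pq] range_projection_mult[OF p r pr]
        range_projection_mult[OF q r qr] range_projection_mult[OF m(1) r pqr] kms_range[OF kms] p q r)
qed

text \<open>The partition function may diverge at \<open>b\<close>, but the Gibbs states at \<open>b + 1 / (k + 1)\<close> accumulate at a KMS
  state there.\<close>

lemma inverse_temperature_space_threshold: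
  assumes sm: "\<And>\<beta>. \<beta> > b \<Longrightarrow> (\<lambda>p. exp (- \<beta> * real (len p))) summable_on carrier P"
    and ground: "\<And>p. p \<in> carrier P \<Longrightarrow> len p = 0 \<longleftrightarrow> p = \<one>"
    and necessary: "\<And>\<beta> \<phi>. kms_state A \<sigma> \<beta> \<phi> \<Longrightarrow> \<beta> = 0 \<or> b \<le> \<beta>"
  shows "inverse_temperature_space A \<sigma> = {0} \<union> {ereal b..\<infinity>}"
proof -
  have "\<exists>\<phi>. kms_state A \<sigma> b \<phi>"
  proof -
    define \<beta> where "\<beta> k = b + 1 / real (Suc k)" for k
    have "\<exists>\<phi>. kms_state A \<sigma> (\<beta> k) \<phi>" for k
      by (intro kms_state_exists sm) (simp add: \<beta>_def)
    then obtain \<psi> where \<psi>: "\<And>k. kms_state A \<sigma> (\<beta> k) (\<psi> k)" by metis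
    have "\<beta> \<longlonglongrightarrow> b + 0"
      unfolding \<beta>_def[abs_def] by (intro tendsto_add tendsto_const LIMSEQ_Suc[OF lim_1_over_n])
    then show ?thesis using cstar_algebra.kms_state_limit[OF cstar_algebra \<psi>, where b = b] by simp
  qed
  then have "(\<exists>\<phi>. kms_state A \<sigma> \<beta> \<phi>) \<longleftrightarrow> \<beta> = 0 \<or> b \<le> \<beta>" for \<beta>
    using necessary kms_state_zero_exists kms_state_exists[OF sm, of \<beta>]
    by (metis order.order_iff_strict)
  moreover have "\<exists>\<phi>. kms_infinity_state A \<sigma> \<phi>"
    using kms_infinity_state_exists[OF sm[of "b + 1"] ground] by simp
  ultimately have "inverse_temperature_space A \<sigma> = {ereal \<beta> | \<beta>. \<beta> = 0 \<or> b \<le> \<beta>} \<union> {\<infinity>}"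
    unfolding inverse_temperature_space_def by auto
  also have "\<dots> = {0} \<union> {ereal b..\<infinity>}"
  proof (intro equalityI subsetI)
    fix x assume "x \<in> {0} \<union> {ereal b..\<infinity>}"
    then show "x \<in> {ereal \<beta> | \<beta>. \<beta> = 0 \<or> b \<le> \<beta>} \<union> {\<infinity>}" by (cases x) (auto simp: zero_ereal_def)
  qed (auto simp: zero_ereal_def)
  finally show ?thesis .
qed

end

section \<open>Common multiples in braid monoids\<close>

declare braid_eq.trans [trans]

abbreviation (input) braids :: "nat \<Rightarrow> nat list set set" where
  "braids n \<equiv> carrier (braid_monoid n)"

abbreviation (input) multiples :: "nat \<Rightarrow> nat list set \<Rightarrow> nat list set set" where
  "multiples n p \<equiv> p <#\<^bsub>braid_monoid n\<^esub> braids n"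

text \<open>The word \<open>i # complement i j\<close> represents the least common multiple of the generators \<open>i\<close> and \<open>j\<close>.\<close>

definition complement :: "nat \<Rightarrow> nat \<Rightarrow> nat list" where
  "complement i j = (if i = j then [] else if i = j + 1 \<or> j = i + 1 then [j, i] else [j])"

text \<open>Garside's condition on an equation between words starting with \<open>i\<close> and \<open>j\<close>: the common value is a multiple of
  the least common multiple of the two generators. For \<open>i = j\<close> it is cancellation.\<close>

definition common_multiple :: "nat \<Rightarrow> nat \<Rightarrow> nat list \<Rightarrow> nat \<Rightarrow> nat list \<Rightarrow> bool" where
  "common_multiple n i u j w \<longleftrightarrow>
    (\<exists>z. set z \<subseteq> {1..<n} \<and> braid_eq n u (complement i j @ z) \<and> braid_eq n w (complement j i @ z))"

lemma braid_cons: "braid_eq n u w \<Longrightarrow> i \<in> {1..<n} \<Longrightarrow> braid_eq n (i # u) (i # w)"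
  using braid_eq_context[of n u w "[i]" "[]"] by simp

lemma common_multiple_sym: "common_multiple n i u j w \<Longrightarrow> common_multiple n j w i u"
  unfolding common_multiple_def by blast

lemma common_multiple_same: "common_multiple n i u i w \<longleftrightarrow> braid_eq n u w"
proof
  show "braid_eq n u w \<Longrightarrow> common_multiple n i u i w"
    unfolding common_multiple_def complement_def using braid_eq_set braid_eq.refl by force
qed (auto simp: common_multiple_def complement_def intro: braid_eq.trans braid_eq.sym)

lemma common_multiple_cong:
  "common_multiple n i u j w \<Longrightarrow> braid_eq n u' u \<Longrightarrow> common_multiple n i u' j w"
  unfolding common_multiple_def by (blast intro: braid_eq.trans)

lemma common_multiple_set:
  "common_multiple n i u j w \<Longrightarrow> set u \<subseteq> {1..<n} \<and> set w \<subseteq> {1..<n}"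
  unfolding common_multiple_def using braid_eq_set by blast

lemma mirror_letters: "set w \<subseteq> {1..<4} \<Longrightarrow> set (map ((-) 4) w) \<subseteq> {1..<4 :: nat}"
  by (induction w) auto

lemma braid_eq_mirror: "braid_eq 4 u w \<Longrightarrow> braid_eq 4 (map ((-) 4) u) (map ((-) 4) w)"
proof (induction rule: braid_eq.induct)
  case (refl w) then show ?case by (intro braid_eq.refl mirror_letters)
next
  case (sym u w) then show ?case by (blast intro: braid_eq.sym)
next
  case (trans u w x) then show ?case by (blast intro: braid_eq.trans)
next
  case (braid u w i j)
  then have "4 - i \<in> {1..<4}" "4 - j \<in> {1..<4}" "4 - i = (4 - j) + 1 \<or> 4 - j = (4 - i) + 1" by auto
  from braid_eq.braid[OF mirror_letters[OF braid(1)] mirror_letters[OF braid(2)] this] show ?case by simp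
next
  case (commute u w i j)
  then have "4 - i \<in> {1..<4}" "4 - j \<in> {1..<4}" "4 - i \<ge> (4 - j) + 2 \<or> 4 - j \<ge> (4 - i) + 2" by auto
  from braid_eq.commute[OF mirror_letters[OF commute(1)] mirror_letters[OF commute(2)] this] show ?case by simp
qed

lemma common_multiple_mirror:
  assumes "common_multiple 4 i u j w" and ij: "i \<in> {1..<4}" "j \<in> {1..<4}"
  shows "common_multiple 4 (4 - i) (map ((-) 4) u) (4 - j) (map ((-) 4) w)"
proof -
  obtain z where z: "set z \<subseteq> {1..<4}" "braid_eq 4 u (complement i j @ z)" "braid_eq 4 w (complement j i @ z)"
    using assms(1) by (auto simp: common_multiple_def)
  have "map ((-) 4) (complement a b) = complement (4 - a) (4 - b)" if "a \<in> {1..<4}" "b \<in> {1..<4}" for a b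
    using that by (auto simp: complement_def)
  then show ?thesis
    unfolding common_multiple_def using mirror_letters[OF z(1)] z(2,3)[THEN braid_eq_mirror] ij
    by (intro exI[of _ "map ((-) 4) z"]) auto
qed

text \<open>Induction on the length of the words. Within one length the condition holds along each defining relation,
  so only its transitivity has to be shown, through an intermediate word with first letter \<open>h\<close>.
  If the three letters differ, this is a computation in which the shorter equations that arise are
  solved by the induction hypothesis; with at most three generators the letters are \<open>1\<close>, \<open>2\<close>, \<open>3\<close>,
  and two symmetries, exchanging the outer letters and the mirror image \<open>i \<mapsto> 4 - i\<close>, leave two cases.\<close>

locale braid_cancellation_step =
  fixes n k :: nat
  assumes n: "n \<le> 4"
    and IH: "\<And>i u j w. braid_eq n (i # u) (j # w) \<Longrightarrow> length u < k \<Longrightarrow> common_multiple n i u j w"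
begin

lemma cancel_cons: "braid_eq n (i # u) (i # w) \<Longrightarrow> length u < k \<Longrightarrow> braid_eq n u w"
  using IH common_multiple_same by blast

lemma common_multiple_below:
  assumes "braid_eq n (i # u) (j # w)" "length u < k"
  obtains z where "set z \<subseteq> {1..<n}" "braid_eq n u (complement i j @ z)" "braid_eq n w (complement j i @ z)"
  using IH[OF assms] unfolding common_multiple_def by blast

lemma trans_1_2_3:
  assumes len: "length x = k" and ux: "common_multiple n 1 u 2 x" and xw: "common_multiple n 2 x 3 w"
    and n4: "n = 4"
  shows "common_multiple n 1 u 3 w"
proof -
  obtain z where u: "braid_eq n u (2 # 1 # z)" and x: "braid_eq n x (1 # 2 # z)"
    using ux by (auto simp: common_multiple_def complement_def)
  obtain z' where x': "braid_eq n x (3 # 2 # z')" and w: "braid_eq n w (2 # 3 # z')"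
    using xw by (auto simp: common_multiple_def complement_def)
  note len = len braid_eq_length[OF x] braid_eq_length[OF x']
  have "braid_eq n (1 # 2 # z) (3 # 2 # z')" using x x' by (blast intro: braid_eq.trans braid_eq.sym)
  then obtain y where y: "braid_eq n (2 # z) (3 # y)" "braid_eq n (2 # z') (1 # y)"
    by (rule common_multiple_below) (use len in \<open>auto simp: complement_def\<close>)
  note len = len y[THEN braid_eq_length]
  obtain a where a: "braid_eq n z (3 # 2 # a)" "braid_eq n y (2 # 3 # a)"
    using y(1) by (rule common_multiple_below) (use len in \<open>auto simp: complement_def\<close>)
  obtain b where b: "braid_eq n z' (1 # 2 # b)" "braid_eq n y (2 # 1 # b)"
    using y(2) by (rule common_multiple_below) (use len in \<open>auto simp: complement_def\<close>)
  note len = len a[THEN braid_eq_length] b[THEN braid_eq_length]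
  have "braid_eq n (2 # 3 # a) (2 # 1 # b)" using a b by (blast intro: braid_eq.trans braid_eq.sym)
  then have "braid_eq n (3 # a) (1 # b)" by (rule cancel_cons) (use len in auto)
  then obtain e where e: "set e \<subseteq> {1..<n}" "braid_eq n a (1 # e)" "braid_eq n b (3 # e)"
    by (rule common_multiple_below) (use len in \<open>auto simp: complement_def\<close>)
  have e4: "set e \<subseteq> {1..<4}" using e(1) n4 by simp
  note u
  also have "braid_eq n (2 # 1 # z) (2 # 1 # 3 # 2 # a)" using n4 by (intro braid_cons a) auto
  also have "braid_eq n (2 # 1 # 3 # 2 # a) (2 # 1 # 3 # 2 # 1 # e)" using n4 by (intro braid_cons e) auto
  also have "braid_eq n (2 # 1 # 3 # 2 # 1 # e) (2 # 3 # 1 # 2 # 1 # e)"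
    using braid_eq.commute[of "[2]" n "2 # 1 # e" 1 3] e4 by (simp add: n4)
  also have "braid_eq n (2 # 3 # 1 # 2 # 1 # e) (2 # 3 # 2 # 1 # 2 # e)"
    using braid_eq.braid[of "[2, 3]" n e 1 2] e4 by (simp add: n4)
  also have "braid_eq n (2 # 3 # 2 # 1 # 2 # e) (3 # 2 # 3 # 1 # 2 # e)"
    using braid_eq.braid[of "[]" n "1 # 2 # e" 2 3] e4 by (simp add: n4)
  finally have u': "braid_eq n u (3 # 2 # 3 # 1 # 2 # e)" .
  note w
  also have "braid_eq n (2 # 3 # z') (2 # 3 # 1 # 2 # b)" using n4 by (intro braid_cons b) auto
  also have "braid_eq n (2 # 3 # 1 # 2 # b) (2 # 3 # 1 # 2 # 3 # e)" using n4 by (intro braid_cons e) auto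
  also have "braid_eq n (2 # 3 # 1 # 2 # 3 # e) (2 # 1 # 3 # 2 # 3 # e)"
    using braid_eq.commute[of "[2]" n "2 # 3 # e" 3 1] e4 by (simp add: n4)
  also have "braid_eq n (2 # 1 # 3 # 2 # 3 # e) (2 # 1 # 2 # 3 # 2 # e)"
    using braid_eq.braid[of "[2, 1]" n e 3 2] e4 by (simp add: n4)
  also have "braid_eq n (2 # 1 # 2 # 3 # 2 # e) (1 # 2 # 1 # 3 # 2 # e)"
    using braid_eq.braid[of "[]" n "3 # 2 # e" 2 1] e4 by (simp add: n4)
  also have "braid_eq n (1 # 2 # 1 # 3 # 2 # e) (1 # 2 # 3 # 1 # 2 # e)"
    using braid_eq.commute[of "[1, 2]" n "2 # e" 1 3] e4 by (simp add: n4)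
  finally have w': "braid_eq n w (1 # 2 # 3 # 1 # 2 # e)" .
  show ?thesis
    unfolding common_multiple_def
    using u' w' e4 by (intro exI[of _ "2 # 3 # 1 # 2 # e"]) (simp add: complement_def n4)
qed

lemma trans_2_1_3:
  assumes len: "length x = k" and ux: "common_multiple n 2 u 1 x" and xw: "common_multiple n 1 x 3 w"
    and n4: "n = 4"
  shows "common_multiple n 2 u 3 w"
proof -
  obtain z where u: "braid_eq n u (1 # 2 # z)" and x: "braid_eq n x (2 # 1 # z)"
    using ux by (auto simp: common_multiple_def complement_def)
  obtain z' where x': "braid_eq n x (3 # z')" and w: "braid_eq n w (1 # z')"
    using xw by (auto simp: common_multiple_def complement_def)
  note len = len braid_eq_length[OF x] braid_eq_length[OF x']
  have "braid_eq n (2 # 1 # z) (3 # z')" using x x' by (blast intro: braid_eq.trans braid_eq.sym)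
  then obtain y where y: "braid_eq n (1 # z) (3 # 2 # y)" "braid_eq n z' (2 # 3 # y)"
    by (rule common_multiple_below) (use len in \<open>auto simp: complement_def\<close>)
  note len = len y[THEN braid_eq_length]
  obtain a where a: "braid_eq n z (3 # a)" "braid_eq n (2 # y) (1 # a)"
    using y(1) by (rule common_multiple_below) (use len in \<open>auto simp: complement_def\<close>)
  note len = len a[THEN braid_eq_length]
  obtain b where b: "set b \<subseteq> {1..<n}" "braid_eq n y (1 # 2 # b)" "braid_eq n a (2 # 1 # b)"
    using a(2) by (rule common_multiple_below) (use len in \<open>auto simp: complement_def\<close>)
  have b4: "set b \<subseteq> {1..<4}" using b(1) n4 by simp
  note u
  also have "braid_eq n (1 # 2 # z) (1 # 2 # 3 # a)" using n4 by (intro braid_cons a) auto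
  also have "braid_eq n (1 # 2 # 3 # a) (1 # 2 # 3 # 2 # 1 # b)" using n4 by (intro braid_cons b) auto
  also have "braid_eq n (1 # 2 # 3 # 2 # 1 # b) (1 # 3 # 2 # 3 # 1 # b)"
    using braid_eq.braid[of "[1]" n "1 # b" 2 3] b4 by (simp add: n4)
  also have "braid_eq n (1 # 3 # 2 # 3 # 1 # b) (3 # 1 # 2 # 3 # 1 # b)"
    using braid_eq.commute[of "[]" n "2 # 3 # 1 # b" 1 3] b4 by (simp add: n4)
  also have "braid_eq n (3 # 1 # 2 # 3 # 1 # b) (3 # 1 # 2 # 1 # 3 # b)"
    using braid_eq.commute[of "[3, 1, 2]" n b 3 1] b4 by (simp add: n4)
  also have "braid_eq n (3 # 1 # 2 # 1 # 3 # b) (3 # 2 # 1 # 2 # 3 # b)"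
    using braid_eq.braid[of "[3]" n "3 # b" 1 2] b4 by (simp add: n4)
  finally have u': "braid_eq n u (3 # 2 # 1 # 2 # 3 # b)" .
  note w
  also have "braid_eq n (1 # z') (1 # 2 # 3 # y)" using n4 by (intro braid_cons y) auto
  also have "braid_eq n (1 # 2 # 3 # y) (1 # 2 # 3 # 1 # 2 # b)" using n4 by (intro braid_cons b) auto
  also have "braid_eq n (1 # 2 # 3 # 1 # 2 # b) (1 # 2 # 1 # 3 # 2 # b)"
    using braid_eq.commute[of "[1, 2]" n "2 # b" 3 1] b4 by (simp add: n4)
  also have "braid_eq n (1 # 2 # 1 # 3 # 2 # b) (2 # 1 # 2 # 3 # 2 # b)"
    using braid_eq.braid[of "[]" n "3 # 2 # b" 1 2] b4 by (simp add: n4)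
  also have "braid_eq n (2 # 1 # 2 # 3 # 2 # b) (2 # 1 # 3 # 2 # 3 # b)"
    using braid_eq.braid[of "[2, 1]" n b 2 3] b4 by (simp add: n4)
  also have "braid_eq n (2 # 1 # 3 # 2 # 3 # b) (2 # 3 # 1 # 2 # 3 # b)"
    using braid_eq.commute[of "[2]" n "2 # 3 # b" 1 3] b4 by (simp add: n4)
  finally have w': "braid_eq n w (2 # 3 # 1 # 2 # 3 # b)" .
  show ?thesis
    unfolding common_multiple_def
    using u' w' b4 by (intro exI[of _ "1 # 2 # 3 # b"]) (simp add: complement_def n4)
qed

lemma trans_2_3_1:
  assumes len: "length x = k" and ux: "common_multiple n 2 u 3 x" and xw: "common_multiple n 3 x 1 w"
    and n4: "n = 4"
  shows "common_multiple n 2 u 1 w"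
proof -
  have "common_multiple 4 (4 - 2) (map ((-) 4) u) (4 - 3) (map ((-) 4) x)"
    "common_multiple 4 (4 - 3) (map ((-) 4) x) (4 - 1) (map ((-) 4) w)"
    using ux xw unfolding n4 by (intro common_multiple_mirror; simp)+
  then have "common_multiple n 2 (map ((-) 4) u) 3 (map ((-) 4) w)"
    using len by (intro trans_2_1_3[of "map ((-) 4) x"]) (simp_all add: n4)
  from common_multiple_mirror[OF this[unfolded n4]]
  have "common_multiple 4 2 (map ((-) 4) (map ((-) 4) u)) 1 (map ((-) 4) (map ((-) 4) w))" by simp
  moreover have "map ((-) 4) (map ((-) 4) y) = y" if "set y \<subseteq> {1..<4}" for y :: "nat list"
    using that by (induction y) auto
  ultimately show ?thesis using common_multiple_set[OF ux] common_multiple_set[OF xw] n4 by simp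
qed

lemma common_multiple_trans:
  assumes i: "i \<in> {1..<n}" and h: "h \<in> {1..<n}" and j: "j \<in> {1..<n}"
    and lx: "length x = k"
    and ux: "common_multiple n i u h x" and xw: "common_multiple n h x j w"
  shows "common_multiple n i u j w"
proof -
  consider "i = h" | "j = h" | "i = j" "i \<noteq> h" | "i \<noteq> h" "j \<noteq> h" "i \<noteq> j" by blast
  then show ?thesis
  proof cases
    case 1
    then show ?thesis using ux xw common_multiple_same common_multiple_cong by blast
  next
    case 2
    then show ?thesis
      using ux xw common_multiple_same common_multiple_cong common_multiple_sym braid_eq.sym by blast
  next
    case 3
    from ux obtain z where z: "set z \<subseteq> {1..<n}" "braid_eq n u (complement i h @ z)" "braid_eq n x (complement h i @ z)"
      by (auto simp: common_multiple_def)
    from xw 3 obtain z' where z': "braid_eq n x (complement h i @ z')" "braid_eq n w (complement i h @ z')"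
      by (auto simp: common_multiple_def)
    have e: "braid_eq n (complement h i @ z) (complement h i @ z')"
      using z(3) z'(1) by (blast intro: braid_eq.trans braid_eq.sym)
    have len: "length (complement h i @ z) = k" using lx braid_eq_length[OF z(3)] by simp
    have "braid_eq n z z'"
    proof (cases "h = i + 1 \<or> i = h + 1")
      case True
      then have c: "complement h i = [i, h]" using 3 by (auto simp: complement_def)
      have "braid_eq n (h # z) (h # z')" by (rule cancel_cons[of i]) (use e len in \<open>auto simp: c\<close>)
      then show ?thesis by (rule cancel_cons[of h]) (use len in \<open>auto simp: c\<close>)
    next
      case False
      then have c: "complement h i = [i]" using 3 by (auto simp: complement_def)
      show ?thesis by (rule cancel_cons[of i]) (use e len in \<open>auto simp: c\<close>)
    qed
    moreover have "set (complement i h) \<subseteq> {1..<n}" using i h by (auto simp: complement_def)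
    ultimately have "braid_eq n (complement i h @ z) (complement i h @ z')"
      using braid_eq_context[of n z z' "complement i h" "[]"] by simp
    then have "braid_eq n u w"
      using z(2) z'(2) by (blast intro: braid_eq.trans braid_eq.sym)
    then show ?thesis using 3 common_multiple_same by blast
  next
    case 4
    then have n4: "n = 4" using i h j n by auto
    then have "i \<in> {1, 2, 3}" "h \<in> {1, 2, 3}" "j \<in> {1, 2, 3}" using i h j by auto
    with 4 consider "i = 1" "h = 2" "j = 3" | "i = 3" "h = 2" "j = 1" | "i = 2" "h = 1" "j = 3"
      | "i = 3" "h = 1" "j = 2" | "i = 2" "h = 3" "j = 1" | "i = 1" "h = 3" "j = 2" by auto
    then show ?thesis
    proof cases
      case 1 then show ?thesis using trans_1_2_3[OF lx _ _ n4] ux xw by simp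
    next
      case 2 then show ?thesis
        using trans_1_2_3[OF lx _ _ n4, of w u] ux xw by (simp add: common_multiple_sym)
    next
      case 3 then show ?thesis using trans_2_1_3[OF lx _ _ n4] ux xw by simp
    next
      case 4 then show ?thesis
        using trans_2_1_3[OF lx _ _ n4, of w u] ux xw by (simp add: common_multiple_sym)
    next
      case 5 then show ?thesis using trans_2_3_1[OF lx _ _ n4] ux xw by simp
    next
      case 6 then show ?thesis
        using trans_2_3_1[OF lx _ _ n4, of w u] ux xw by (simp add: common_multiple_sym)
    qed
  qed
qed

text \<open>Induction on the derivation of the equation; each defining relation is either applied at the first
  letter, where it is the condition itself, or further inside, where the first letters coincide.\<close>

lemma common_multiple_step:
  assumes "braid_eq n x y" "length x = Suc k" "x = i # u" "y = j # w"
  shows "common_multiple n i u j w"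
  using assms
proof (induction arbitrary: i u j w rule: braid_eq.induct)
  case (refl x)
  then show ?case using braid_eq.refl[of u n] by (auto simp: common_multiple_same)
next
  case (sym x y)
  then show ?case using braid_eq_length[OF sym.hyps] common_multiple_sym by metis
next
  case (trans x y z)
  note len = braid_eq_length[OF trans.hyps(1)] braid_eq_length[OF trans.hyps(2)]
  then obtain h t where y: "y = h # t" using trans.prems by (cases y) auto
  have "common_multiple n i u h t" using trans.IH(1) trans.prems y by simp
  moreover have "common_multiple n h t j w" using trans.IH(2) trans.prems y len by simp
  moreover have "i \<in> {1..<n}" "h \<in> {1..<n}" "j \<in> {1..<n}"
    using braid_eq_set[OF trans.hyps(1)] braid_eq_set[OF trans.hyps(2)] trans.prems y by auto
  ultimately show ?case using common_multiple_trans[of i h j t u w] len trans.prems y by simp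
next
  case (braid a b p q)
  show ?case
  proof (cases a)
    case Nil
    then show ?thesis
      using braid braid_eq.refl[of u n] braid_eq.refl[of w n] unfolding common_multiple_def
      by (intro exI[of _ b]) (auto simp: complement_def)
  next
    case (Cons c a')
    then show ?thesis
      using braid braid_eq.braid[of a' n b p q] by (auto simp: common_multiple_same)
  qed
next
  case (commute a b p q)
  show ?case
  proof (cases a)
    case Nil
    then show ?thesis
      using commute braid_eq.refl[of u n] braid_eq.refl[of w n] unfolding common_multiple_def
      by (intro exI[of _ b]) (auto simp: complement_def)
  next
    case (Cons c a')
    then show ?thesis
      using commute braid_eq.commute[of a' n b p q] by (auto simp: common_multiple_same)
  qed
qed

end

text \<open>Garside's theorem for at most four strands.\<close>

theorem braid_common_multiple:
  assumes "n \<le> 4" "braid_eq n (i # u) (j # w)"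
  shows "common_multiple n i u j w"
  using assms(2)
proof (induction "length u" arbitrary: i u j w rule: less_induct)
  case less
  interpret braid_cancellation_step n "length u"
    using assms(1) less.hyps by unfold_locales auto
  show ?case using common_multiple_step[OF less.prems] by simp
qed

lemma braid_cancel_word:
  assumes n: "n \<le> 4" and "braid_eq n (p @ u) (p @ w)" shows "braid_eq n u w"
  using assms(2)
proof (induction p)
  case (Cons i p)
  then show ?case using braid_common_multiple[OF n, of i "p @ u" i "p @ w"] by (simp add: common_multiple_same)
qed simp


lemma braid_complement_commute:
  assumes "i \<in> {1..<n}" "j \<in> {1..<n}"
  shows "braid_eq n (i # complement i j) (j # complement j i)"
proof -
  consider "i = j" | "i = j + 1 \<or> j = i + 1" | "i \<ge> j + 2 \<or> j \<ge> i + 2" by linarith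
  then show ?thesis
  proof cases
    case 1 then show ?thesis using assms braid_eq.refl[of "[i]" n] by (simp add: complement_def)
  next
    case 2 then show ?thesis
      using assms braid_eq.braid[of "[]" n "[]" i j] by (auto simp: complement_def)
  next
    case 3 then show ?thesis
      using assms braid_eq.commute[of "[]" n "[]" i j] by (auto simp: complement_def)
  qed
qed

lemma braid_coset:
  assumes "set p \<subseteq> {1..<n}"
  shows "multiples n (braid_class n p) =
    {braid_class n (p @ w) | w. set w \<subseteq> {1..<n}}"
proof (intro equalityI subsetI)
  fix x assume "x \<in> multiples n (braid_class n p)"
  then obtain y where y: "y \<in> braids n" "x = braid_class n p \<otimes>\<^bsub>braid_monoid n\<^esub> y"
    by (auto simp: l_coset_def)
  then show "x \<in> {braid_class n (p @ w) | w. set w \<subseteq> {1..<n}}"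
    using assms by (elim braid_monoid_carrierE) (auto simp: braid_class_mult)
next
  fix x assume "x \<in> {braid_class n (p @ w) | w. set w \<subseteq> {1..<n}}"
  then obtain w where w: "set w \<subseteq> {1..<n}" "x = braid_class n (p @ w)" by auto
  then have "x = braid_class n p \<otimes>\<^bsub>braid_monoid n\<^esub> braid_class n w"
    using assms by (simp add: braid_class_mult)
  with braid_class_carrier[OF w(1)]
  show "x \<in> multiples n (braid_class n p)"
    by (auto simp: l_coset_def)
qed

lemma braid_coset_cong:
  assumes "braid_eq n p q"
  shows "braid_class n p = braid_class n q"
  using assms braid_class_eq_iff braid_eq_set by blast

lemma braid_left_cancel:
  assumes "n \<le> 4" and "p \<in> braids n" "x \<in> braids n" "y \<in> braids n"
    and eq: "p \<otimes>\<^bsub>braid_monoid n\<^esub> x = p \<otimes>\<^bsub>braid_monoid n\<^esub> y"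
  shows "x = y"
proof -
  obtain a u w where "set a \<subseteq> {1..<n}" "p = braid_class n a" "set u \<subseteq> {1..<n}" "x = braid_class n u"
    "set w \<subseteq> {1..<n}" "y = braid_class n w"
    using assms(2-4) by (elim braid_monoid_carrierE)
  then show ?thesis
    using eq braid_cancel_word[OF assms(1), of a u w] by (simp add: braid_class_mult braid_class_eq_iff)
qed

lemma braid_rlcm_pair:
  assumes n: "n \<le> 4" and i: "i \<in> {1..<n}" and j: "j \<in> {1..<n}"
  shows "is_rlcm (braid_monoid n) {braid_gen n i, braid_gen n j} (braid_class n (i # complement i j))"
proof -
  have c: "set (i # complement i j) \<subseteq> {1..<n}" "set (j # complement j i) \<subseteq> {1..<n}"
    using i j by (auto simp: complement_def)
  have "{braid_class n ([i] @ u) | u. set u \<subseteq> {1..<n}} \<inter> {braid_class n ([j] @ u) | u. set u \<subseteq> {1..<n}}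
    = {braid_class n ((i # complement i j) @ u) | u. set u \<subseteq> {1..<n}}" (is "?I \<inter> ?J = ?L")
  proof (intro equalityI subsetI)
    fix x assume "x \<in> ?I \<inter> ?J"
    then obtain u w where u: "set u \<subseteq> {1..<n}" "x = braid_class n (i # u)"
      and w: "set w \<subseteq> {1..<n}" "x = braid_class n (j # w)" by auto
    have "braid_eq n (i # u) (j # w)" using u w i braid_class_eq_iff[of "i # u" n "j # w"] by simp
    then have "common_multiple n i u j w" by (rule braid_common_multiple[OF n])
    then obtain z where z: "set z \<subseteq> {1..<n}" "braid_eq n u (complement i j @ z)"
      by (auto simp: common_multiple_def)
    have "x = braid_class n ((i # complement i j) @ z)"
      unfolding u(2) using braid_coset_cong[OF braid_cons[OF z(2) i]] by simp
    then show "x \<in> ?L" using z(1) by blast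
  next
    fix x assume "x \<in> ?L"
    then obtain z where z: "set z \<subseteq> {1..<n}" and x: "x = braid_class n ((i # complement i j) @ z)" by auto
    have "x = braid_class n ((j # complement j i) @ z)"
      unfolding x by (intro braid_coset_cong braid_eq_append braid_complement_commute i j braid_eq.refl z)
    then have "x = braid_class n ([i] @ (complement i j @ z))" "x = braid_class n ([j] @ (complement j i @ z))"
      by (simp_all add: x)
    moreover have "set (complement i j @ z) \<subseteq> {1..<n}" "set (complement j i @ z) \<subseteq> {1..<n}"
      using c z by auto
    ultimately show "x \<in> ?I \<inter> ?J" by blast
  qed
  then show ?thesis
    unfolding is_rlcm_def braid_gen_def
    using braid_class_carrier[OF c(1)] braid_coset[OF c(1)] braid_coset[of "[i]" n] braid_coset[of "[j]" n] i j
    by simp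
qed

text \<open>The word is the half twist. A multiple of \<open>121\<close> that starts with \<open>3\<close> is rewritten by
  applying Garside's theorem four times, which peels off the letters \<open>3\<close>, \<open>2\<close>, \<open>1\<close> after \<open>121\<close>.\<close>

lemma braid4_half_twist_coset:
  "multiples 4 (braid_class 4 [1, 2, 1]) \<inter>
    multiples 4 (braid_gen 4 3)
    = multiples 4 (braid_class 4 [1, 2, 1, 3, 2, 1])"
proof -
  have "{braid_class 4 ([1, 2, 1] @ u) | u. set u \<subseteq> {1..<4}} \<inter> {braid_class 4 ([3] @ u) | u. set u \<subseteq> {1..<4}}
    = {braid_class 4 ([1, 2, 1, 3, 2, 1] @ u) | u. set u \<subseteq> {1..<4}}" (is "?I \<inter> ?J = ?L")
  proof (intro equalityI subsetI)
    fix x assume "x \<in> ?I \<inter> ?J"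
    then obtain u w where u: "set u \<subseteq> {1..<4}" "x = braid_class 4 (1 # 2 # 1 # u)"
      and w: "set w \<subseteq> {1..<4}" "x = braid_class 4 (3 # w)" by auto
    have split: "\<exists>z. set z \<subseteq> {1..<4} \<and> braid_eq 4 u (complement i j @ z) \<and> braid_eq 4 w (complement j i @ z)"
      if "braid_eq 4 (i # u) (j # w)" for i j u w
      using braid_common_multiple[OF _ that] by (simp add: common_multiple_def)
    have "braid_eq 4 (1 # 2 # 1 # u) (3 # w)"
      using u w braid_class_eq_iff[of "1 # 2 # 1 # u" 4 "3 # w"] by simp
    from split[OF this] obtain z1 where "braid_eq 4 (2 # 1 # u) (3 # z1)" by (auto simp: complement_def)
    from split[OF this] obtain z2 where "braid_eq 4 (1 # u) (3 # 2 # z2)" by (auto simp: complement_def)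
    from split[OF this] obtain z3 where z3: "braid_eq 4 u (3 # z3)" "braid_eq 4 (2 # z2) (1 # z3)"
      by (auto simp: complement_def)
    from split[OF z3(2)] obtain z4 where z4: "set z4 \<subseteq> {1..<4}" "braid_eq 4 z3 (2 # 1 # z4)"
      by (auto simp: complement_def)
    have "braid_eq 4 u (3 # 2 # 1 # z4)" by (rule braid_eq.trans[OF z3(1) braid_cons[OF z4(2)]]) simp
    then have "x = braid_class 4 ([1, 2, 1, 3, 2, 1] @ z4)"
      unfolding u(2) by (intro braid_coset_cong) (simp add: braid_cons)
    then show "x \<in> ?L" using z4(1) by blast
  next
    fix x assume "x \<in> ?L"
    then obtain z where z: "set z \<subseteq> {1..<4}" and x: "x = braid_class 4 ([1, 2, 1, 3, 2, 1] @ z)" by auto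
    have "braid_eq 4 ([1, 2, 1, 3, 2, 1] @ z) ([1, 2, 3, 1, 2, 1] @ z)"
      using braid_eq.commute[of "[1, 2]" 4 "2 # 1 # z" 1 3] z by simp
    also have "braid_eq 4 \<dots> ([1, 2, 3, 2, 1, 2] @ z)"
      using braid_eq.braid[of "[1, 2, 3]" 4 z 1 2] z by simp
    also have "braid_eq 4 \<dots> ([1, 3, 2, 3, 1, 2] @ z)"
      using braid_eq.braid[of "[1]" 4 "1 # 2 # z" 2 3] z by simp
    also have "braid_eq 4 \<dots> ([3, 1, 2, 3, 1, 2] @ z)"
      using braid_eq.commute[of "[]" 4 "2 # 3 # 1 # 2 # z" 1 3] z by simp
    finally have "x = braid_class 4 ([3] @ ([1, 2, 3, 1, 2] @ z))"
      unfolding x by (intro braid_coset_cong) simp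
    moreover have "set ([1, 2, 3, 1, 2] @ z) \<subseteq> {1..<4}" "set ([3, 2, 1] @ z) \<subseteq> {1..<4}" using z by auto
    moreover have "x = braid_class 4 ([1, 2, 1] @ ([3, 2, 1] @ z))" by (simp add: x)
    ultimately show "x \<in> ?I \<inter> ?J" by blast
  qed
  then show ?thesis unfolding braid_gen_def by (simp add: braid_coset)
qed

lemma braid4_rlcm_half_twist:
  "is_rlcm (braid_monoid 4) {braid_class 4 [1, 2, 1], braid_gen 4 3} (braid_class 4 [1, 2, 1, 3, 2, 1])"
  using braid4_half_twist_coset by (simp add: is_rlcm_def braid_class_carrier)

lemma braid_rlcm_1_2:
  assumes "n \<in> {3, 4}"
  shows "is_rlcm (braid_monoid n) {braid_gen n 1, braid_gen n 2} (braid_class n [1, 2, 1])"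
  using assms braid_rlcm_pair[of n 1 2] by (auto simp: complement_def)

text \<open>Two least common multiples of the same set divide each other, and the length leaves no room for a
  nontrivial quotient.\<close>

lemma braid_rlcm_unique:
  assumes m: "is_rlcm (braid_monoid n) K m" and m': "is_rlcm (braid_monoid n) K m'"
  shows "m = m'"
proof -
  interpret monoid "braid_monoid n" by (rule monoid_braid_monoid)
  have car: "m \<in> braids n" "m' \<in> braids n"
    using m m' by (simp_all add: is_rlcm_def)
  have self: "x \<in> multiples n x" if "x \<in> braids n" for x
  proof -
    have "x \<otimes>\<^bsub>braid_monoid n\<^esub> \<one>\<^bsub>braid_monoid n\<^esub> \<in> multiples n x"
      unfolding l_coset_def using one_closed by blast
    then show ?thesis using that by simp
  qed
  have "multiples n m = multiples n m'"
    using m m' by (simp add: is_rlcm_def)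
  then have "m \<in> multiples n m'" "m' \<in> multiples n m"
    using self car by auto
  then obtain x y where x: "x \<in> braids n" "m = m' \<otimes>\<^bsub>braid_monoid n\<^esub> x"
    and y: "y \<in> braids n" "m' = m \<otimes>\<^bsub>braid_monoid n\<^esub> y"
    by (auto simp: l_coset_def)
  have "braid_length m = braid_length m' + braid_length x" "braid_length m' = braid_length m + braid_length y"
    using braid_length_mult[OF car(2) x(1), folded x(2)] braid_length_mult[OF car(1) y(1), folded y(2)]
    by simp_all
  then have "braid_length x = 0" by simp
  then have "x = \<one>\<^bsub>braid_monoid n\<^esub>"
    using x(1) by (elim braid_monoid_carrierE) (simp add: braid_length_class braid_monoid_def)
  then show ?thesis using x(2) car by simp
qed

lemma rlcm_eq: "is_rlcm (braid_monoid n) K m \<Longrightarrow> rlcm (braid_monoid n) K = m"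
  unfolding rlcm_def using braid_rlcm_unique by (intro the_equality) auto

section \<open>Growth series\<close>

definition sphere :: "nat \<Rightarrow> nat \<Rightarrow> nat list set set" where
  "sphere n k = {p \<in> braids n. braid_length p = k}"

definition growth_series :: "nat \<Rightarrow> real fps" where
  "growth_series n = Abs_fps (\<lambda>k. real (card (sphere n k)))"

lemma finite_sphere: "finite (sphere n k)"
proof (rule finite_subset)
  show "sphere n k \<subseteq> braid_class n ` {w. set w \<subseteq> {1..<n} \<and> length w = k}"
    by (auto simp: sphere_def braid_length_class elim!: braid_monoid_carrierE)
  show "finite (braid_class n ` {w. set w \<subseteq> {1..<n} \<and> length w = k})"
    by (intro finite_imageI finite_lists_length_eq) simp
qed

lemma braid_length_eq_0_iff:
  assumes "p \<in> braids n"
  shows "braid_length p = 0 \<longleftrightarrow> p = \<one>\<^bsub>braid_monoid n\<^esub>"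
proof
  obtain w where w: "set w \<subseteq> {1..<n}" "p = braid_class n w" using assms by (rule braid_monoid_carrierE)
  assume "braid_length p = 0"
  then show "p = \<one>\<^bsub>braid_monoid n\<^esub>"
    using w by (simp add: braid_length_class) (simp add: braid_monoid_def)
qed (simp add: braid_length_one)

lemma sphere_0: "sphere n 0 = {\<one>\<^bsub>braid_monoid n\<^esub>}"
  using braid_length_eq_0_iff[of _ n] monoid.one_closed[OF monoid_braid_monoid, of n]
  by (auto simp: sphere_def)

text \<open>By cancellation, multiplication by \<open>p\<close> is a bijection from the elements of length \<open>k - |p|\<close> onto the
  multiples of \<open>p\<close> of length \<open>k\<close>.\<close>

lemma card_coset_sphere:
  assumes n: "n \<le> 4" and p: "p \<in> braids n"
  shows "real (card (multiples n p \<inter> sphere n k))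
    = (fps_X ^ braid_length p * growth_series n) $ k"
proof (cases "k < braid_length p")
  case True
  then have "multiples n p \<inter> sphere n k = {}"
    using braid_length_mult[OF p] by (auto simp: l_coset_def sphere_def)
  then show ?thesis using True by (simp add: fps_X_power_mult_nth)
next
  case False
  interpret monoid "braid_monoid n" by (rule monoid_braid_monoid)
  have "multiples n p \<inter> sphere n k
    = (\<lambda>x. p \<otimes>\<^bsub>braid_monoid n\<^esub> x) ` sphere n (k - braid_length p)"
  proof (intro equalityI subsetI)
    fix y assume "y \<in> multiples n p \<inter> sphere n k"
    then obtain x where x: "x \<in> braids n" "y = p \<otimes>\<^bsub>braid_monoid n\<^esub> x" and y: "y \<in> sphere n k"
      by (auto simp: l_coset_def)
    have "x \<in> sphere n (k - braid_length p)"
      using y x(1) braid_length_mult[OF p x(1), folded x(2)] by (auto simp: sphere_def)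
    then show "y \<in> (\<lambda>x. p \<otimes>\<^bsub>braid_monoid n\<^esub> x) ` sphere n (k - braid_length p)" using x(2) by (rule image_eqI[rotated])
  qed (use False braid_length_mult[OF p] p in \<open>auto simp: l_coset_def sphere_def\<close>)
  moreover have "inj_on (\<lambda>x. p \<otimes>\<^bsub>braid_monoid n\<^esub> x) (sphere n (k - braid_length p))"
    using braid_left_cancel[OF n p] by (auto simp: inj_on_def sphere_def)
  ultimately show ?thesis using False by (simp add: card_image fps_X_power_mult_nth growth_series_def)
qed

lemma sphere_union:
  assumes "k > 0"
  shows "sphere n k = (\<Union>i\<in>{1..<n}. multiples n (braid_gen n i) \<inter> sphere n k)"
proof (intro equalityI subsetI)
  fix p assume p: "p \<in> sphere n k"
  then obtain w where w: "set w \<subseteq> {1..<n}" "p = braid_class n w"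
    by (auto simp: sphere_def elim!: braid_monoid_carrierE)
  with p assms have "w \<noteq> []" by (auto simp: sphere_def braid_length_class)
  then obtain i u where "w = i # u" by (cases w) auto
  with w have i: "i \<in> {1..<n}" "set u \<subseteq> {1..<n}" "p = braid_class n ([i] @ u)" by auto
  then have "p \<in> multiples n (braid_gen n i)"
    unfolding braid_gen_def by (subst braid_coset) auto
  with p i(1) show "p \<in> (\<Union>i\<in>{1..<n}. multiples n (braid_gen n i) \<inter> sphere n k)"
    by blast
qed auto

lemma braid_gen_carrier: "i \<in> {1..<n} \<Longrightarrow> braid_gen n i \<in> braids n"
  unfolding braid_gen_def by (rule braid_class_carrier) auto

lemma rlcm_coset:
  "is_rlcm P {p, q} m \<Longrightarrow> (p <#\<^bsub>P\<^esub> carrier P) \<inter> (q <#\<^bsub>P\<^esub> carrier P) = m <#\<^bsub>P\<^esub> carrier P"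
  by (simp add: is_rlcm_def)

lemma growth_series_0: "growth_series n $ 0 = 1"
  by (simp add: growth_series_def sphere_0)

lemma card_Un_real: "finite S \<Longrightarrow> finite T \<Longrightarrow> real (card (S \<union> T)) = real (card S) + real (card T) - real (card (S \<inter> T))"
  using card_Un_Int[of S T] by simp

text \<open>Inclusion-exclusion over the first letters: the growth series is the reciprocal of the clique
  polynomial.\<close>

lemma growth_series_3: "growth_series 3 * (1 - 2 * fps_X + fps_X ^ 3) = 1"
proof -
  define C where "C p k = multiples 3 p \<inter> sphere 3 k" for p k
  let ?G = "growth_series 3"
  have fin: "finite (C p k)" for p k using finite_sphere by (simp add: C_def)
  have card: "real (card (C p k)) = (fps_X ^ braid_length p * ?G) $ k" if "p \<in> braids 3" for p k
    unfolding C_def by (rule card_coset_sphere[OF _ that]) simp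
  have word: "real (card (C (braid_class 3 w) k)) = (fps_X ^ l * ?G) $ k"
    if "set w \<subseteq> {1..<3}" "length w = l" for w l k
    using card[OF braid_class_carrier[OF that(1)]] that by (simp add: braid_length_class)
  have "?G $ k = (1 + 2 * (fps_X * ?G) - fps_X ^ 3 * ?G) $ k" for k
  proof (cases "k = 0")
    case True then show ?thesis by (simp add: growth_series_0)
  next
    case False
    have "{1..<3} = {1, 2 :: nat}" by auto
    then have "sphere 3 k = C (braid_gen 3 1) k \<union> C (braid_gen 3 2) k"
      using sphere_union[of k 3] False by (simp add: C_def)
    moreover have "C (braid_gen 3 1) k \<inter> C (braid_gen 3 2) k = C (braid_class 3 [1, 2, 1]) k"
      using rlcm_coset[OF braid_rlcm_1_2[of 3]] by (auto simp: C_def)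
    ultimately have "?G $ k = real (card (C (braid_gen 3 1) k)) + real (card (C (braid_gen 3 2) k))
        - real (card (C (braid_class 3 [1, 2, 1]) k))"
      by (simp add: growth_series_def card_Un_real fin)
    moreover have "real (card (C (braid_gen 3 1) k)) = (fps_X ^ 1 * ?G) $ k"
        "real (card (C (braid_gen 3 2) k)) = (fps_X ^ 1 * ?G) $ k"
        "real (card (C (braid_class 3 [1, 2, 1]) k)) = (fps_X ^ 3 * ?G) $ k"
      unfolding braid_gen_def by (rule word; simp)+
    ultimately show ?thesis using False by simp
  qed
  then have "?G = 1 + 2 * (fps_X * ?G) - fps_X ^ 3 * ?G" by (simp add: fps_eq_iff)
  then show ?thesis by (simp add: algebra_simps)
qed

lemma growth_series_4: "growth_series 4 * (1 - 3 * fps_X + fps_X ^ 2 + 2 * fps_X ^ 3 - fps_X ^ 6) = 1"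
proof -
  define C where "C p k = multiples 4 p \<inter> sphere 4 k" for p k
  let ?G = "growth_series 4"
  have fin: "finite (C p k)" for p k using finite_sphere by (simp add: C_def)
  have card: "real (card (C p k)) = (fps_X ^ braid_length p * ?G) $ k" if "p \<in> braids 4" for p k
    unfolding C_def by (rule card_coset_sphere[OF _ that]) simp
  have word: "real (card (C (braid_class 4 w) k)) = (fps_X ^ l * ?G) $ k"
    if "set w \<subseteq> {1..<4}" "length w = l" for w l k
    using card[OF braid_class_carrier[OF that(1)]] that by (simp add: braid_length_class)
  have "?G $ k = (1 + 3 * (fps_X * ?G) - fps_X ^ 2 * ?G - 2 * (fps_X ^ 3 * ?G) + fps_X ^ 6 * ?G) $ k" for k
  proof (cases "k = 0")
    case True then show ?thesis by (simp add: growth_series_0)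
  next
    case False
    let ?C1 = "C (braid_gen 4 1) k" and ?C2 = "C (braid_gen 4 2) k" and ?C3 = "C (braid_gen 4 3) k"
    have "{1..<4} = {1, 2, 3 :: nat}" by auto
    then have S: "sphere 4 k = (?C1 \<union> ?C2) \<union> ?C3"
      using sphere_union[of k 4] False by (simp add: C_def Un_assoc)
    have C12: "?C1 \<inter> ?C2 = C (braid_class 4 [1, 2, 1]) k"
      using rlcm_coset[OF braid_rlcm_1_2[of 4]] by (auto simp: C_def)
    have C13: "?C1 \<inter> ?C3 = C (braid_class 4 [1, 3]) k"
      using rlcm_coset[OF braid_rlcm_pair[of 4 1 3]] by (auto simp: C_def complement_def)
    have C23: "?C2 \<inter> ?C3 = C (braid_class 4 [2, 3, 2]) k"
      using rlcm_coset[OF braid_rlcm_pair[of 4 2 3]] by (auto simp: C_def complement_def)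
    have C123: "C (braid_class 4 [1, 2, 1]) k \<inter> ?C3 = C (braid_class 4 [1, 2, 1, 3, 2, 1]) k"
      using braid4_half_twist_coset by (auto simp: C_def)
    have "(?C1 \<union> ?C2) \<inter> ?C3 = C (braid_class 4 [1, 3]) k \<union> C (braid_class 4 [2, 3, 2]) k"
      using C13 C23 by blast
    moreover have "C (braid_class 4 [1, 3]) k \<inter> C (braid_class 4 [2, 3, 2]) k = C (braid_class 4 [1, 2, 1, 3, 2, 1]) k"
      using C12 C13 C23 C123 by blast
    ultimately have "?G $ k = real (card ?C1) + real (card ?C2) - real (card (C (braid_class 4 [1, 2, 1]) k)) + real (card ?C3)
      - (real (card (C (braid_class 4 [1, 3]) k)) + real (card (C (braid_class 4 [2, 3, 2]) k))
        - real (card (C (braid_class 4 [1, 2, 1, 3, 2, 1]) k)))"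
      using C12 unfolding growth_series_def by (simp add: S card_Un_real fin)
    moreover have "real (card ?C1) = (fps_X ^ 1 * ?G) $ k" "real (card ?C2) = (fps_X ^ 1 * ?G) $ k"
        "real (card ?C3) = (fps_X ^ 1 * ?G) $ k"
        "real (card (C (braid_class 4 [1, 2, 1]) k)) = (fps_X ^ 3 * ?G) $ k"
        "real (card (C (braid_class 4 [1, 3]) k)) = (fps_X ^ 2 * ?G) $ k"
        "real (card (C (braid_class 4 [2, 3, 2]) k)) = (fps_X ^ 3 * ?G) $ k"
        "real (card (C (braid_class 4 [1, 2, 1, 3, 2, 1]) k)) = (fps_X ^ 6 * ?G) $ k"
      unfolding braid_gen_def by (rule word; simp)+
    ultimately show ?thesis using False by simp
  qed
  then have "?G = 1 + 3 * (fps_X * ?G) - fps_X ^ 2 * ?G - 2 * (fps_X ^ 3 * ?G) + fps_X ^ 6 * ?G"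
    by (simp add: fps_eq_iff)
  then show ?thesis by (simp add: algebra_simps)
qed

text \<open>Dividing by \<open>1 - g\<close> preserves absolute convergence at \<open>t\<close> if \<open>c\<close>, the value at \<open>t\<close> of \<open>g\<close> with absolute
  coefficients, is less than \<open>1\<close>: the partial sums satisfy \<open>F N \<le> Y + c * F N\<close>.\<close>

lemma fps_quotient_summable:
  fixes f y :: "real fps" and g :: "real poly"
  assumes t: "0 \<le> t" and y: "summable (\<lambda>k. \<bar>y $ k\<bar> * t ^ k)"
    and eq: "f * fps_of_poly (1 - g) = y" and g: "poly (map_poly abs g) t < 1"
  shows "summable (\<lambda>k. \<bar>f $ k\<bar> * t ^ k)"
proof -
  define F where "F N = (\<Sum>k\<le>N. \<bar>f $ k\<bar> * t ^ k)" for N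
  define Y where "Y = (\<Sum>k. \<bar>y $ k\<bar> * t ^ k)"
  define c where "c = poly (map_poly abs g) t"
  have g_le: "(\<Sum>m\<le>N. \<bar>coeff g m\<bar> * t ^ m) \<le> c" for N
  proof -
    have "(\<Sum>m\<le>N. \<bar>coeff g m\<bar> * t ^ m) \<le> (\<Sum>m\<le>max N (degree (map_poly abs g)). \<bar>coeff g m\<bar> * t ^ m)"
      using t by (intro sum_mono2) auto
    also have "\<dots> = (\<Sum>m\<le>degree (map_poly abs g). \<bar>coeff g m\<bar> * t ^ m)"
    proof (intro sum.mono_neutral_right ballI)
      fix m assume "m \<in> {..max N (degree (map_poly abs g))} - {..degree (map_poly abs g)}"
      then have "coeff (map_poly abs g) m = 0" by (intro coeff_eq_0) auto
      then show "\<bar>coeff g m\<bar> * t ^ m = 0" by (simp add: coeff_map_poly)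
    qed auto
    also have "\<dots> = c" by (simp add: c_def poly_altdef coeff_map_poly)
    finally show ?thesis .
  qed
  have f_eq: "f = y + f * fps_of_poly g"
    using eq by (simp add: fps_of_poly_diff algebra_simps)
  have f_le: "\<bar>f $ k\<bar> * t ^ k \<le> \<bar>y $ k\<bar> * t ^ k + (\<Sum>j\<le>k. (\<bar>f $ j\<bar> * t ^ j) * (\<bar>coeff g (k - j)\<bar> * t ^ (k - j)))" for k
  proof -
    have "f $ k = y $ k + (\<Sum>j\<le>k. f $ j * coeff g (k - j))"
      by (subst f_eq) (simp add: fps_mult_nth atMost_atLeast0)
    then have "\<bar>f $ k\<bar> \<le> \<bar>y $ k\<bar> + (\<Sum>j\<le>k. \<bar>f $ j\<bar> * \<bar>coeff g (k - j)\<bar>)"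
      using sum_abs[of "\<lambda>j. f $ j * coeff g (k - j)" "{..k}"] abs_triangle_ineq[of "y $ k" "\<Sum>j\<le>k. f $ j * coeff g (k - j)"]
      by (simp add: abs_mult)
    then have "\<bar>f $ k\<bar> * t ^ k \<le> \<bar>y $ k\<bar> * t ^ k + (\<Sum>j\<le>k. \<bar>f $ j\<bar> * \<bar>coeff g (k - j)\<bar>) * t ^ k"
      unfolding distrib_right[symmetric] using t by (intro mult_right_mono) auto
    also have "(\<Sum>j\<le>k. \<bar>f $ j\<bar> * \<bar>coeff g (k - j)\<bar>) * t ^ k
      = (\<Sum>j\<le>k. (\<bar>f $ j\<bar> * t ^ j) * (\<bar>coeff g (k - j)\<bar> * t ^ (k - j)))"
      unfolding sum_distrib_right
    proof (rule sum.cong)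
      fix j assume "j \<in> {..k}"
      then have "t ^ k = t ^ j * t ^ (k - j)" by (simp flip: power_add)
      then show "\<bar>f $ j\<bar> * \<bar>coeff g (k - j)\<bar> * t ^ k = (\<bar>f $ j\<bar> * t ^ j) * (\<bar>coeff g (k - j)\<bar> * t ^ (k - j))"
        by simp
    qed simp
    finally show ?thesis .
  qed
  have F_le: "F N \<le> Y + F N * c" for N
  proof -
    have "F N \<le> (\<Sum>k\<le>N. \<bar>y $ k\<bar> * t ^ k) + (\<Sum>k\<le>N. \<Sum>j\<le>k. (\<bar>f $ j\<bar> * t ^ j) * (\<bar>coeff g (k - j)\<bar> * t ^ (k - j)))"
      unfolding F_def sum.distrib[symmetric] by (intro sum_mono f_le)
    also have "(\<Sum>k\<le>N. \<bar>y $ k\<bar> * t ^ k) \<le> Y"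
      unfolding Y_def using t by (intro sum_le_suminf y) auto
    also have "(\<Sum>k\<le>N. \<Sum>j\<le>k. (\<bar>f $ j\<bar> * t ^ j) * (\<bar>coeff g (k - j)\<bar> * t ^ (k - j)))
      = (\<Sum>(j, m)\<in>{(j, m). j + m \<le> N}. (\<bar>f $ j\<bar> * t ^ j) * (\<bar>coeff g m\<bar> * t ^ m))"
      by (rule sum.triangle_reindex_eq[symmetric])
    also have "\<dots> \<le> (\<Sum>(j, m)\<in>{..N} \<times> {..N}. (\<bar>f $ j\<bar> * t ^ j) * (\<bar>coeff g m\<bar> * t ^ m))"
      using t by (intro sum_mono2) auto
    also have "\<dots> = F N * (\<Sum>m\<le>N. \<bar>coeff g m\<bar> * t ^ m)"
      by (simp add: F_def sum_product sum.cartesian_product)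
    also have "\<dots> \<le> F N * c"
      using t g_le by (intro mult_left_mono) (auto simp: F_def intro!: sum_nonneg)
    finally show ?thesis by simp
  qed
  show ?thesis
  proof (rule bounded_imp_summable)
    show "(\<Sum>k\<le>N. \<bar>f $ k\<bar> * t ^ k) \<le> Y / (1 - c)" for N
      using F_le[of N] g unfolding F_def[symmetric] c_def[symmetric] by (simp add: field_simps)
  qed (use t in simp)
qed

lemma partition_function_summable:
  assumes sm: "summable (\<lambda>k. \<bar>growth_series n $ k\<bar> * exp (- \<beta>) ^ k)"
  shows "(\<lambda>p. exp (- \<beta> * real (braid_length p))) summable_on braids n"
proof (rule nonneg_bounded_partial_sums_imp_summable_on)
  show "\<forall>\<^sub>F F in finite_subsets_at_top (braids n).
    (\<Sum>p\<in>F. exp (- \<beta> * real (braid_length p))) \<le> (\<Sum>k. \<bar>growth_series n $ k\<bar> * exp (- \<beta>) ^ k)"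
  proof (rule eventually_finite_subsets_at_top_weakI)
    fix F assume F: "finite F" "F \<subseteq> braids n"
    define N where "N = Max (insert 0 (braid_length ` F))"
    have "F \<subseteq> (\<Union>k\<le>N. sphere n k)" using F by (auto simp: sphere_def N_def)
    then have "(\<Sum>p\<in>F. exp (- \<beta> * real (braid_length p))) \<le> (\<Sum>p\<in>(\<Union>k\<le>N. sphere n k). exp (- \<beta> * real (braid_length p)))"
      by (intro sum_mono2) (auto simp: finite_sphere)
    also have "\<dots> = (\<Sum>k\<le>N. \<Sum>p\<in>sphere n k. exp (- \<beta> * real (braid_length p)))"
      by (rule sum.UNION_disjoint) (auto simp: finite_sphere[unfolded sphere_def] sphere_def)
    also have "\<dots> = (\<Sum>k\<le>N. \<bar>growth_series n $ k\<bar> * exp (- \<beta>) ^ k)"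
    proof (rule sum.cong)
      fix k
      have "(\<Sum>p\<in>sphere n k. exp (- \<beta> * real (braid_length p))) = (\<Sum>p\<in>sphere n k. exp (- \<beta>) ^ k)"
        by (intro sum.cong) (auto simp: sphere_def mult.commute simp flip: exp_of_nat_mult)
      then show "(\<Sum>p\<in>sphere n k. exp (- \<beta> * real (braid_length p))) = \<bar>growth_series n $ k\<bar> * exp (- \<beta>) ^ k"
        by (simp add: growth_series_def)
    qed simp
    also have "\<dots> \<le> (\<Sum>k. \<bar>growth_series n $ k\<bar> * exp (- \<beta>) ^ k)"
      by (intro sum_le_suminf sm) auto
    finally show "(\<Sum>p\<in>F. exp (- \<beta> * real (braid_length p))) \<le> (\<Sum>k. \<bar>growth_series n $ k\<bar> * exp (- \<beta>) ^ k)" .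
  qed
qed auto

lemma growth_series_3_summable:
  assumes t: "0 \<le> t" "t + t ^ 2 < 1"
  shows "summable (\<lambda>k. \<bar>growth_series 3 $ k\<bar> * t ^ k)"
proof -
  let ?h = "growth_series 3 * fps_of_poly (1 - [:0, 1, 1:])"
  have "t < 1" using t by (smt (verit) zero_le_power2)
  have one: "summable (\<lambda>k. \<bar>(1 :: real fps) $ k\<bar> * t ^ k)"
    by (rule summable_finite[of "{0}"]) auto
  have "?h * fps_of_poly (1 - [:0, 1:]) = growth_series 3 * fps_of_poly ((1 - [:0, 1, 1:]) * (1 - [:0, 1:]))"
    by (simp add: fps_of_poly_mult mult.assoc)
  also have "fps_of_poly ((1 - [:0, 1, 1:]) * (1 - [:0, 1:])) = 1 - 2 * fps_X + (fps_X ^ 3 :: real fps)"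
    by (simp add: fps_of_poly_mult fps_of_poly_diff fps_of_poly_pCons algebra_simps power3_eq_cube)
  finally have "?h * fps_of_poly (1 - [:0, 1:]) = 1" by (simp add: growth_series_3)
  then have "summable (\<lambda>k. \<bar>?h $ k\<bar> * t ^ k)"
    by (rule fps_quotient_summable[rotated 2])
      (use t \<open>t < 1\<close> one in \<open>simp_all add: map_poly_pCons\<close>)
  then show ?thesis
    by (rule fps_quotient_summable[rotated, of _ _ _ "[:0, 1, 1:]"])
      (use t in \<open>auto simp: map_poly_pCons power2_eq_square algebra_simps\<close>)
qed

text \<open>If \<open>r\<close> is a root of the quintic, the quintic divided by \<open>1 - t / r\<close> is \<open>1 - quintic_cofactor r\<close>. The
  coefficients are obtained by dividing from the top degree, which avoids inverses of \<open>r\<close>.\<close>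

definition quintic_cofactor :: "real \<Rightarrow> real poly" where
  "quintic_cofactor r = [:0, r ^ 4 + r ^ 3 + r ^ 2 - r, r + r ^ 2 + r ^ 3, r + r ^ 2, r:]"

lemma quintic_factor:
  assumes "r > 0" and root: "poly [:1, -2, -1, 1, 1, 1:] r = 0"
  shows "[:1, -2, -1, 1, 1, 1:] = (1 - [:0, 1 / r:]) * (1 - quintic_cofactor r)"
  using assms
  by (simp add: quintic_cofactor_def field_simps power2_eq_square power3_eq_cube power4_eq_xxxx one_pCons)

text \<open>The range up to \<open>31 / 50\<close> just exceeds the golden ratio root \<open>0.618\<close>, above which two generators
  already exclude KMS states with \<open>t < 1\<close>.\<close>

lemma quintic_cofactor_bound:
  assumes r: "0 \<le> r" "r \<le> 1 / 2" and t: "0 \<le> t" "t \<le> 31 / 50"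
  shows "poly (map_poly abs (quintic_cofactor r)) t < 1"
proof -
  have "r ^ 2 \<le> r * (1/2)" "r ^ 3 \<le> r ^ 2 * (1/2)" "r ^ 4 \<le> r ^ 3 * (1/2)"
    using r mult_left_mono[of r "1/2" r] mult_left_mono[of r "1/2" "r ^ 2"] mult_left_mono[of r "1/2" "r ^ 3"]
    by (simp_all add: power2_eq_square power3_eq_cube power4_eq_xxxx)
  moreover have "0 \<le> r ^ 2" "0 \<le> r ^ 3" "0 \<le> r ^ 4" using r by simp_all
  ultimately have a: "\<bar>r ^ 4 + r ^ 3 + r ^ 2 - r\<bar> \<le> 1 / 2" and b: "\<bar>r + r ^ 2 + r ^ 3\<bar> \<le> 7 / 8"
    and c: "\<bar>r + r ^ 2\<bar> \<le> 3 / 4" and e: "\<bar>r\<bar> \<le> 1 / 2"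
    using r by linarith+
  have step: "t * x \<le> 31 / 50 * y" if "0 \<le> x" "x \<le> y" for x y
    using t that by (intro mult_mono) auto
  have 1: "\<bar>r + r ^ 2\<bar> + t * \<bar>r\<bar> \<le> 3 / 4 + 31 / 50 * (1 / 2)"
    using c by (intro add_mono step e) auto
  have 2: "\<bar>r + r ^ 2 + r ^ 3\<bar> + t * (\<bar>r + r ^ 2\<bar> + t * \<bar>r\<bar>) \<le> 7 / 8 + 31 / 50 * (3 / 4 + 31 / 50 * (1 / 2))"
    using b t by (intro add_mono step 1) auto
  have 3: "\<bar>r ^ 4 + r ^ 3 + r ^ 2 - r\<bar> + t * (\<bar>r + r ^ 2 + r ^ 3\<bar> + t * (\<bar>r + r ^ 2\<bar> + t * \<bar>r\<bar>))
      \<le> 1 / 2 + 31 / 50 * (7 / 8 + 31 / 50 * (3 / 4 + 31 / 50 * (1 / 2)))"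
    using a t by (intro add_mono step 2) auto
  have "poly (map_poly abs (quintic_cofactor r)) t
    = t * (\<bar>r ^ 4 + r ^ 3 + r ^ 2 - r\<bar> + t * (\<bar>r + r ^ 2 + r ^ 3\<bar> + t * (\<bar>r + r ^ 2\<bar> + t * \<bar>r\<bar>)))"
    unfolding quintic_cofactor_def by (simp add: map_poly_pCons)
  also have "\<dots> \<le> 31 / 50 * (1 / 2 + 31 / 50 * (7 / 8 + 31 / 50 * (3 / 4 + 31 / 50 * (1 / 2))))"
    using t by (intro step 3) auto
  also have "\<dots> < 1" by simp
  finally show ?thesis .
qed

lemma quintic_cofactor_pos:
  assumes r: "0 \<le> r" "r \<le> 1 / 2" and t: "0 \<le> t" "t \<le> 31 / 50"
  shows "poly (1 - quintic_cofactor r) t > 0"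
proof -
  have "poly (quintic_cofactor r) t \<le> poly (map_poly abs (quintic_cofactor r)) t"
    unfolding quintic_cofactor_def using t
    by (simp add: map_poly_pCons) (intro mult_left_mono add_mono abs_ge_self; simp)
  then show ?thesis using quintic_cofactor_bound[OF assms] by simp
qed

lemma quintic_root:
  obtains r :: real where "0 < r" "r \<le> 1 / 2" "poly [:1, -2, -1, 1, 1, 1:] r = 0"
proof -
  have "\<exists>r. 0 \<le> r \<and> r \<le> 1 / 2 \<and> poly [:1, -2, -1, 1, 1, 1:] r = (0 :: real)"
    by (rule IVT2) (auto intro!: continuous_intros)
  then obtain r :: real where r: "0 \<le> r" "r \<le> 1 / 2" "poly [:1, -2, -1, 1, 1, 1:] r = 0" by blast
  moreover from r(3) have "r \<noteq> 0" by auto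
  ultimately show thesis using that[of r] by simp
qed

lemma quintic_poly:
  assumes "r > 0" and "poly [:1, -2, -1, 1, 1, 1:] r = 0"
  shows "poly [:1, -2, -1, 1, 1, 1:] t = (1 - t / r) * poly (1 - quintic_cofactor r) t"
  unfolding quintic_factor[OF assms] by simp

text \<open>The cofactor has no zero up to \<open>31 / 50\<close>, so below \<open>r\<close> the quintic is positive.\<close>

lemma quintic_smallest_root:
  assumes r: "0 < r" "r \<le> 1 / 2" and root: "poly [:1, -2, -1, 1, 1, 1:] r = 0"
  shows "smallest_positive_root [:1, -2, -1, 1, 1, 1:] r"
  unfolding smallest_positive_root_def
proof (intro conjI allI impI r(1) root, elim conjE)
  fix t :: real assume t: "t > 0" "poly [:1, -2, -1, 1, 1, 1:] t = 0"
  show "r \<le> t"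
  proof (rule ccontr)
    assume "\<not> r \<le> t"
    then have "1 - t / r > 0" "t \<le> 31 / 50" using r by (simp_all add: field_simps)
    then have "(1 - t / r) * poly (1 - quintic_cofactor r) t > 0"
      using quintic_cofactor_pos[of r t] r t by (intro mult_pos_pos) auto
    moreover have "(1 - t / r) * poly (1 - quintic_cofactor r) t = 0"
      using quintic_poly[OF r(1) root, of t] t(2) by metis
    ultimately show False by linarith
  qed
qed

text \<open>The clique polynomial of the four strand monoid is \<open>(1 - t)\<close> times the quintic, that is, a product
  \<open>(1 - t) (1 - t / r) (1 - g t)\<close>; the three factors are divided out in turn.\<close>

lemma growth_series_4_summable:
  assumes r: "0 < r" "r \<le> 1 / 2" and root: "poly [:1, -2, -1, 1, 1, 1:] r = 0" and t: "0 \<le> t" "t < r"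
  shows "summable (\<lambda>k. \<bar>growth_series 4 $ k\<bar> * t ^ k)"
proof -
  let ?w = "quintic_cofactor r"
  let ?f = "growth_series 4 * fps_of_poly (1 - ?w)" and ?h = "growth_series 4 * fps_of_poly (1 - ?w) * fps_of_poly (1 - [:0, 1 / r:])"
  have one: "summable (\<lambda>k. \<bar>(1 :: real fps) $ k\<bar> * t ^ k)"
    by (rule summable_finite[of "{0}"]) auto
  have "?h * fps_of_poly (1 - [:0, 1:]) = growth_series 4 * fps_of_poly (((1 - [:0, 1 / r:]) * (1 - ?w)) * (1 - [:0, 1:]))"
    by (simp add: fps_of_poly_mult mult_ac)
  also have "fps_of_poly (((1 - [:0, 1 / r:]) * (1 - ?w)) * (1 - [:0, 1:]))
      = 1 - 3 * fps_X + fps_X ^ 2 + 2 * fps_X ^ 3 - (fps_X ^ 6 :: real fps)"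
  proof -
    have "((1 - [:0, 1 / r:]) * (1 - ?w)) * (1 - [:0, 1:]) = [:1, -3, 1, 2, 0, 0, -1:]"
      unfolding quintic_factor[OF r(1) root, symmetric] by (simp add: one_pCons)
    then show ?thesis by (simp add: fps_of_poly_pCons algebra_simps eval_nat_numeral)
  qed
  finally have "?h * fps_of_poly (1 - [:0, 1:]) = 1" by (simp add: growth_series_4)
  then have h: "summable (\<lambda>k. \<bar>?h $ k\<bar> * t ^ k)"
    by (rule fps_quotient_summable[rotated 2])
      (use t r one in \<open>simp_all add: map_poly_pCons\<close>)
  have f: "summable (\<lambda>k. \<bar>?f $ k\<bar> * t ^ k)"
    by (rule fps_quotient_summable[OF t(1) h HOL.refl]) (use t r in \<open>simp add: map_poly_pCons\<close>)
  show ?thesis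
    by (rule fps_quotient_summable[OF t(1) f HOL.refl]) (use t r in \<open>auto intro!: quintic_cofactor_bound\<close>)
qed

section \<open>Thresholds for three and four strands\<close>

lemma graded_dynamics_braid:
  assumes n: "n \<in> {3, 4}"
    and "semigroup_cstar_algebra (braid_monoid n) A v"
    and "cstar_dynamics A \<sigma>"
    and "\<And>t p. p \<in> braids n \<Longrightarrow>
      \<sigma> t (v p) = cscale A (exp (\<i> * complex_of_real t * of_nat (braid_length p))) (v p)"
  shows "graded_dynamics (braid_monoid n) braid_length A v \<sigma>"
proof -
  have "graded_cancellative_monoid (braid_monoid n) braid_length"
  proof (intro graded_cancellative_monoid.intro monoid_braid_monoid graded_cancellative_monoid_axioms.intro)
    show "countable (braids n)"
      by (simp add: braid_monoid_def)
    show "infinite (braids n)"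
    proof
      assume "finite (braids n)"
      then have "finite (braid_length ` braids n)" by simp
      moreover have "k \<in> braid_length ` braids n" for k
      proof -
        have w: "set (replicate k 1) \<subseteq> {1..<n}" using n by auto
        from braid_length_class[OF w] braid_class_carrier[OF w] show ?thesis by force
      qed
      then have "braid_length ` braids n = UNIV" by blast
      ultimately show False by simp
    qed
    show "x = y" if "p \<in> braids n" "x \<in> braids n" "y \<in> braids n"
      "p \<otimes>\<^bsub>braid_monoid n\<^esub> x = p \<otimes>\<^bsub>braid_monoid n\<^esub> y" for p x y
      by (rule braid_left_cancel[OF _ that]) (use n in auto)
  qed (rule braid_length_mult)
  then show ?thesis
    by (rule graded_dynamics.intro[OF _ graded_dynamics_axioms.intro]) (fact assms)+
qed

lemma braid_length_word:
  "set w \<subseteq> {1..<n} \<Longrightarrow> length w = l \<Longrightarrow> braid_length (braid_class n w) = l"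
  by (simp add: braid_length_class)

lemma braid_gen_distinct:
  assumes "n \<le> 4" "i \<in> {1..<n}" "j \<in> {1..<n}" "i \<noteq> j" shows "braid_gen n i \<noteq> braid_gen n j"
proof
  assume "braid_gen n i = braid_gen n j"
  then have "braid_eq n [i] [j]" using assms braid_class_eq_iff[of "[i]" n "[j]"] by (simp add: braid_gen_def)
  then have "common_multiple n i [] j []" by (rule braid_common_multiple[OF assms(1)])
  then obtain z where "braid_eq n [] (complement i j @ z)" by (auto simp: common_multiple_def)
  from braid_eq_length[OF this] show False using assms(4) by (auto simp: complement_def split: if_splits)
qed

lemma rlcm_singleton: "p \<in> braids n \<Longrightarrow> rlcm (braid_monoid n) {p} = p"
  by (rule rlcm_eq) (simp add: is_rlcm_def)

lemma clique_polynomial_3: "clique_polynomial 3 = [:1, -2, 0, 1:]"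
proof -
  let ?s = "braid_gen 3 1" and ?t = "braid_gen 3 2"
  have ne: "?s \<noteq> ?t" by (rule braid_gen_distinct) auto
  have gens: "braid_gen 3 ` {1..<3} = {?s, ?t}"
  proof -
    have "{1..<3} = {1, 2 :: nat}" by auto
    then show ?thesis by simp
  qed
  have pow: "Pow {?s, ?t} - {{}} = {{?s}, {?t}, {?s, ?t}}" by auto
  have lens: "braid_length (rlcm (braid_monoid 3) {?s}) = 1" "braid_length (rlcm (braid_monoid 3) {?t}) = 1"
    by (subst rlcm_singleton; simp add: braid_gen_carrier braid_length_gen)+
  have "rlcm (braid_monoid 3) {?s, ?t} = braid_class 3 [1, 2, 1]"
    by (rule rlcm_eq[OF braid_rlcm_1_2]) simp
  moreover have "braid_length (braid_class 3 [1, 2, 1]) = 3" by (rule braid_length_word; simp)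
  ultimately have len3: "braid_length (rlcm (braid_monoid 3) {?s, ?t}) = 3" by simp
  have "clique_polynomial 3 = 1 + (\<Sum>K\<in>{{?s}, {?t}, {?s, ?t}}. monom ((-1) ^ card K) (braid_length (rlcm (braid_monoid 3) K)))"
    unfolding clique_polynomial_def gens pow ..
  also have "\<dots> = 1 + (monom (-1) 1 + (monom (-1) 1 + monom 1 3))"
    using ne by (simp add: lens[simplified] len3[simplified] insert_eq_iff doubleton_eq_iff)
  also have "\<dots> = [:1, -2, 0, 1:]"
    by (simp add: monom_altdef one_pCons eval_nat_numeral)
  finally show ?thesis .
qed

lemma golden_root:
  fixes t :: real
  assumes "t > 0" shows "t + t ^ 2 < 1 \<longleftrightarrow> t < sqrt 5 / 2 - 1 / 2" "t + t ^ 2 \<le> 1 \<longleftrightarrow> t \<le> sqrt 5 / 2 - 1 / 2"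
proof -
  have s: "sqrt 5 \<ge> 0" "sqrt 5 ^ 2 = (5 :: real)" by auto
  have *: "4 * (t + t ^ 2 - 1) = (2 * t + 1 - sqrt 5) * (2 * t + 1 + sqrt 5)"
    using s(2) by (simp add: algebra_simps power2_eq_square)
  have pos: "2 * t + 1 + sqrt 5 > 0" using assms s(1) by linarith
  have "t + t ^ 2 < 1 \<longleftrightarrow> (2 * t + 1 - sqrt 5) * (2 * t + 1 + sqrt 5) < 0" unfolding *[symmetric] by auto
  also have "\<dots> \<longleftrightarrow> 2 * t + 1 - sqrt 5 < 0" using pos by (simp add: mult_less_0_iff)
  finally show "t + t ^ 2 < 1 \<longleftrightarrow> t < sqrt 5 / 2 - 1 / 2" by auto
  have "t + t ^ 2 \<le> 1 \<longleftrightarrow> (2 * t + 1 - sqrt 5) * (2 * t + 1 + sqrt 5) \<le> 0" unfolding *[symmetric] by auto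
  also have "\<dots> \<longleftrightarrow> 2 * t + 1 - sqrt 5 \<le> 0" using pos by (simp add: mult_le_0_iff)
  finally show "t + t ^ 2 \<le> 1 \<longleftrightarrow> t \<le> sqrt 5 / 2 - 1 / 2" by auto
qed

lemma golden_root_bounds: "0 < sqrt 5 / 2 - 1 / 2" "sqrt 5 / 2 - 1 / 2 < (1 :: real)"
proof -
  have "1 < sqrt (5 :: real)" by (rule real_less_rsqrt) simp
  moreover have "sqrt (5 :: real) < 3" by (rule real_less_lsqrt) auto
  ultimately show "0 < sqrt 5 / 2 - 1 / 2" "sqrt 5 / 2 - 1 / 2 < (1 :: real)" by simp_all
qed

lemma golden_smallest_root: "smallest_positive_root [:1, -2, 0, 1:] (sqrt 5 / 2 - 1 / 2)"
  unfolding smallest_positive_root_def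
proof (intro conjI allI impI golden_root_bounds(1), goal_cases)
  case 1
  let ?t = "sqrt 5 / 2 - 1 / 2 :: real"
  have "?t + ?t ^ 2 = 1" by (simp add: power2_eq_square field_simps)
  moreover have "poly [:1, -2, 0, 1:] ?t = (1 - ?t) * (1 - (?t + ?t ^ 2))"
    by (simp only: poly_pCons poly_0) (simp add: algebra_simps power2_eq_square)
  ultimately show ?case by simp
next
  case (2 t)
  have "poly [:1, -2, 0, 1:] t = (1 - t) * (1 - (t + t ^ 2))"
    by (simp add: algebra_simps power2_eq_square)
  with 2 have "t = 1 \<or> t + t ^ 2 = 1" by auto
  then show ?case using golden_root(1)[of t] golden_root_bounds 2 by auto
qed

context
  fixes n :: nat and A :: "'a cstar" and v :: "nat list set \<Rightarrow> 'a" and \<sigma> :: "real \<Rightarrow> 'a \<Rightarrow> 'a"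
  assumes n: "n \<in> {3, 4}" and dyn: "graded_dynamics (braid_monoid n) braid_length A v \<sigma>"
begin

interpretation graded_dynamics "braid_monoid n" braid_length A v \<sigma> by (rule dyn)

lemma kms_nonneg:
  assumes "kms_state A \<sigma> \<beta> \<phi>" shows "0 \<le> \<beta>"
  using kms_one_generator[OF assms braid_gen_carrier[of 1]] n braid_length_gen[of 1 n] by auto

lemma kms_golden_bound:
  assumes kms: "kms_state A \<sigma> \<beta> \<phi>" and "\<beta> \<noteq> 0"
  shows "exp (- \<beta>) < 1" "exp (- \<beta>) + exp (- \<beta>) ^ 2 \<le> 1"
proof -
  define t where "t = exp (- \<beta>)"
  show 1: "exp (- \<beta>) < 1" using kms_nonneg[OF kms] \<open>\<beta> \<noteq> 0\<close> by simp
  have gens: "1 \<in> {1..<n}" "2 \<in> {1..<n}" using n by auto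
  have len: "braid_length (braid_class n [1, 2, 1]) = 3" using n by (intro braid_length_word) auto
  have "t ^ 1 + t ^ 1 \<le> 1 + t ^ 3"
    using kms_two_generators[OF kms braid_gen_carrier[OF gens(1)] braid_gen_carrier[OF gens(2)] braid_rlcm_1_2[OF n]]
    unfolding braid_length_gen[OF gens(1)] braid_length_gen[OF gens(2)] len t_def .
  then have "0 \<le> (1 - t) * (1 - (t + t ^ 2))" by (simp add: algebra_simps power2_eq_square power3_eq_cube)
  then show "exp (- \<beta>) + exp (- \<beta>) ^ 2 \<le> 1" using 1 by (simp add: t_def zero_le_mult_iff)
qed

lemma inverse_temperature_space_braid:
  assumes r: "0 < r"
    and sm: "\<And>t. 0 < t \<Longrightarrow> t < r \<Longrightarrow> summable (\<lambda>k. \<bar>growth_series n $ k\<bar> * t ^ k)"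
    and nec: "\<And>\<beta> \<phi>. kms_state A \<sigma> \<beta> \<phi> \<Longrightarrow> \<beta> \<noteq> 0 \<Longrightarrow> exp (- \<beta>) \<le> r"
  shows "inverse_temperature_space A \<sigma> = {0} \<union> {ereal (- ln r)..\<infinity>}"
proof (rule inverse_temperature_space_threshold)
  fix \<beta> assume "- ln r < \<beta>"
  then have "exp (- \<beta>) < r" using r by (metis exp_less_mono exp_ln minus_less_iff)
  then show "(\<lambda>p. exp (- \<beta> * real (braid_length p))) summable_on braids n"
    by (intro partition_function_summable sm) auto
next
  fix \<beta> \<phi> assume kms: "kms_state A \<sigma> \<beta> \<phi>"
  show "\<beta> = 0 \<or> - ln r \<le> \<beta>"
  proof (cases "\<beta> = 0")
    case False
    then have "ln (exp (- \<beta>)) \<le> ln r" using nec[OF kms] r by (subst ln_le_cancel_iff) auto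
    then show ?thesis by simp
  qed simp
qed (rule braid_length_eq_0_iff)

end

text \<open>The two generator inequality gives \<open>t \<le> 31 / 50\<close>, where the cofactor of the quintic is positive; so the three
  generator inequality says that \<open>1 - t / r\<close> is nonnegative.\<close>

lemma kms_quintic_bound:
  assumes dyn: "graded_dynamics (braid_monoid 4) braid_length A v \<sigma>"
    and kms: "kms_state A \<sigma> \<beta> \<phi>" and "\<beta> \<noteq> 0"
    and r: "0 < r" "r \<le> 1 / 2" and root: "poly [:1, -2, -1, 1, 1, 1:] r = 0"
  shows "exp (- \<beta>) \<le> r"
proof -
  interpret graded_dynamics "braid_monoid 4" braid_length A v \<sigma> by (rule dyn)
  define t where "t = exp (- \<beta>)"
  have t: "0 < t" "t < 1" "t + t ^ 2 \<le> 1"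
    using kms_golden_bound[OF _ dyn kms \<open>\<beta> \<noteq> 0\<close>] by (auto simp: t_def)
  have "t \<le> 31 / 50"
  proof (rule ccontr)
    assume "\<not> t \<le> 31 / 50"
    then have "31 / 50 * (31 / 50) \<le> t * t" by (intro mult_mono) auto
    then show False using t(3) \<open>\<not> t \<le> 31 / 50\<close> by (simp add: power2_eq_square)
  qed
  have gens: "braid_gen 4 1 \<in> braids 4" "braid_gen 4 2 \<in> braids 4"
      "braid_gen 4 3 \<in> braids 4" by (rule braid_gen_carrier; simp)+
  have gen_len: "braid_length (braid_gen 4 1) = 1" "braid_length (braid_gen 4 2) = 1" "braid_length (braid_gen 4 3) = 1"
    by (rule braid_length_gen; simp)+
  have lcms: "is_rlcm (braid_monoid 4) {braid_gen 4 1, braid_gen 4 2} (braid_class 4 [1, 2, 1])"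
    "is_rlcm (braid_monoid 4) {braid_gen 4 1, braid_gen 4 3} (braid_class 4 [1, 3])"
    "is_rlcm (braid_monoid 4) {braid_gen 4 2, braid_gen 4 3} (braid_class 4 [2, 3, 2])"
    using braid_rlcm_1_2[of 4] braid_rlcm_pair[of 4 1 3] braid_rlcm_pair[of 4 2 3] by (simp_all add: complement_def)
  have lens: "braid_length (braid_class 4 [1, 2, 1]) = 3" "braid_length (braid_class 4 [1, 3]) = 2"
    "braid_length (braid_class 4 [2, 3, 2]) = 3" "braid_length (braid_class 4 [1, 2, 1, 3, 2, 1]) = 6"
    by (rule braid_length_word; simp)+
  have "t ^ 1 + t ^ 1 + t ^ 1 + t ^ 6 \<le> 1 + t ^ 3 + t ^ 2 + t ^ 3"
    using kms_three_generators[OF kms gens lcms braid4_rlcm_half_twist] unfolding gen_len lens t_def .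
  then have "0 \<le> (1 - t) * poly [:1, -2, -1, 1, 1, 1:] t"
    by (simp add: algebra_simps eval_nat_numeral)
  then have "0 \<le> poly [:1, -2, -1, 1, 1, 1:] t" using t(2) by (simp only: zero_le_mult_iff) auto
  then have "0 \<le> (1 - t / r) * poly (1 - quintic_cofactor r) t"
    by (simp only: quintic_poly[OF r(1) root, symmetric])
  moreover have "0 < poly (1 - quintic_cofactor r) t"
    using quintic_cofactor_pos[of r t] r t(1) \<open>t \<le> 31 / 50\<close> by simp
  ultimately have "0 \<le> 1 - t / r" by (simp only: zero_le_mult_iff) linarith
  then show ?thesis using r(1) by (simp add: t_def field_simps)
qed

theorem corollary6p3:
  fixes n :: nat
    and A :: "'a cstar"
    and v :: "nat list set \<Rightarrow> 'a"
    and \<sigma> :: "real \<Rightarrow> 'a \<Rightarrow> 'a"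
  assumes "n \<in> {3, 4}"
    and "semigroup_cstar_algebra (braid_monoid n) A v"
    and "cstar_dynamics A \<sigma>"
    and "\<And>t p. p \<in> carrier (braid_monoid n) \<Longrightarrow>
      \<sigma> t (v p) = cscale A (exp (\<i> * complex_of_real t * of_nat (braid_length p))) (v p)"
  shows
    "(n = 3 \<longrightarrow>
        clique_polynomial 3 = [:1, -2, 0, 1:] \<and>
        smallest_positive_root (clique_polynomial 3) (sqrt 5 / 2 - 1 / 2) \<and>
        inverse_temperature_space A \<sigma> = {0} \<union> {ereal (- ln (sqrt 5 / 2 - 1 / 2))..\<infinity>}) \<and>
     (n = 4 \<longrightarrow>
        (\<exists>r. smallest_positive_root [:1, -2, -1, 1, 1, 1:] r \<and>
          inverse_temperature_space A \<sigma> = {0} \<union> {ereal (- ln r)..\<infinity>}))"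
proof (intro conjI impI)
  have dyn: "graded_dynamics (braid_monoid n) braid_length A v \<sigma>"
    by (rule graded_dynamics_braid[OF assms])
  show "clique_polynomial 3 = [:1, -2, 0, 1:]" by (rule clique_polynomial_3)
  show "smallest_positive_root (clique_polynomial 3) (sqrt 5 / 2 - 1 / 2)"
    unfolding clique_polynomial_3 by (rule golden_smallest_root)
  show "inverse_temperature_space A \<sigma> = {0} \<union> {ereal (- ln (sqrt 5 / 2 - 1 / 2))..\<infinity>}" if "n = 3"
  proof (rule inverse_temperature_space_braid[OF assms(1) dyn golden_root_bounds(1)])
    fix t :: real assume t: "0 < t" "t < sqrt 5 / 2 - 1 / 2"
    show "summable (\<lambda>k. \<bar>growth_series n $ k\<bar> * t ^ k)"
      unfolding that using t golden_root(1)[OF t(1)] by (intro growth_series_3_summable) auto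
  next
    fix \<beta> \<phi> assume "kms_state A \<sigma> \<beta> \<phi>" "\<beta> \<noteq> 0"
    from kms_golden_bound[OF assms(1) dyn this] show "exp (- \<beta>) \<le> sqrt 5 / 2 - 1 / 2"
      using golden_root(2)[of "exp (- \<beta>)"] by simp
  qed
  show "\<exists>r. smallest_positive_root [:1, -2, -1, 1, 1, 1:] r \<and>
      inverse_temperature_space A \<sigma> = {0} \<union> {ereal (- ln r)..\<infinity>}" if "n = 4"
  proof -
    obtain r :: real where r: "0 < r" "r \<le> 1 / 2" and root: "poly [:1, -2, -1, 1, 1, 1:] r = 0"
      by (rule quintic_root)
    have "inverse_temperature_space A \<sigma> = {0} \<union> {ereal (- ln r)..\<infinity>}"
    proof (rule inverse_temperature_space_braid[OF assms(1) dyn r(1)])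
      show "summable (\<lambda>k. \<bar>growth_series n $ k\<bar> * t ^ k)" if "0 < t" "t < r" for t
        unfolding \<open>n = 4\<close> using that by (intro growth_series_4_summable[OF r root]) auto
      show "exp (- \<beta>) \<le> r" if "kms_state A \<sigma> \<beta> \<phi>" "\<beta> \<noteq> 0" for \<beta> \<phi>
        using dyn that r root unfolding \<open>n = 4\<close> by (rule kms_quintic_bound)
    qed
    with quintic_smallest_root[OF r root] show ?thesis by blast
  qed
qed

end
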